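(* Let $w\in W^P\cap W^{odd}$ be such that the Schubert variety $X(w)\subset\mathrm{IG}(k,2n+1)$ satisfies $X(w)\cap X^\circ\ne\emptyset$, and let $d\ge1$ be an effective degree. Then $$\Gamma_d(X(w))=X\big(w\cdot_k O^\circ(d)\big).$$
   Context: **Geometry.** Let $1\le k\le n+1$. For $1\le i\le 2n+2$ put $\bar i=2n+3-i$. Let $\widetilde E=\mathbb{C}^{2n+2}$ with basis $e_1,\dots,e_{2n+2}$ and symplectic form with $\widetilde\omega(e_i,e_j)=\delta_{i,\bar j}$ for $i\le j$; $E=\langle e_1,\dots,e_{2n+1}\rangle$, $\omega=\widetilde\omega|_E$. $X=\mathrm{IG}(k,2n+1)$ is the variety of $k$-dimensional $\omega$-isotropic subspaces of $E$; $H_2(X,\mathbb{Z})\cong\mathbb{Z}$. $\mathrm{Sp}_{2n+1}\subset\mathrm{GL}(E)$ is the group preserving $\omega$, $B$ its subgroup of upper triangular matrices, and $X^\circ=\{V\in X:e_1\notin V\}$ (empty if $k=n+1$). **Weyl group.** $W$ is the group of permutations $w$ of $\{1,\dots,2n+2\}$ with $w(\bar i)=\overline{w(i)}$, with simple reflections $s_i$ ($1\le i\le n$, exchanging $i,i+1$ and $\bar i,\overline{i+1}$) and $s_{n+1}$ (exchanging $n+1$ and $\overline{n+1}$), and length $\ell$. $W_P=\langle s_j:j\ne k\rangle$; $W^P$ is the set of minimal length representatives of $W/W_P$; for $k\le n$ these are the $w$ with $w(1)<\dots<w(k)$ and $w(k+1)<\dots<w(n+1)\le n+1$, written $(w(1)<\dots<w(k))$.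 $W^{odd}=\{w\in W: w(j)\ne\bar1,\ 1\le j\le n+1\}$. For $w\in W^{odd}$, $X(w)$ is the closure of the $B$-orbit of $\langle e_{w(1)},\dots,e_{w(k)}\rangle$ (it depends only on $wW_P$). For $w\in W^P\cap W^{odd}$, $X(w)\cap X^\circ\neq\emptyset$ iff $w(1)\neq1$. **Modified Hecke product.** $w\cdot_k s_i=ws_i$ if $\ell(ws_i)>\ell(w)$ or $i=k$, and $w\cdot_k s_i=w$ otherwise. $O^\circ(1)=s_1s_2\cdots s_{n+1}\cdots s_2s_1$; $w\cdot_k O^\circ(1)$ is obtained by applying $\cdot_k$ successively with the letters of this word from left to right. $O^\circ(d)=O^\circ(d-1)\cdot_kO^\circ(1)$ for $d>1$, i.e. $w\cdot_kO^\circ(d)$ is obtained by applying this $d$ times. **Curve neighborhoods.** For a closed $\Omega\subset X$, $\Gamma_d(\Omega)=\mathrm{ev}_2(\mathrm{ev}_1^{-1}(\Omega))$ with reduced structure, where $\mathrm{ev}_1,\mathrm{ev}_2:\overline{\mathcal M}_{0,2}(X,d)\to X$ are the evaluation maps on the moduli space of genus 0 degree $d$ two-pointed stable maps. *)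

theory Defs
  imports
    "Jordan_Normal_Form.DL_Rank"
    "Jordan_Normal_Form.DL_Submatrix"
    "HOL-Combinatorics.Permutations"
    "HOL-Combinatorics.Transposition"
begin

section \<open>The odd symplectic Grassmannian\<close>

text \<open>
  Vectors and matrices are indexed from 0, the mathematics from 1: the basis vector
  \<open>e\<^sub>i\<close> of \<open>E = \<complex>\<^sup>2\<^sup>n\<^sup>+\<^sup>1\<close> is \<open>ev n i\<close>, and the \<open>i\<close>-th coordinate of \<open>x\<close> is \<open>x $ (i - 1)\<close>.
\<close>

definition dimE :: "nat \<Rightarrow> nat" where
  "dimE n = 2 * n + 1"

definition bar :: "nat \<Rightarrow> nat \<Rightarrow> nat" where
  "bar n i = 2 * n + 3 - i"

definition ev :: "nat \<Rightarrow> nat \<Rightarrow> complex vec" where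
  "ev n i = unit_vec (dimE n) (i - 1)"

text \<open>The value of the symplectic form of \<open>\<complex>\<^sup>2\<^sup>n\<^sup>+\<^sup>2\<close> on \<open>(e\<^sub>i, e\<^sub>j)\<close>.\<close>
definition omega_basis :: "nat \<Rightarrow> nat \<Rightarrow> nat \<Rightarrow> complex" where
  "omega_basis n i j = (if i = bar n j then (if i \<le> j then 1 else - 1) else 0)"

text \<open>Its restriction to \<open>E\<close>; the kernel is the line spanned by \<open>e\<^sub>1\<close>.\<close>
definition omega :: "nat \<Rightarrow> complex vec \<Rightarrow> complex vec \<Rightarrow> complex" where
  "omega n x y =
     (\<Sum>i = 1..dimE n. \<Sum>j = 1..dimE n. omega_basis n i j * x $ (i - 1) * y $ (j - 1))"

abbreviation VE :: "nat \<Rightarrow> (complex, complex vec) module" where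
  "VE n \<equiv> module_vec TYPE(complex) (dimE n)"

definition IG :: "nat \<Rightarrow> nat \<Rightarrow> complex vec set set" where
  "IG n k = {V. VectorSpace.subspace class_ring V (VE n)
              \<and> vectorspace.fin_dim class_ring ((VE n)\<lparr>carrier := V\<rparr>)
              \<and> vectorspace.dim class_ring ((VE n)\<lparr>carrier := V\<rparr>) = k
              \<and> (\<forall>x\<in>V. \<forall>y\<in>V. omega n x y = 0)}"

definition IG_open :: "nat \<Rightarrow> nat \<Rightarrow> complex vec set set" where
  "IG_open n k = {V \<in> IG n k. ev n 1 \<notin> V}"

text \<open>
  For \<open>V\<close> of dimension \<open>k\<close>, the \<open>k\<close> columns of a frame are necessarily a basis of \<open>V\<close>.
\<close>
definition frame :: "nat \<Rightarrow> nat \<Rightarrow> complex vec set \<Rightarrow> complex mat \<Rightarrow> bool" where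
  "frame n k V A \<longleftrightarrow> A \<in> carrier_mat (dimE n) k \<and> vec_space.col_space (dimE n) A = V"

text \<open>
  Pluecker coordinates, indexed by the \<open>k\<close>-subsets of the set of row indices (other
  indices give 0, so that polynomials in all coordinates may be used below).
  Changing the frame multiplies all of them by a common nonzero factor.
\<close>
definition pluecker :: "nat \<Rightarrow> nat \<Rightarrow> complex mat \<Rightarrow> nat set \<Rightarrow> complex" where
  "pluecker n k A I =
     (if I \<subseteq> {..<dimE n} \<and> card I = k then det (submatrix A I UNIV) else 0)"

text \<open>Homogeneous polynomial functions of a given degree in variables indexed by \<open>'v\<close>.\<close>
inductive hom_poly :: "nat \<Rightarrow> (('v \<Rightarrow> complex) \<Rightarrow> complex) \<Rightarrow> bool" where
  const: "hom_poly 0 (\<lambda>x. c)"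
| var: "hom_poly 1 (\<lambda>x. x v)"
| add: "hom_poly m F \<Longrightarrow> hom_poly m G \<Longrightarrow> hom_poly m (\<lambda>x. F x + G x)"
| mult: "hom_poly l F \<Longrightarrow> hom_poly m G \<Longrightarrow> hom_poly (l + m) (\<lambda>x. F x * G x)"

definition vanishes_at ::
    "nat \<Rightarrow> nat \<Rightarrow> ((nat set \<Rightarrow> complex) \<Rightarrow> complex) \<Rightarrow> complex vec set \<Rightarrow> bool" where
  "vanishes_at n k F V \<longleftrightarrow> (\<forall>A. frame n k V A \<longrightarrow> F (pluecker n k A) = 0)"

text \<open>Zariski closure in \<open>IG n k\<close>, a projective variety via the Pluecker embedding.\<close>
definition zariski_closure ::
    "nat \<Rightarrow> nat \<Rightarrow> complex vec set set \<Rightarrow> complex vec set set" where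
  "zariski_closure n k S =
     {V \<in> IG n k. \<forall>m F. hom_poly m F \<longrightarrow> (\<forall>U\<in>S. vanishes_at n k F U) \<longrightarrow> vanishes_at n k F V}"

section \<open>Weyl group\<close>

definition weyl :: "nat \<Rightarrow> (nat \<Rightarrow> nat) set" where
  "weyl n = {w. w permutes {1..2 * n + 2} \<and> (\<forall>i\<in>{1..2 * n + 2}. w (bar n i) = bar n (w i))}"

definition srefl :: "nat \<Rightarrow> nat \<Rightarrow> nat \<Rightarrow> nat" where
  "srefl n i =
     (if i \<le> n then Transposition.transpose i (i + 1) \<circ> Transposition.transpose (bar n i) (bar n (i + 1))
      else Transposition.transpose (n + 1) (bar n (n + 1)))"

definition word_prod :: "nat \<Rightarrow> nat list \<Rightarrow> nat \<Rightarrow> nat" where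
  "word_prod n is = foldr (\<lambda>i v. srefl n i \<circ> v) is id"

definition wlength :: "nat \<Rightarrow> (nat \<Rightarrow> nat) \<Rightarrow> nat" where
  "wlength n w = (LEAST r. \<exists>is. set is \<subseteq> {1..n + 1} \<and> length is = r \<and> w = word_prod n is)"

text \<open>The simple reflections are involutions, so words suffice to generate the subgroup.\<close>
definition weyl_P :: "nat \<Rightarrow> nat \<Rightarrow> (nat \<Rightarrow> nat) set" where
  "weyl_P n k = {word_prod n is | is. set is \<subseteq> {1..n + 1} - {k}}"

definition min_reps :: "nat \<Rightarrow> nat \<Rightarrow> (nat \<Rightarrow> nat) set" where
  "min_reps n k = {w \<in> weyl n. \<forall>u\<in>weyl_P n k. wlength n w \<le> wlength n (w \<circ> u)}"

definition weyl_odd :: "nat \<Rightarrow> (nat \<Rightarrow> nat) set" where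
  "weyl_odd n = {w \<in> weyl n. \<forall>j\<in>{1..n + 1}. w j \<noteq> bar n 1}"

definition hecke :: "nat \<Rightarrow> nat \<Rightarrow> (nat \<Rightarrow> nat) \<Rightarrow> nat \<Rightarrow> (nat \<Rightarrow> nat)" where
  "hecke n k w i =
     (if wlength n (w \<circ> srefl n i) > wlength n w \<or> i = k then w \<circ> srefl n i else w)"

text \<open>\<open>1, 2, \<dots>, n + 1, \<dots>, 2, 1\<close>\<close>
definition O_word :: "nat \<Rightarrow> nat list" where
  "O_word n = [1..<n + 2] @ rev [1..<n + 1]"

definition hecke_O :: "nat \<Rightarrow> nat \<Rightarrow> nat \<Rightarrow> (nat \<Rightarrow> nat) \<Rightarrow> (nat \<Rightarrow> nat)" where
  "hecke_O n k d w = ((\<lambda>v. foldl (hecke n k) v (O_word n)) ^^ d) w"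

section \<open>Schubert varieties\<close>

definition Sp_odd :: "nat \<Rightarrow> complex mat set" where
  "Sp_odd n = {g \<in> carrier_mat (dimE n) (dimE n). invertible_mat g \<and>
     (\<forall>x\<in>carrier_vec (dimE n). \<forall>y\<in>carrier_vec (dimE n).
        omega n (g *\<^sub>v x) (g *\<^sub>v y) = omega n x y)}"

definition borel :: "nat \<Rightarrow> complex mat set" where
  "borel n = {g \<in> Sp_odd n. upper_triangular g}"

definition coord_subspace :: "nat \<Rightarrow> nat \<Rightarrow> (nat \<Rightarrow> nat) \<Rightarrow> complex vec set" where
  "coord_subspace n k w =
     LinearCombinations.module.span class_ring (VE n) ((\<lambda>i. ev n (w i)) ` {1..k})"

definition schubert :: "nat \<Rightarrow> nat \<Rightarrow> (nat \<Rightarrow> nat) \<Rightarrow> complex vec set set" where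
  "schubert n k w = zariski_closure n k {(\<lambda>x. g *\<^sub>v x) ` coord_subspace n k w | g. g \<in> borel n}"

section \<open>Two-pointed stable maps of genus 0\<close>

text \<open>
  A point of \<open>\<P>\<^sup>1\<close> is given by homogeneous coordinates, a nonzero pair up to scaling.
\<close>
definition P1_coords :: "(complex \<times> complex) set" where
  "P1_coords = UNIV - {(0, 0)}"

definition P1_eq :: "complex \<times> complex \<Rightarrow> complex \<times> complex \<Rightarrow> bool" where
  "P1_eq p q \<longleftrightarrow> fst p * snd q = fst q * snd p"

definition binary_form :: "nat \<Rightarrow> (nat \<Rightarrow> complex) \<Rightarrow> complex \<times> complex \<Rightarrow> complex" where
  "binary_form m c p = (\<Sum>j\<le>m. c j * fst p ^ j * snd p ^ (m - j))"

text \<open>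
  Morphisms \<open>\<P>\<^sup>1 \<rightarrow> IG n k\<close> of degree \<open>m\<close>: in Pluecker coordinates they are given by binary
  forms \<open>c I\<close> of degree \<open>m\<close>. The forms have no common zero, and \<open>f\<close> is constant on
  proportional pairs, because the Pluecker coordinates of a frame are not all zero and
  determine the subspace. Frames can be rescaled when \<open>k \<ge> 1\<close>, so proportionality of
  Pluecker vectors is expressed by equality for some frame. The generator of
  \<open>H\<^sub>2(X, \<int>) \<cong> \<int>\<close> is the class of a line, so that the degree of a curve is its degree in
  the Pluecker embedding.
\<close>
definition P1_morphism ::
    "nat \<Rightarrow> nat \<Rightarrow> nat \<Rightarrow> (complex \<times> complex \<Rightarrow> complex vec set) \<Rightarrow> bool" where
  "P1_morphism n k m f \<longleftrightarrow>
     (\<forall>p\<in>P1_coords. f p \<in> IG n k) \<and>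
     (\<exists>c. \<forall>p\<in>P1_coords. \<exists>A. frame n k (f p) A \<and>
        (\<forall>I. I \<subseteq> {..<dimE n} \<and> card I = k \<longrightarrow> pluecker n k A I = binary_form m (c I) p))"

text \<open>
  A complex nodal curve of arithmetic genus 0 is a tree of projective lines. The components
  are the vertices; \<open>(u, v) \<in> adj\<close> says that \<open>u\<close> and \<open>v\<close> meet in a node, which is the point
  \<open>node u v\<close> on \<open>u\<close> and \<open>node v u\<close> on \<open>v\<close>. The marked point \<open>i \<in> {1, 2}\<close> is the point
  \<open>mark_pt i\<close> of the component \<open>mark_comp i\<close>, and \<open>cmap v\<close> is the restriction of the map to
  \<open>v\<close>, of degree \<open>cdeg v\<close>.
\<close>
record marked_map =
  comps :: "nat set"
  adj :: "(nat \<times> nat) set"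
  node :: "nat \<Rightarrow> nat \<Rightarrow> complex \<times> complex"
  mark_comp :: "nat \<Rightarrow> nat"
  mark_pt :: "nat \<Rightarrow> complex \<times> complex"
  cmap :: "nat \<Rightarrow> complex \<times> complex \<Rightarrow> complex vec set"
  cdeg :: "nat \<Rightarrow> nat"

text \<open>
  \<open>adj\<close> contains both orientations of each edge; a connected graph is a tree iff it has one
  edge less than vertices, i.e. iff the nodal curve has arithmetic genus 0.
\<close>
definition tree_of_lines :: "marked_map \<Rightarrow> bool" where
  "tree_of_lines C \<longleftrightarrow>
     finite (comps C) \<and> comps C \<noteq> {} \<and>
     adj C \<subseteq> comps C \<times> comps C \<and> sym (adj C) \<and> irrefl (adj C) \<and>
     (\<forall>u\<in>comps C. \<forall>v\<in>comps C. (u, v) \<in> (adj C)\<^sup>*) \<and>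
     card (adj C) = 2 * (card (comps C) - 1)"

text \<open>Special points on a component: \<open>Inl u\<close> is the node with \<open>u\<close>, \<open>Inr i\<close> the marking \<open>i\<close>.\<close>
definition specials :: "marked_map \<Rightarrow> nat \<Rightarrow> (nat + nat) set" where
  "specials C v = Inl ` {u. (v, u) \<in> adj C} \<union> Inr ` {i \<in> {1, 2}. mark_comp C i = v}"

definition special_pt :: "marked_map \<Rightarrow> nat \<Rightarrow> nat + nat \<Rightarrow> complex \<times> complex" where
  "special_pt C v a = (case a of Inl u \<Rightarrow> node C v u | Inr i \<Rightarrow> mark_pt C i)"

text \<open>The closed points of \<open>M\<^sub>0\<^sub>,\<^sub>2(X, d)\<close> (compactified) are the isomorphism classes of these.\<close>
definition stable_maps :: "nat \<Rightarrow> nat \<Rightarrow> nat \<Rightarrow> marked_map set" where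
  "stable_maps n k d = {C.
     tree_of_lines C \<and>
     mark_comp C 1 \<in> comps C \<and> mark_comp C 2 \<in> comps C \<and>
     (\<forall>v\<in>comps C. \<forall>a\<in>specials C v. special_pt C v a \<in> P1_coords) \<and>
     (\<forall>v\<in>comps C. \<forall>a\<in>specials C v. \<forall>b\<in>specials C v.
        a \<noteq> b \<longrightarrow> \<not> P1_eq (special_pt C v a) (special_pt C v b)) \<and>
     (\<forall>v\<in>comps C. P1_morphism n k (cdeg C v) (cmap C v)) \<and>
     (\<forall>(u, v)\<in>adj C. cmap C u (node C u v) = cmap C v (node C v u)) \<and>
     (\<forall>v\<in>comps C. cdeg C v = 0 \<longrightarrow> card (specials C v) \<ge> 3) \<and>
     (\<Sum>v\<in>comps C. cdeg C v) = d}"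

definition eval_mark :: "nat \<Rightarrow> marked_map \<Rightarrow> complex vec set" where
  "eval_mark i C = cmap C (mark_comp C i) (mark_pt C i)"

text \<open>With its reduced structure, the curve neighborhood is determined by its closed points.\<close>
definition curve_nbhd ::
    "nat \<Rightarrow> nat \<Rightarrow> nat \<Rightarrow> complex vec set set \<Rightarrow> complex vec set set" where
  "curve_nbhd n k d \<Omega> = eval_mark 2 ` {C \<in> stable_maps n k d. eval_mark 1 C \<in> \<Omega>}"

end

(* Write r V j for the dimension of the intersection of V with the span of e_1, ..., e_j. The Schubert
   variety X(w) consists of the V with r V j >= r_w j for all j, where r_w counts the values of
   w(1), ..., w(k) that are at most j: a subspace of smaller type is a limit of subspaces of larger type
   along a root subgroup, and the types below w are connected by such moves. A curve of degree d joining
   V to V' forces r V' j >= r V j - d, because a Pluecker coordinate nonzero at V' vanishes at V to order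
   r V j - r V' j. Conversely, if r V' j >= r_w j - 1 for all j and 1 is not among w(1), ..., w(k), then
   a hyperplane A of V' can be enlarged inside its orthogonal space to a point of X(w), so V' lies on a
   line meeting X(w). Hence the curve neighborhood of degree d is given by the conditions
   r V' j >= r_w j - d, and multiplying by O(1) replaces the least of w(1), ..., w(k) by the
   largest admissible value, which lowers these conditions by exactly one. *)
theory Submission
  imports Defs
begin

section \<open>Subsets of leading positions\<close>

text \<open>Everything about V is read off its set of leading positions: an upper triangular
  symplectic matrix takes the coordinate subspace on these positions to V. This reduces the geometry
  to k-subsets of {0..2n} that contain no pair i, 2n+1-i, and r V j becomes
  \<open>cnt (leads V) j\<close>. Lowering the conditions by one needs care, since every
  k-dimensional V has r V j >= k - (2n+1-j): the new bound is the maximum of r_w j - 1 and this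
  forced value, which any k-subset of {0..2n} respects. The step must also be repeatable. That X(w)
  contains some V without e_1 forces k <= n and w(k+1) = 1. One pass of the word parks the value 1
  at place k and returns it to place k+1, so its partner 2n+2 is again outside the first k places
  and each product describes isotropic subspaces of E. Finally a chain of fewer than d lines has to
  be completed to degree exactly d: the surplus goes into a multiple cover of a line or, if V'
  itself lies in X(w), into a tail on a contracted component.\<close>

definition cnt :: "nat set \<Rightarrow> nat \<Rightarrow> nat" where
  "cnt S j = card (S \<inter> {..<j})"

text \<open>The Schubert condition: if \<open>S\<close> is the type of w, the V in
  \<open>IG n k\<close> with \<open>dominated (leads V) S\<close> will turn out to form X(w). The
  set \<open>T\<close> lies to the left of \<open>S\<close>.\<close>

definition dominated :: "nat set \<Rightarrow> nat set \<Rightarrow> bool" where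
  "dominated T S \<longleftrightarrow> (\<forall>j. cnt S j \<le> cnt T j)"

text \<open>Positions are counted from 0, so \<open>i\<close> is paired with \<open>2 * n + 1 - i\<close>; the position 0 of the
  kernel of the form has no partner in range.\<close>
definition admissible :: "nat \<Rightarrow> nat set \<Rightarrow> bool" where
  "admissible n S \<longleftrightarrow> S \<subseteq> {..2 * n} \<and> (\<forall>i\<in>S. 2 * n + 1 - i \<notin> S)"

section \<open>Counting elements below a position\<close>

lemma cnt_0 [simp]: "cnt S 0 = 0"
  by (simp add: cnt_def)

lemma cnt_Suc: "cnt S (Suc j) = cnt S j + (if j \<in> S then 1 else 0)"
proof -
  have "S \<inter> {..<Suc j} = (if j \<in> S then insert j (S \<inter> {..<j}) else S \<inter> {..<j})"
    by (auto simp: less_Suc_eq)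
  then show ?thesis by (simp add: cnt_def)
qed

lemma cnt_full: "S \<subseteq> {..<j} \<Longrightarrow> cnt S j = card S"
  by (simp add: cnt_def Int_absorb2)

lemma cnt_move:
  assumes "a \<in> T" "b \<notin> T" "a < b"
  shows "cnt T j = cnt (insert b (T - {a})) j + (if a < j \<and> j \<le> b then 1 else 0)"
  using assms by (induction j) (auto simp: cnt_Suc less_Suc_eq Suc_le_eq le_less)

lemma cnt_insert: "a \<notin> T \<Longrightarrow> cnt (insert a T) j = cnt T j + (if a < j then 1 else 0)"
  by (induction j) (auto simp: cnt_Suc less_Suc_eq less_Suc_eq_le)

lemma cnt_compl: "cnt T j + card (T \<inter> {j..m}) = card T" if "T \<subseteq> {..m}"
proof -
  have "T = (T \<inter> {..<j}) \<union> (T \<inter> {j..m})" using that by auto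
  moreover have "finite T" using that finite_subset by blast
  ultimately show ?thesis unfolding cnt_def
    by (metis (no_types, lifting) Int_Un_distrib card_Un_disjoint finite_Int disjoint_iff Int_iff atLeastAtMost_iff lessThan_iff not_le)
qed

lemma admissible_finite: "admissible n S \<Longrightarrow> finite S"
  unfolding admissible_def using finite_subset by blast

text \<open>On a maximal interval \<open>{a\<^sub>0<..c}\<close> where \<open>cnt S < cnt T\<close>, let \<open>p\<close> be the last element of \<open>T\<close> up to
  \<open>c\<close>. If some \<open>e\<close> in \<open>{p<..c}\<close> is free, \<open>p\<close> moves to \<open>e\<close>. Otherwise the partners of \<open>{p<..c}\<close> lie in
  \<open>T\<close> and the strict inequality also holds there, so that \<open>p\<close> and the partner of \<open>p + 1\<close> can both
  move up by one.\<close>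
lemma raising_move:
  assumes S: "admissible n S" and T: "admissible n T" and card: "card S = card T"
    and dom: "dominated T S" and ne: "S \<noteq> T"
  shows "\<exists>a b U. a \<in> T \<and> a < b \<and> b \<notin> T \<and> b \<le> 2 * n \<and> dominated U S \<and> admissible n U \<and>
    card U = card T \<and> \<Sum>T < \<Sum>U \<and>
    (((2 * n + 1 - b = a \<or> 2 * n + 1 - b \<notin> T) \<and> U = insert b (T - {a})) \<or>
     (1 \<le> a \<and> 2 * n + 1 - b \<in> T - {a} \<and>
      U = insert (2 * n + 1 - a) (insert b (T - {a}) - {2 * n + 1 - b})))"
proof -
  let ?b = "\<lambda>i. 2 * n + 1 - i"
  have dom': "cnt S j \<le> cnt T j" for j using dom by (simp add: dominated_def)
  have Ss: "S \<subseteq> {..<2 * n + 1}" and Ts: "T \<subseteq> {..<2 * n + 1}"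
    using S T by (auto simp: admissible_def less_Suc_eq_le)
  have fT: "finite T" using T by (rule admissible_finite)
  have end_eq: "cnt S (2 * n + 1) = cnt T (2 * n + 1)"
    using cnt_full[OF Ss] cnt_full[OF Ts] card by simp
  have "\<exists>j. cnt S j \<noteq> cnt T j"
  proof (rule ccontr)
    assume "\<not> ?thesis"
    then have "i \<in> S \<longleftrightarrow> i \<in> T" for i
      using cnt_Suc[of S i] cnt_Suc[of T i] by (auto split: if_splits)
    then show False using ne by auto
  qed
  then obtain j0 where j0: "cnt S j0 \<noteq> cnt T j0" "\<And>j. j < j0 \<Longrightarrow> cnt S j = cnt T j"
    using exists_least_iff[of "\<lambda>j. cnt S j \<noteq> cnt T j"] by blast
  then have "j0 \<noteq> 0" by (metis cnt_0)
  then obtain a0 where a0: "j0 = Suc a0" by (cases j0) auto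
  have a0T: "a0 \<in> T" and a0S: "a0 \<notin> S"
    using j0(1) j0(2)[of a0] dom'[of "Suc a0"] by (auto simp: a0 cnt_Suc split: if_splits)
  have "\<exists>c. a0 < c \<and> cnt S (Suc c) = cnt T (Suc c)"
  proof -
    have "a0 \<noteq> 2 * n" using end_eq j0(1) a0 by auto
    then have "a0 < 2 * n" using a0T Ts by auto
    then show ?thesis using end_eq by auto
  qed
  then obtain c where c: "a0 < c" "cnt S (Suc c) = cnt T (Suc c)"
    and cmin: "\<And>e. e < c \<Longrightarrow> a0 < e \<Longrightarrow> cnt S (Suc e) \<noteq> cnt T (Suc e)"
    using exists_least_iff[of "\<lambda>c. a0 < c \<and> cnt S (Suc c) = cnt T (Suc c)"] by blast
  have D: "cnt S j < cnt T j" if "a0 < j" "j \<le> c" for j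
  proof (cases "j = Suc a0")
    case True
    then show ?thesis using j0(1) a0 dom'[of j] by simp
  next
    case False
    with that obtain e where "j = Suc e" "a0 < e" "e < c" by (cases j) auto
    then show ?thesis using cmin[of e] dom'[of j] by simp
  qed
  have cS: "c \<in> S" and cT: "c \<notin> T"
    using D[OF c(1)] c(2) by (auto simp: cnt_Suc split: if_splits)
  have c2n: "c \<le> 2 * n" using cS Ss by auto
  define p where "p = Max (T \<inter> {..c})"
  have pmem: "p \<in> T \<inter> {..c}" unfolding p_def
    by (rule Max_in) (use fT a0T c(1) in auto)
  have pge: "a0 \<le> p" unfolding p_def by (rule Max_ge) (use fT a0T c(1) in auto)
  have pgap: "e \<notin> T" if "p < e" "e \<le> c" for e
    using that Max_ge[of "T \<inter> {..c}" e] fT unfolding p_def by fastforce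
  have pT: "p \<in> T" and pc: "p < c" using pmem cT by (auto simp: order.strict_iff_order)
  show ?thesis
  proof (cases "\<exists>e. p < e \<and> e \<le> c \<and> (?b e \<notin> T \<or> ?b e = p)")
    case True
    \<comment> \<open>A target whose partner is p is allowed, because the move vacates p.\<close>
    then obtain e where e: "p < e" "e \<le> c" "?b e \<notin> T \<or> ?b e = p" by blast
    let ?U = "insert e (T - {p})"
    have eT: "e \<notin> T" using pgap e by auto
    have "dominated ?U S"
      unfolding dominated_def
    proof
      fix j
      show "cnt S j \<le> cnt ?U j"
        using cnt_move[OF pT eT e(1), of j] dom'[of j] D[of j] e pge by (auto split: if_splits)
    qed
    moreover have "admissible n ?U"
      unfolding admissible_def
    proof (intro conjI ballI)
      show "?U \<subseteq> {..2 * n}" using T e c2n by (auto simp: admissible_def)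
      fix i assume i: "i \<in> ?U"
      have "?b e \<noteq> e" by presburger
      then have e': "?b e \<notin> ?U" using e(3) by auto
      show "?b i \<notin> ?U"
      proof (cases "i = e")
        case False
        then have iT: "i \<in> T" using i by auto
        then have "i \<le> 2 * n" using Ts by auto
        then have "?b i \<noteq> e" using e' i by auto
        then show ?thesis using T iT by (auto simp: admissible_def)
      qed (use e' in simp)
    qed
    moreover have "card ?U = card T"
      using fT pT eT by (metis Diff_iff card.insert_remove card_Suc_Diff1 finite_Diff insert_Diff_single card_insert_disjoint)
    moreover have "\<Sum>T < \<Sum>?U"
      using fT pT eT e(1) by (simp add: sum.remove[OF fT pT])
    ultimately show ?thesis using pT eT e c2n by (intro exI[of _ p] exI[of _ e] exI[of _ ?U]) auto
  next
    case False
    then have all: "?b e \<in> T" "?b e \<noteq> p" if "p < e" "e \<le> c" for e using that by auto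
    \<comment> \<open>Downward induction from e = c. As c is in S, its partner is not in S, but it
      is in T, so passing it makes the inequality strict. Each further partner is in T, so the gap
      cannot close again.\<close>
    have D': "cnt S (Suc (?b e)) < cnt T (Suc (?b e))" if "p < e" "e \<le> c" for e
      using that(2,1)
    proof (induction e rule: inc_induct)
      case base
      have "?b c \<in> T" using all pc by auto
      moreover have "?b c \<notin> S" using cS S by (auto simp: admissible_def)
      ultimately show ?case using dom'[of "?b c"] by (simp add: cnt_Suc)
    next
      case (step e)
      have "?b e = Suc (?b (Suc e))" using step c2n by auto
      moreover have "?b e \<in> T" using step all by auto
      ultimately show ?case using step cnt_Suc[of S "?b e"] cnt_Suc[of T "?b e"] by simp
    qed
    \<comment> \<open>The partner of p has to be a position. For p = 0 the strict inequality would
      reach the end 2n+1, where the counts agree.\<close>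
    have p1: "1 \<le> p"
    proof (rule ccontr)
      assume "\<not> 1 \<le> p"
      then have "p = 0" by simp
      then have "cnt S (Suc (2 * n)) < cnt T (Suc (2 * n))" using D'[of 1] pc by simp
      then show False using end_eq by simp
    qed
    let ?e = "Suc p" and ?q = "2 * n - p"
    have q: "?b ?e = ?q" "?b p = Suc ?q" using pc c2n by auto
    have qT: "?q \<in> T" and qp: "?q \<noteq> p" using all[of ?e] pc q by auto
    have eT: "?e \<notin> T" using pgap pc by auto
    have q'T: "Suc ?q \<notin> T" using T pT q by (auto simp: admissible_def)
    have qe: "?q \<noteq> ?e" using qT eT by auto
    \<comment> \<open>The double move as two unit moves, p to p+1 and 2n-p to 2n-p+1. Each lowers
      the count at a single j, and strict inequality is known at both.\<close>
    let ?V = "insert ?e (T - {p})"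
    let ?U = "insert (Suc ?q) (?V - {?q})"
    have qV: "?q \<in> ?V" "Suc ?q \<notin> ?V" using qT qp q'T by auto
    have "dominated ?U S"
      unfolding dominated_def
    proof
      fix j
      have "cnt T j = cnt ?V j + (if j = ?e then 1 else 0)"
        using cnt_move[OF pT eT, of j] by (auto split: if_splits)
      moreover have "cnt ?V j = cnt ?U j + (if j = Suc ?q then 1 else 0)"
        using cnt_move[OF qV, of j] by (auto split: if_splits)
      moreover have "cnt S ?e < cnt T ?e" using D[of ?e] pge pc by auto
      moreover have "cnt S (Suc ?q) < cnt T (Suc ?q)" using D'[of ?e] pc q by auto
      ultimately show "cnt S j \<le> cnt ?U j" using dom'[of j] qp by (auto split: if_splits)
    qed
    moreover have "admissible n ?U"
      unfolding admissible_def
    proof (intro conjI ballI)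
      show "?U \<subseteq> {..2 * n}" using T p1 pc c2n by (auto simp: admissible_def)
      fix i assume i: "i \<in> ?U"
      then consider "i = Suc ?q" | "i = ?e" | "i \<in> T" "i \<noteq> p" "i \<noteq> ?q" by auto
      then show "?b i \<notin> ?U"
      proof cases
        case 1
        then have "?b i = p" using pc c2n by auto
        moreover have "p \<noteq> Suc ?q" using pc c2n by presburger
        ultimately show ?thesis using qp by auto
      next
        case 2
        then have "?b i = ?q" by simp
        then show ?thesis by simp
      next
        case 3
        then have "?b i \<notin> T" "i \<le> 2 * n" using T by (auto simp: admissible_def)
        moreover have "?b i \<noteq> Suc ?q" "?b i \<noteq> ?e" using 3 calculation p1 pc c2n by arith+
        ultimately show ?thesis by blast
      qed
    qed
    moreover have "card ?U = card T"
      using fT pT eT qV by (metis Diff_iff card.insert_remove card_Suc_Diff1 finite_Diff insert_Diff_single card_insert_disjoint finite_insert)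
    moreover have "\<Sum>T < \<Sum>?U"
    proof -
      have "\<Sum>T + 1 = \<Sum>?V" using fT pT eT by (simp add: sum.remove[OF fT pT])
      moreover have "\<Sum>?V + 1 = \<Sum>?U"
        using fT qV sum.remove[of ?V ?q "\<lambda>x. x"] by (simp del: insert_Diff_single)
      ultimately show ?thesis by simp
    qed
    ultimately show ?thesis
      using pT eT pc c2n p1 qT qp q by (intro exI[of _ p] exI[of _ ?e] exI[of _ ?U]) auto
  qed
qed

text \<open>A pigeonhole argument; i is the position of the vector that enlarges a hyperplane of
  type A to a point of the Schubert variety of type S. Let c be the element of S at which S first
  overtakes A. If every i <= c were in A or had its partner in A, the c+1 positions up to c would be
  covered by the elements of A up to c, of which there are \<open>cnt S c\<close>, and by the
  partners of elements of A from 2n+1-c on. The latter are at most as many as those of S, whose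
  partners are positions below c outside S. Together this is at most c-1.\<close>

lemma exists_free_index:
  assumes A: "admissible n A" and S: "admissible n S" and "0 \<notin> S"
    and card: "card S = Suc (card A)" and near: "\<And>j. cnt S j \<le> cnt A j + 1"
  shows "\<exists>i. i \<le> 2 * n \<and> i \<notin> A \<and> 2 * n + 1 - i \<notin> A \<and> dominated (insert i A) S"
proof -
  let ?b = "\<lambda>i. 2 * n + 1 - i"
  have Ss: "S \<subseteq> {..2 * n}" and As: "A \<subseteq> {..2 * n}" using A S by (auto simp: admissible_def)
  have "cnt A (Suc (2 * n)) < cnt S (Suc (2 * n))"
    using card Ss As by (simp add: cnt_full lessThan_Suc_atMost)
  then obtain j where j: "cnt A j < cnt S j" "\<And>i. i < j \<Longrightarrow> cnt S i \<le> cnt A i"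
    using exists_least_iff[of "\<lambda>j. cnt A j < cnt S j"] by (metis leI)
  from j(1) have "j \<noteq> 0" by (metis cnt_0 less_irrefl)
  then obtain c where c: "j = Suc c" by (cases j) auto
  have cS: "c \<in> S" using j(1) j(2)[of c] by (auto simp: c cnt_Suc split: if_splits)
  then have c1: "1 \<le> c" using \<open>0 \<notin> S\<close> by (cases c) auto
  have c2n: "c \<le> 2 * n" using cS Ss by auto
  have key: "cnt A (Suc c) = cnt S c"
    using near[of "Suc c"] j(1) cS by (simp add: c cnt_Suc)
  have "\<exists>i\<le>c. i \<notin> A \<and> ?b i \<notin> A"
  proof (rule ccontr)
    assume none: "\<not> ?thesis"
    have sub: "{..c} \<subseteq> (A \<inter> {..<Suc c}) \<union> ?b ` (A \<inter> {?b c..2 * n})"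
    proof (intro subsetI)
      fix i assume i: "i \<in> {..c}"
      show "i \<in> (A \<inter> {..<Suc c}) \<union> ?b ` (A \<inter> {?b c..2 * n})"
      proof (cases "i \<in> A")
        case False
        then have "?b i \<in> A" using none i by auto
        moreover have "i = ?b (?b i)" using i c2n by auto
        ultimately show ?thesis using i As c2n by (intro UnI2 image_eqI[of _ _ "?b i"]) auto
      qed (use i in auto)
    qed
    have fA: "finite A" using A by (rule admissible_finite)
    have "Suc c \<le> card ((A \<inter> {..<Suc c}) \<union> ?b ` (A \<inter> {?b c..2 * n}))"
      using card_mono[OF _ sub] fA by simp
    also have "\<dots> \<le> cnt A (Suc c) + card (A \<inter> {?b c..2 * n})"
      unfolding cnt_def by (rule order_trans[OF card_Un_le]) (simp add: card_image_le fA)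
    \<comment> \<open>S has one element more than A but at most one more below the partner of c,
      hence at least as many from there on.\<close>
    also have "card (A \<inter> {?b c..2 * n}) \<le> card (S \<inter> {?b c..2 * n})"
      using cnt_compl[OF As, of "?b c"] cnt_compl[OF Ss, of "?b c"] near[of "?b c"] card by linarith
    also have "card (S \<inter> {?b c..2 * n}) \<le> card ({1..<c} - S)"
    proof (rule card_inj_on_le)
      show "inj_on ?b (S \<inter> {?b c..2 * n})" by (auto simp: inj_on_def)
      show "?b ` (S \<inter> {?b c..2 * n}) \<subseteq> {1..<c} - S"
      proof
        fix x assume "x \<in> ?b ` (S \<inter> {?b c..2 * n})"
        then obtain i where i: "i \<in> S" "?b c \<le> i" "i \<le> 2 * n" "x = ?b i" by auto
        then have "x \<notin> S" using S by (auto simp: admissible_def)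
        moreover have "x \<noteq> c" using calculation cS by auto
        ultimately show "x \<in> {1..<c} - S" using i c2n by auto
      qed
    qed auto
    also have "card ({1..<c} - S) = card {1..<c} - card (S \<inter> {1..<c})"
      by (metis Diff_Int_distrib Diff_Int2 Int_commute card_Diff_subset_Int finite_Int finite_atLeastLessThan)
    also have "S \<inter> {1..<c} = S \<inter> {..<c}" using \<open>0 \<notin> S\<close> by (auto simp: Suc_le_eq intro: gr0I)
    finally have "Suc c \<le> cnt A (Suc c) + (c - 1 - cnt S c)" by (simp add: cnt_def)
    moreover have "cnt S c \<le> c - 1"
    proof -
      have "S \<inter> {..<c} \<subseteq> {1..<c}" using \<open>0 \<notin> S\<close> by (auto simp: Suc_le_eq intro: gr0I)
      then have "card (S \<inter> {..<c}) \<le> card {1..<c}" by (rule card_mono[rotated]) simp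
      then show ?thesis by (simp add: cnt_def)
    qed
    ultimately show False using key c1 by linarith
  qed
  then obtain i where i: "i \<le> c" "i \<notin> A" "?b i \<notin> A" by blast
  \<comment> \<open>Before j nothing is missing. From j on the defect is at most one, and i <= c < j
    is counted.\<close>
  have "dominated (insert i A) S"
    unfolding dominated_def
  proof
    fix l
    show "cnt S l \<le> cnt (insert i A) l"
      using near[of l] j(2)[of l] i(1) by (cases "l < j") (auto simp: cnt_insert[OF i(2)] c)
  qed
  then show ?thesis using i c2n by (intro exI[of _ i]) auto
qed

text \<open>The effect of O(1) on types. The maximum only avoids repetition and says nothing about
  partners; that the result is admissible for the types in question comes from the Weyl group
  elements in \<open>hecke_O_step\<close>.\<close>

definition lift_min :: "nat \<Rightarrow> nat set \<Rightarrow> nat set" where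
  "lift_min n S = insert (Max ({..2 * n} - (S - {Min S}))) (S - {Min S})"

text \<open>Moving the minimum m up to M lowers the count by one for m < j <= M. For j <= m the
  count of S is already 0. For j > M every position from j on is occupied, so the count is the least
  possible for a set of this size; this is the second term of the maximum.\<close>

lemma
  assumes S: "S \<subseteq> {..2 * n}" "S \<noteq> {}"
  shows cnt_lift_min_ge: "cnt S j \<le> cnt (lift_min n S) j + 1"
    and cnt_lift_min_le: "cnt (lift_min n S) j \<le> max (cnt S j - 1) (card S - (2 * n + 1 - j))"
    and lift_min_subset: "lift_min n S \<subseteq> {..2 * n}"
    and card_lift_min: "card (lift_min n S) = card S"
proof -
  define m where "m = Min S"
  define C where "C = {..2 * n} - (S - {m})"
  define M where "M = Max C"
  have fin: "finite S" using S(1) finite_subset by blast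
  have mS: "m \<in> S" and mle: "\<And>x. x \<in> S \<Longrightarrow> m \<le> x"
    unfolding m_def using fin S(2) by auto
  have fC: "finite C" unfolding C_def by simp
  have mC: "m \<in> C" using mS S(1) by (auto simp: C_def)
  have MC: "M \<in> C" unfolding M_def using fC mC by (intro Max_in) auto
  have mM: "m \<le> M" unfolding M_def using fC mC by (rule Max_ge)
  have above: "x \<in> S - {m}" if "M < x" "x \<le> 2 * n" for x
  proof (rule ccontr)
    assume "x \<notin> S - {m}"
    then have "x \<in> C" using that by (auto simp: C_def)
    then show False using Max_ge[OF fC, of x] that by (simp add: M_def)
  qed
  have eq: "lift_min n S = insert M (S - {m})" by (simp add: lift_min_def m_def M_def C_def)
  have MnS: "M \<notin> S - {m}" using MC by (auto simp: C_def)
  have S_eq: "S = insert m (S - {m})" using mS by auto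
  have cS: "cnt S j = cnt (S - {m}) j + (if m < j then 1 else 0)"
    using cnt_insert[of m "S - {m}" j] S_eq by (metis Diff_iff singletonI)
  have cL: "cnt (lift_min n S) j = cnt (S - {m}) j + (if M < j then 1 else 0)"
    unfolding eq using cnt_insert[OF MnS] .
  show "cnt S j \<le> cnt (lift_min n S) j + 1" using cS cL by simp
  show sub: "lift_min n S \<subseteq> {..2 * n}" unfolding eq using S MC by (auto simp: C_def)
  show card: "card (lift_min n S) = card S"
    unfolding eq using fin MnS mS by (metis card_Suc_Diff1 card_insert_disjoint finite_Diff)
  show "cnt (lift_min n S) j \<le> max (cnt S j - 1) (card S - (2 * n + 1 - j))"
  proof (cases "M < j")
    case True
    have "lift_min n S \<inter> {j..2 * n} = {j..2 * n}" using above True mM by (auto simp: eq)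
    then have "cnt (lift_min n S) j + card {j..2 * n} = card S"
      using cnt_compl[OF sub, of j] card by simp
    then show ?thesis by simp
  next
    case False
    show ?thesis
    proof (cases "m < j")
      case True
      then show ?thesis using cS cL False mM by simp
    next
      case mj: False
      have "cnt (S - {m}) j = 0" using mle mj by (force simp: cnt_def)
      then show ?thesis using cL False mj mM by simp
    qed
  qed
qed

text \<open>Each lift uses up one unit of the slack d. Where the lifted count is instead the forced
  value k - (2n+1-j), the set \<open>T\<close>, which also has k elements in {0..2n}, satisfies the
  inequality anyway.\<close>

lemma dominated_funpow_lift_min:
  assumes T: "T \<subseteq> {..2 * n}" "card T = k"
  shows "S \<subseteq> {..2 * n} \<Longrightarrow> S \<noteq> {} \<Longrightarrow> card S = k \<Longrightarrow> (\<And>j. cnt S j \<le> cnt T j + d) \<Longrightarrow>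
    dominated T ((lift_min n ^^ d) S)"
proof (induction d arbitrary: S)
  case 0
  then show ?case by (simp add: dominated_def)
next
  case (Suc d)
  have "dominated T ((lift_min n ^^ d) (lift_min n S))"
  proof (rule Suc.IH)
    show "lift_min n S \<subseteq> {..2 * n}" "card (lift_min n S) = k"
      using lift_min_subset card_lift_min Suc.prems by auto
    show "lift_min n S \<noteq> {}" by (simp add: lift_min_def)
    fix j
    have "card T - (2 * n + 1 - j) \<le> cnt T j"
      using cnt_compl[OF T(1), of j] card_mono[of "{j..2 * n}" "T \<inter> {j..2 * n}"] by simp
    moreover have "cnt S j \<le> cnt T j + Suc d" using Suc.prems by blast
    ultimately show "cnt (lift_min n S) j \<le> cnt T j + d"
      using cnt_lift_min_le[OF Suc.prems(1,2), of j] T(2) Suc.prems(3) by linarith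
  qed
  then show ?case by (simp add: funpow_swap1)
qed

section \<open>The modified Hecke product\<close>

lemma bar_bar: "i \<in> {1..2 * n + 2} \<Longrightarrow> bar n (bar n i) = i"
  by (auto simp: bar_def)

lemma weyl_permutes: "w \<in> weyl n \<Longrightarrow> w permutes {1..2 * n + 2}"
  and weyl_bar: "w \<in> weyl n \<Longrightarrow> i \<in> {1..2 * n + 2} \<Longrightarrow> w (bar n i) = bar n (w i)"
  by (auto simp: weyl_def)

lemma weyl_inj: "w \<in> weyl n \<Longrightarrow> inj w"
  by (auto dest: weyl_permutes permutes_inj)

lemma weyl_mem: "w \<in> weyl n \<Longrightarrow> i \<in> {1..2 * n + 2} \<Longrightarrow> w i \<in> {1..2 * n + 2}"
  using permutes_in_image[OF weyl_permutes] by blast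

text \<open>Both factors appear as transpositions of neighbours in increasing order, the form in
  which inversions can be counted.\<close>

lemma srefl_low:
  assumes "1 \<le> i" "i \<le> n"
  shows "srefl n i = transpose i (Suc i) \<circ> transpose (2 * n + 2 - i) (Suc (2 * n + 2 - i))"
proof -
  have b: "bar n i = Suc (2 * n + 2 - i)" "bar n (i + 1) = 2 * n + 2 - i"
    using assms by (auto simp: bar_def)
  have a: "srefl n i = transpose i (i + 1) \<circ> transpose (bar n i) (bar n (i + 1))"
    unfolding srefl_def using assms(2) by (rule if_P)
  have c: "transpose (Suc (2 * n + 2 - i)) (2 * n + 2 - i) =
      transpose (2 * n + 2 - i) (Suc (2 * n + 2 - i))"
    by (rule transpose_commute)
  show ?thesis using a unfolding b unfolding c unfolding Suc_eq_plus1[symmetric, of i] .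
qed

lemma bar_middle: "bar n (n + 1) = n + 2"
  by (simp add: bar_def)

lemma weyl_middle: "w \<in> weyl n \<Longrightarrow> w (n + 2) = bar n (w (n + 1))"
  using weyl_bar[of w n "n + 1"] unfolding bar_middle by simp

lemma srefl_top: "srefl n (n + 1) = transpose (n + 1) (n + 2)"
  unfolding srefl_def bar_middle by simp

lemma srefl_weyl:
  assumes "1 \<le> i" "i \<le> n + 1"
  shows "srefl n i \<in> weyl n"
proof (cases "i = n + 1")
  case True
  have "transpose (n + 1) (n + 2) permutes {1..2 * n + 2}"
    by (rule permutes_swap_id) auto
  moreover have "transpose (n + 1) (n + 2) (bar n j) = bar n (transpose (n + 1) (n + 2) j)"
    if "j \<in> {1..2 * n + 2}" for j
  proof -
    consider "j = n + 1" | "j = n + 2" | "j \<noteq> n + 1" "j \<noteq> n + 2" by blast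
    then show ?thesis
    proof cases
      case 3
      then have "bar n j \<noteq> n + 1" "bar n j \<noteq> n + 2" using that by (auto simp: bar_def)
      then show ?thesis using 3 by simp
    qed (simp_all add: bar_def)
  qed
  ultimately show ?thesis unfolding True srefl_top weyl_def by auto
next
  case False
  then have i: "i \<le> n" using assms by simp
  have "(transpose i (Suc i) \<circ> transpose (2 * n + 2 - i) (Suc (2 * n + 2 - i))) permutes {1..2 * n + 2}"
    by (intro permutes_compose permutes_swap_id) (use assms i in auto)
  moreover have "srefl n i (bar n j) = bar n (srefl n i j)" if "j \<in> {1..2 * n + 2}" for j
  proof -
    let ?l = "2 * n + 2 - i"
    have b: "bar n i = Suc ?l" "bar n (Suc i) = ?l" "bar n ?l = Suc i" "bar n (Suc ?l) = i"
      and d: "i \<noteq> ?l" "i \<noteq> Suc ?l" "Suc i \<noteq> ?l" "Suc i \<noteq> Suc ?l"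
      using assms i by (auto simp: bar_def)
    consider "j = i" | "j = Suc i" | "j = ?l" | "j = Suc ?l"
      | "j \<noteq> i" "j \<noteq> Suc i" "j \<noteq> ?l" "j \<noteq> Suc ?l" by blast
    then show ?thesis
    proof cases
      case 5
      then have "bar n j \<noteq> i" "bar n j \<noteq> Suc i" "bar n j \<noteq> ?l" "bar n j \<noteq> Suc ?l"
        using that i by (auto simp: bar_def)
      then show ?thesis unfolding srefl_low[OF assms(1) i] comp_def using 5
        by (simp only: transpose_apply_other not_False_eq_True)
    qed (unfold srefl_low[OF assms(1) i] comp_def,
        use b d d[symmetric] in \<open>simp_all only: transpose_apply_first transpose_apply_second
          transpose_apply_other not_False_eq_True\<close>)
  qed
  ultimately show ?thesis using srefl_low[OF assms(1) i] by (simp add: weyl_def)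
qed

lemma srefl_involutory:
  assumes "1 \<le> i" "i \<le> n + 1"
  shows "srefl n i \<circ> srefl n i = id"
proof (cases "i = n + 1")
  case True
  then show ?thesis by (simp add: srefl_top del: One_nat_def)
next
  case False
  then have "i \<le> n" using assms by simp
  then show ?thesis
    unfolding srefl_low[OF assms(1) \<open>i \<le> n\<close>]
  proof (intro ext)
    fix x
    let ?l = "2 * n + 2 - i"
    have d: "i \<noteq> ?l" "i \<noteq> Suc ?l" "Suc i \<noteq> ?l" "Suc i \<noteq> Suc ?l"
      using \<open>i \<le> n\<close> by auto
    consider "x = i" | "x = Suc i" | "x = ?l" | "x = Suc ?l"
      | "x \<noteq> i" "x \<noteq> Suc i" "x \<noteq> ?l" "x \<noteq> Suc ?l" by blast
    then show "((transpose i (Suc i) \<circ> transpose ?l (Suc ?l)) \<circ>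
        (transpose i (Suc i) \<circ> transpose ?l (Suc ?l))) x = id x"
      unfolding comp_def id_def
      by cases (use d d[symmetric] in \<open>simp_all only: transpose_apply_first transpose_apply_second
          transpose_apply_other not_False_eq_True\<close>)
  qed
qed

lemma weyl_compose:
  assumes v: "v \<in> weyl n" and w: "w \<in> weyl n"
  shows "v \<circ> w \<in> weyl n"
proof -
  have "(v \<circ> w) (bar n i) = bar n ((v \<circ> w) i)" if "i \<in> {1..2 * n + 2}" for i
    using weyl_bar[OF w that] weyl_bar[OF v weyl_mem[OF w that]] by simp
  then show ?thesis
    using permutes_compose[OF weyl_permutes[OF w] weyl_permutes[OF v]] by (simp add: weyl_def)
qed

lemma srefl_low_apply:
  assumes "1 \<le> i" "i \<le> n" "j \<in> {1..n + 1}"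
  shows "srefl n i j = transpose i (Suc i) j"
  unfolding srefl_low[OF assms(1,2)] using assms by (auto simp: transpose_def)

section \<open>Length as a count of inversions\<close>

definition inversions :: "nat \<Rightarrow> (nat \<Rightarrow> nat) \<Rightarrow> (nat \<times> nat) set" where
  "inversions m w = {(p, q). 1 \<le> p \<and> p < q \<and> q \<le> m \<and> w q < w p}"

lemma finite_inversions: "finite (inversions m w)"
  by (rule finite_subset[of _ "{1..m} \<times> {1..m}"]) (auto simp: inversions_def)

text \<open>Exchanging neighbours preserves the order of every pair of places except (i, i+1), so it
  carries the old inversions injectively to new ones and adds this pair.\<close>

lemma card_inversions_swap:
  assumes "1 \<le> i" "Suc i \<le> m" "w i < w (Suc i)"
  shows "card (inversions m (w \<circ> transpose i (Suc i))) = Suc (card (inversions m w))"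
proof -
  let ?t = "transpose i (Suc i)"
  have t: "?t (?t x) = x" for x by simp
  have rng: "Suc 0 \<le> ?t x \<longleftrightarrow> Suc 0 \<le> x" "?t x \<le> m \<longleftrightarrow> x \<le> m" for x
    using assms by (auto simp: transpose_def)
  have mono: "?t p < ?t q" if "p < q" "\<not> (p = i \<and> q = Suc i)" for p q
    using that by (auto simp: transpose_def)
  have "inversions m (w \<circ> ?t) = insert (i, Suc i) (map_prod ?t ?t ` inversions m w)"
  proof (intro equalityI subsetI)
    fix x assume x: "x \<in> inversions m (w \<circ> ?t)"
    obtain p q where pq: "x = (p, q)" by (cases x)
    show "x \<in> insert (i, Suc i) (map_prod ?t ?t ` inversions m w)"
    proof (cases "p = i \<and> q = Suc i")
      case False
      then have "(?t p, ?t q) \<in> inversions m w"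
        using x pq mono[of p q] by (auto simp: inversions_def rng)
      then show ?thesis unfolding pq
        by (intro insertI2 image_eqI[of _ _ "(?t p, ?t q)"]) auto
    qed (use pq in auto)
  next
    fix x assume "x \<in> insert (i, Suc i) (map_prod ?t ?t ` inversions m w)"
    then consider "x = (i, Suc i)" | p q where "x = (?t p, ?t q)" "(p, q) \<in> inversions m w"
      by auto
    then show "x \<in> inversions m (w \<circ> ?t)"
    proof cases
      case 1
      then show ?thesis using assms by (auto simp: inversions_def)
    next
      case 2
      then have "\<not> (p = i \<and> q = Suc i)" using assms by (auto simp: inversions_def)
      then show ?thesis using 2 mono[of p q] by (auto simp: inversions_def rng)
    qed
  qed
  moreover have "(i, Suc i) \<notin> map_prod ?t ?t ` inversions m w"
    by (auto simp: inversions_def transpose_def split: if_splits)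
  moreover have "inj (map_prod ?t ?t)" by (intro prod.inj_map) auto
  then have "card (map_prod ?t ?t ` inversions m w) = card (inversions m w)"
    by (intro card_image) (auto intro: inj_on_subset)
  ultimately show ?thesis by (simp add: finite_inversions)
qed

text \<open>Reflections in short roots change the number of inversions by 2, those in long roots only by 1.\<close>
definition twice_length :: "nat \<Rightarrow> (nat \<Rightarrow> nat) \<Rightarrow> nat" where
  "twice_length n w = card (inversions (2 * n + 2) w) + card {p \<in> {1..n + 1}. n + 1 < w p}"

text \<open>For i <= n the reflection consists of two disjoint neighbour exchanges, at i and at the
  mirrored pair; both create an inversion, and the first n+1 places are only permuted. For i = n+1
  there is one new inversion, and one more of the first n+1 values passes the middle.\<close>

lemma twice_length_ascent:
  assumes w: "w \<in> weyl n" and i: "1 \<le> i" "i \<le> n + 1" and asc: "w i < w (i + 1)"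
  shows "twice_length n (w \<circ> srefl n i) = twice_length n w + 2"
proof (cases "i = n + 1")
  case True
  have wb: "w (n + 2) = bar n (w (n + 1))"
    using w by (rule weyl_middle)
  have wm: "w (n + 1) \<in> {1..2 * n + 2}" using w by (rule weyl_mem) auto
  have le: "w (n + 1) \<le> n + 1" "n + 1 < w (n + 2)"
    using asc wb wm by (auto simp: True bar_def)
  have "card (inversions (2 * n + 2) (w \<circ> srefl n i)) = Suc (card (inversions (2 * n + 2) w))"
    using card_inversions_swap[of "n + 1" "2 * n + 2" w] asc
    by (simp add: True srefl_top[simplified])
  moreover have "{p \<in> {1..n + 1}. n + 1 < (w \<circ> srefl n i) p} =
      insert (n + 1) {p \<in> {1..n + 1}. n + 1 < w p}"
    unfolding True srefl_top using le by (auto simp: transpose_def)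
  moreover have "n + 1 \<notin> {p \<in> {1..n + 1}. n + 1 < w p}" using le by simp
  ultimately show ?thesis by (simp add: twice_length_def)
next
  case False
  then have i': "i \<le> n" using i by simp
  let ?j = "2 * n + 2 - i"
  let ?v = "w \<circ> transpose i (Suc i)"
  have s: "w \<circ> srefl n i = ?v \<circ> transpose ?j (Suc ?j)"
    unfolding srefl_low[OF i(1) i'] by (simp add: comp_assoc)
  have b: "bar n (i + 1) = ?j" "bar n i = Suc ?j" using i i' by (auto simp: bar_def)
  have "?v ?j = w ?j" "?v (Suc ?j) = w (Suc ?j)"
    using i i' by (auto simp: transpose_def)
  then have wj: "?v ?j = bar n (w (i + 1))" "?v (Suc ?j) = bar n (w i)"
    using weyl_bar[OF w, of "i + 1"] weyl_bar[OF w, of i] i i' unfolding b by auto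
  have "w i \<in> {1..2 * n + 2}" "w (i + 1) \<in> {1..2 * n + 2}"
    using weyl_mem[OF w, of i] weyl_mem[OF w, of "i + 1"] i i' by auto
  then have "?v ?j < ?v (Suc ?j)" unfolding wj using asc by (auto simp: bar_def)
  then have "card (inversions (2 * n + 2) (w \<circ> srefl n i)) = Suc (card (inversions (2 * n + 2) ?v))"
    unfolding s using i i' by (intro card_inversions_swap) auto
  moreover have "card (inversions (2 * n + 2) ?v) = Suc (card (inversions (2 * n + 2) w))"
    using i i' asc by (intro card_inversions_swap) auto
  moreover have "{p \<in> {1..n + 1}. n + 1 < (w \<circ> srefl n i) p} =
      transpose i (Suc i) ` {p \<in> {1..n + 1}. n + 1 < w p}" (is "?L = ?t ` ?R")
  proof (intro equalityI subsetI)
    fix p assume p: "p \<in> ?L"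
    then have "?t p \<in> ?R" using srefl_low_apply[OF i(1) i', of p] i i'
      by (auto simp: transpose_def split: if_splits)
    then show "p \<in> ?t ` ?R" by (intro image_eqI[of _ _ "?t p"]) auto
  next
    fix p assume "p \<in> ?t ` ?R"
    then obtain q where q: "q \<in> ?R" "p = ?t q" by blast
    then have "p \<in> {1..n + 1}" using i i' by (auto simp: transpose_def)
    then show "p \<in> ?L" using srefl_low_apply[OF i(1) i', of p] q by auto
  qed
  then have "card {p \<in> {1..n + 1}. n + 1 < (w \<circ> srefl n i) p} = card {p \<in> {1..n + 1}. n + 1 < w p}"
    by (simp add: card_image)
  ultimately show ?thesis by (simp add: twice_length_def)
qed

lemma srefl_swap:
  assumes w: "w \<in> weyl n" and i: "1 \<le> i" "i \<le> n + 1"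
  shows "(w \<circ> srefl n i) i = w (i + 1)" "(w \<circ> srefl n i) (i + 1) = w i"
  using i by (cases "i = n + 1"; simp add: srefl_top[simplified] srefl_low; auto simp: transpose_def)+

lemma twice_length_descent:
  assumes w: "w \<in> weyl n" and i: "1 \<le> i" "i \<le> n + 1" and desc: "w (i + 1) < w i"
  shows "twice_length n w = twice_length n (w \<circ> srefl n i) + 2"
proof -
  let ?v = "w \<circ> srefl n i"
  have v: "?v \<in> weyl n" by (rule weyl_compose[OF w srefl_weyl[OF i]])
  have "?v \<circ> srefl n i = w" using srefl_involutory[OF i] by (simp add: comp_assoc)
  then show ?thesis
    using twice_length_ascent[OF v i] srefl_swap[OF w i] desc by simp
qed

text \<open>Without descents the first n+1 values increase, hence w j >= j there. The last of them
  is smaller than its bar, hence at most n+1, and going down from it gives w j <= j. The bar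
  symmetry settles the other half.\<close>

lemma weyl_descent:
  assumes w: "w \<in> weyl n" and ne: "w \<noteq> id"
  shows "\<exists>i. 1 \<le> i \<and> i \<le> n + 1 \<and> w (i + 1) < w i"
proof (rule ccontr)
  assume "\<not> ?thesis"
  then have asc: "w i < w (i + 1)" if "1 \<le> i" "i \<le> n + 1" for i
    using that weyl_inj[OF w] by (metis Suc_eq_plus1 injD n_not_Suc_n nat_neq_iff)
  have wm: "w j \<in> {1..2 * n + 2}" if "1 \<le> j" "j \<le> 2 * n + 2" for j
    using weyl_mem[OF w] that by auto
  have lower: "j \<le> w j" if "1 \<le> j" "j \<le> n + 1" for j
    using that
  proof (induction j rule: dec_induct)
    case base
    then show ?case using wm[of 1] by auto
  next
    case (step j)
    then show ?case using asc[of j] by auto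
  qed
  have "w (n + 2) = bar n (w (n + 1))"
    using w by (rule weyl_middle)
  then have top: "w (n + 1) \<le> n + 1" using asc[of "n + 1"] wm[of "n + 1"] by (auto simp: bar_def)
  have upper: "w j \<le> j" if "1 \<le> j" "j \<le> n + 1" for j
    using that(2,1)
  proof (induction j rule: inc_induct)
    case (step j)
    then show ?case using asc[of j] by auto
  qed (use top in simp)
  have low: "w j = j" if "1 \<le> j" "j \<le> n + 1" for j
    using upper[OF that] lower[OF that] by simp
  have "w j = j" for j
  proof (cases "j \<in> {1..2 * n + 2}")
    case True
    show ?thesis
    proof (cases "j \<le> n + 1")
      case False
      then have "w (bar n j) = bar n j" using True by (intro low) (auto simp: bar_def)
      then have "bar n (w j) = bar n j" using weyl_bar[OF w True] by simp
      then show ?thesis using bar_bar[OF True] bar_bar[OF weyl_mem[OF w True]] by simp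
    qed (use low True in auto)
  next
    case False
    then show ?thesis using permutes_not_in[OF weyl_permutes[OF w]] by blast
  qed
  then show False using ne by auto
qed

lemma word_prod_Nil: "word_prod n [] = id"
  by (simp only: word_prod_def foldr.simps id_apply)

lemma twice_length_id: "twice_length n id = 0"
proof -
  have "inversions (2 * n + 2) id = {}" by (auto simp: inversions_def)
  moreover have "{p \<in> {1..n + 1}. n + 1 < id p} = {}" by auto
  ultimately show ?thesis by (simp only: twice_length_def card.empty add_0)
qed

lemma id_weyl: "id \<in> weyl n"
  by (auto simp only: weyl_def mem_Collect_eq permutes_id id_apply)

lemma word_prod_snoc: "word_prod n (is @ [i]) = word_prod n is \<circ> srefl n i"
  by (induction "is") (auto simp: word_prod_def comp_assoc)

lemma word_prod_bound:
  "set is \<subseteq> {1..n + 1} \<Longrightarrow>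
    word_prod n is \<in> weyl n \<and> twice_length n (word_prod n is) \<le> 2 * length is"
proof (induction "is" rule: rev_induct)
  case Nil
  show ?case unfolding word_prod_Nil twice_length_id using id_weyl by blast
next
  case (snoc i "is")
  let ?v = "word_prod n is"
  have i: "1 \<le> i" "i \<le> n + 1" and v: "?v \<in> weyl n" "twice_length n ?v \<le> 2 * length is"
    using snoc by auto
  have "twice_length n (?v \<circ> srefl n i) \<le> twice_length n ?v + 2"
  proof (cases "?v i < ?v (i + 1)")
    case False
    moreover have "?v i \<noteq> ?v (i + 1)" using weyl_inj[OF v(1)] by (metis injD add.commute add_cancel_right_left one_neq_zero)
    ultimately show ?thesis using twice_length_descent[OF v(1) i] by simp
  qed (use twice_length_ascent[OF v(1) i] in simp)
  then have "twice_length n (?v \<circ> srefl n i) \<le> 2 * length (is @ [i])" using v(2) by simp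
  then show ?case unfolding word_prod_snoc using weyl_compose[OF v(1) srefl_weyl[OF i]] by blast
qed

lemma weyl_word:
  "w \<in> weyl n \<Longrightarrow> \<exists>is. set is \<subseteq> {1..n + 1} \<and> w = word_prod n is \<and> 2 * length is = twice_length n w"
proof (induction "twice_length n w" arbitrary: w rule: less_induct)
  case less
  show ?case
  proof (cases "w = id")
    case True
    show ?thesis unfolding True using twice_length_id[of n]
      by (intro exI[of _ "[]"]) (simp add: word_prod_Nil)
  next
    case False
    then obtain i where i: "1 \<le> i" "i \<le> n + 1" "w (i + 1) < w i"
      using weyl_descent less.prems by blast
    let ?v = "w \<circ> srefl n i"
    have tw: "twice_length n w = twice_length n ?v + 2"
      using twice_length_descent[OF less.prems i] .
    moreover have "?v \<in> weyl n" by (rule weyl_compose[OF less.prems srefl_weyl[OF i(1,2)]])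
    ultimately obtain "is" where "is": "set is \<subseteq> {1..n + 1}" "?v = word_prod n is"
        "2 * length is = twice_length n ?v"
      using less.hyps[of ?v] by auto
    have "w = word_prod n (is @ [i])"
      unfolding word_prod_snoc "is"(2)[symmetric]
      using srefl_involutory[OF i(1,2)] by (simp add: comp_assoc)
    then show ?thesis using "is" i tw by (intro exI[of _ "is @ [i]"]) auto
  qed
qed

text \<open>Removing descents one by one yields a word of half this length
  (\<open>weyl_word\<close>), and no word is shorter because a letter raises
  \<open>twice_length\<close> by at most 2 (\<open>word_prod_bound\<close>).\<close>

lemma wlength_eq: "w \<in> weyl n \<Longrightarrow> 2 * wlength n w = twice_length n w"
proof -
  assume w: "w \<in> weyl n"
  obtain "is" where "is": "set is \<subseteq> {1..n + 1}" "w = word_prod n is" "2 * length is = twice_length n w"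
    using weyl_word[OF w] by blast
  have "wlength n w = length is"
    unfolding wlength_def
  proof (rule Least_equality)
    fix r assume "\<exists>is. set is \<subseteq> {1..n + 1} \<and> length is = r \<and> w = word_prod n is"
    then show "length is \<le> r" using word_prod_bound[of _ n] "is"(3) by fastforce
  qed (use "is" in auto)
  then show ?thesis using "is" by simp
qed

lemma wlength_ascent_iff:
  assumes w: "w \<in> weyl n" and i: "1 \<le> i" "i \<le> n + 1"
  shows "wlength n w < wlength n (w \<circ> srefl n i) \<longleftrightarrow> w i < w (i + 1)"
    and "wlength n w \<le> wlength n (w \<circ> srefl n i) \<longleftrightarrow> w i < w (i + 1)"
proof -
  have "w i \<noteq> w (i + 1)" using weyl_inj[OF w] by (metis injD add.commute add_cancel_right_left one_neq_zero)
  moreover have "2 * wlength n (w \<circ> srefl n i) = twice_length n (w \<circ> srefl n i)"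
    using weyl_compose[OF w srefl_weyl[OF i]] by (rule wlength_eq)
  ultimately show "wlength n w < wlength n (w \<circ> srefl n i) \<longleftrightarrow> w i < w (i + 1)"
    "wlength n w \<le> wlength n (w \<circ> srefl n i) \<longleftrightarrow> w i < w (i + 1)"
    using wlength_eq[OF w] twice_length_ascent[OF w i] twice_length_descent[OF w i]
    by (cases "w i < w (i + 1)"; simp)+
qed

section \<open>Action of Hecke words on one-line notation\<close>

lemma hecke_weyl: "w \<in> weyl n \<Longrightarrow> 1 \<le> i \<Longrightarrow> i \<le> n + 1 \<Longrightarrow> hecke n k w i \<in> weyl n"
  using weyl_compose srefl_weyl by (simp add: hecke_def)

lemma hecke_low:
  assumes w: "w \<in> weyl n" and i: "1 \<le> i" "i \<le> n"
  shows "i \<noteq> k \<Longrightarrow> hecke n k w i i = max (w i) (w (Suc i))"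
    and "i \<noteq> k \<Longrightarrow> hecke n k w i (Suc i) = min (w i) (w (Suc i))"
    and "i = k \<Longrightarrow> hecke n k w i i = w (Suc i)"
    and "i = k \<Longrightarrow> hecke n k w i (Suc i) = w i"
    and "j \<in> {1..n + 1} \<Longrightarrow> j \<noteq> i \<Longrightarrow> j \<noteq> Suc i \<Longrightarrow> hecke n k w i j = w j"
  using srefl_swap[OF w i(1), simplified] wlength_ascent_iff[OF w i(1)] i srefl_low_apply[OF i, of j]
  by (auto simp: hecke_def)

lemma hecke_top:
  assumes w: "w \<in> weyl n" and k: "k \<noteq> n + 1"
  shows "hecke n k w (n + 1) (n + 1) = max (w (n + 1)) (bar n (w (n + 1)))"
    and "j \<in> {1..n} \<Longrightarrow> hecke n k w (n + 1) j = w j"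
proof -
  have wb: "w (n + 1 + 1) = bar n (w (n + 1))"
    using weyl_middle[OF w] by simp
  show "hecke n k w (n + 1) (n + 1) = max (w (n + 1)) (bar n (w (n + 1)))"
    using srefl_swap[OF w, of "n + 1"] wlength_ascent_iff[OF w, of "n + 1"] k
    unfolding wb[symmetric] by (auto simp: hecke_def)
  show "j \<in> {1..n} \<Longrightarrow> hecke n k w (n + 1) j = w j"
    unfolding hecke_def srefl_top by (auto simp: transpose_def)
qed

lemma hecke_low_image:
  assumes "w \<in> weyl n" "1 \<le> i" "i \<le> n" "A \<subseteq> {1..n + 1}" "i \<in> A" "Suc i \<in> A"
  shows "hecke n k w i ` A = w ` A"
proof -
  have A: "A = insert i (insert (Suc i) (A - {i, Suc i}))" using assms by auto
  have 1: "hecke n k w i ` (A - {i, Suc i}) = w ` (A - {i, Suc i})"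
    using assms by (intro image_cong refl hecke_low(5)) auto
  have 2: "{hecke n k w i i, hecke n k w i (Suc i)} = {w i, w (Suc i)}"
    using hecke_low(1-4)[OF assms(1-3), of k] by (cases "i = k") (auto simp: max_def min_def)
  show ?thesis
    using 1 2 by (subst (1 2) A) (auto simp only: image_insert)
qed

text \<open>As k is not a letter here, each letter puts its two values into descending order, so the
  smaller one is passed on to the next letter as in a pass of bubble sort.\<close>

lemma foldl_hecke_up:
  assumes w: "w \<in> weyl n" and a: "1 \<le> a" "a \<le> b" "b \<le> n + 1"
    and k: "k \<notin> {a..<b}"
  defines "v \<equiv> foldl (hecke n k) w [a..<b]"
  shows "v \<in> weyl n \<and> v ` {a..b} = w ` {a..b} \<and> v b = Min (w ` {a..b}) \<and>
    (\<forall>i\<in>{1..n + 1} - {a..b}. v i = w i)"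
  using a(2,3) k unfolding v_def
proof (induction b rule: dec_induct)
  case base
  then show ?case using w by simp
next
  case (step b)
  let ?v = "foldl (hecke n k) w [a..<b]"
  let ?u = "hecke n k ?v b"
  have IH0: "?v \<in> weyl n \<and> ?v ` {a..b} = w ` {a..b} \<and> ?v b = Min (w ` {a..b}) \<and>
      (\<forall>i\<in>{1..n + 1} - {a..b}. ?v i = w i)"
    by (rule step.IH) (use step in auto)
  have IH: "?v \<in> weyl n" "?v ` {a..b} = w ` {a..b}" "?v b = Min (w ` {a..b})"
    "\<And>i. i \<in> {1..n + 1} - {a..b} \<Longrightarrow> ?v i = w i"
    using IH0 by blast+
  have b: "1 \<le> b" "b \<le> n" "b \<noteq> k" using step a by auto
  have eq: "{a..Suc b} = insert (Suc b) {a..b}" using step by auto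
  have "?v (Suc b) = w (Suc b)" using IH(4)[of "Suc b"] b by auto
  then have img: "?v ` {a..Suc b} = w ` {a..Suc b}" unfolding eq by (simp add: IH(2))
  have "?u (Suc b) = min (Min (w ` {a..b})) (w (Suc b))"
    using hecke_low(2)[OF IH(1) b(1,2,3)] IH(3) \<open>?v (Suc b) = w (Suc b)\<close> by simp
  also have "\<dots> = Min (w ` {a..Suc b})"
    unfolding eq using step by (simp add: min.commute)
  finally have "?u (Suc b) = Min (w ` {a..Suc b})" .
  moreover have "?u ` {a..Suc b} = w ` {a..Suc b}"
    using hecke_low_image[OF IH(1) b(1,2), of "{a..Suc b}" k] step a img by auto
  moreover have "?u i = w i" if "i \<in> {1..n + 1} - {a..Suc b}" for i
    using hecke_low(5)[OF IH(1) b(1,2), of i k] IH(4)[of i] that step by auto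
  moreover have "?u \<in> weyl n" using hecke_weyl[OF IH(1)] b by auto
  moreover have "[a..<Suc b] = [a..<b] @ [b]" using step by simp
  ultimately show ?case by simp
qed

lemma foldl_hecke_down:
  assumes w: "w \<in> weyl n" and a: "1 \<le> a" "a \<le> b" "b \<le> n + 1"
    and k: "k \<notin> {a..<b}"
  defines "v \<equiv> foldl (hecke n k) w (rev [a..<b])"
  shows "v \<in> weyl n \<and> v ` {a..b} = w ` {a..b} \<and> v a = Max (w ` {a..b}) \<and>
    (\<forall>i\<in>{1..n + 1} - {a..b}. v i = w i)"
  using a(2,1) k unfolding v_def
proof (induction a rule: inc_induct)
  case base
  then show ?case using w by simp
next
  case (step a)
  let ?v = "foldl (hecke n k) w (rev [Suc a..<b])"
  let ?u = "hecke n k ?v a"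
  have IH0: "?v \<in> weyl n \<and> ?v ` {Suc a..b} = w ` {Suc a..b} \<and> ?v (Suc a) = Max (w ` {Suc a..b}) \<and>
      (\<forall>i\<in>{1..n + 1} - {Suc a..b}. ?v i = w i)"
    by (rule step.IH) (use step in auto)
  have IH: "?v \<in> weyl n" "?v ` {Suc a..b} = w ` {Suc a..b}" "?v (Suc a) = Max (w ` {Suc a..b})"
    "\<And>i. i \<in> {1..n + 1} - {Suc a..b} \<Longrightarrow> ?v i = w i"
    using IH0 by blast+
  have b: "1 \<le> a" "a \<le> n" "a \<noteq> k" using step a(3) by auto
  have eq: "{a..b} = insert a {Suc a..b}" using step by auto
  have "?v a = w a" using IH(4)[of a] b by auto
  then have img: "?v ` {a..b} = w ` {a..b}" unfolding eq by (simp add: IH(2))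
  have "?u a = max (w a) (Max (w ` {Suc a..b}))"
    using hecke_low(1)[OF IH(1) b(1,2,3)] IH(3) \<open>?v a = w a\<close> by simp
  also have "\<dots> = Max (w ` {a..b})"
    unfolding eq using step by simp
  finally have "?u a = Max (w ` {a..b})" .
  moreover have "?u ` {a..b} = w ` {a..b}"
    using hecke_low_image[OF IH(1) b(1,2), of "{a..b}" k] step a(3) img by auto
  moreover have "?u i = w i" if "i \<in> {1..n + 1} - {a..b}" for i
    using hecke_low(5)[OF IH(1) b(1,2), of i k] IH(4)[of i] that step by auto
  moreover have "?u \<in> weyl n" using hecke_weyl[OF IH(1)] b by auto
  moreover have "rev [a..<b] = rev [Suc a..<b] @ [a]" using step by (simp add: upt_rec)
  ultimately show ?case by simp
qed

text \<open>The leading positions of the coordinate subspace of w; subtracting 1 passes to positions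
  counted from 0.\<close>

definition index_set :: "nat \<Rightarrow> (nat \<Rightarrow> nat) \<Rightarrow> nat set" where
  "index_set k w = (\<lambda>i. w i - 1) ` {1..k}"

lemma O_word_split:
  assumes "1 \<le> k" "k \<le> n"
  shows "O_word n = [1..<k] @ [k] @ [Suc k..<n + 1] @ [n + 1] @ rev [Suc k..<n + 1] @ [k] @ rev [1..<k]"
proof -
  have "k + (n + 1 - k) = n + 1" using assms by simp
  then have "[1..<n + 1] = [1..<k] @ [k..<n + 1]"
    using upt_add_eq_append[OF assms(1), of "n + 1 - k"] by simp
  also have "[k..<n + 1] = k # [Suc k..<n + 1]" using assms by (intro upt_conv_Cons) simp
  finally have eq: "[1..<n + 1] = [1..<k] @ [k] @ [Suc k..<n + 1]" by simp
  have "[1..<n + 2] = [1..<n + 1] @ [n + 1]" using upt_Suc_append[of 1 "n + 1"] by simp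
  then show ?thesis unfolding O_word_def eq by simp
qed

text \<open>The word is cut at the two letters k. First the minimum m of the values at places 1..k
  travels to place k and is exchanged with the 1 at place k+1. Then the letters above k act on the
  places k+1..n+1 only: they carry the minimum of this block to place n+1, replace it by its bar if
  that is larger, and bring the maximum M of the block back to place k+1. The second letter k
  exchanges M with the 1 waiting at place k. So the first k places lose m and gain M, and it remains
  to see that M is the largest value up to 2n+1 outside the others.\<close>

lemma hecke_O_step:
  assumes w: "w \<in> weyl n" and k: "1 \<le> k" "k \<le> n" and one: "w (Suc k) = 1"
  defines "w' \<equiv> foldl (hecke n k) w (O_word n)"
  shows "w' \<in> weyl n" "w' (Suc k) = 1" "index_set k w' = lift_min n (index_set k w)"
proof -
  define f1 where "f1 = foldl (hecke n k) w [1..<k]"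
  define f2 where "f2 = hecke n k f1 k"
  define f3 where "f3 = foldl (hecke n k) f2 [Suc k..<n + 1]"
  define f4 where "f4 = hecke n k f3 (n + 1)"
  define f5 where "f5 = foldl (hecke n k) f4 (rev [Suc k..<n + 1])"
  define f6 where "f6 = hecke n k f5 k"
  have w': "w' = foldl (hecke n k) f6 (rev [1..<k])"
    unfolding w'_def O_word_split[OF k] f6_def f5_def f4_def f3_def f2_def f1_def by simp
  define m where "m = Min (w ` {1..k})"
  define M where "M = Max (f4 ` {Suc k..n + 1})"
  have f1: "f1 \<in> weyl n" "f1 ` {1..k} = w ` {1..k}" "f1 k = m"
    "\<And>i. i \<in> {1..n + 1} \<Longrightarrow> k < i \<Longrightarrow> f1 i = w i"
    using foldl_hecke_up[OF w, of 1 k k] k unfolding f1_def m_def by auto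
  have f2: "f2 \<in> weyl n" "f2 k = 1" "f2 (Suc k) = m"
    "\<And>i. i \<in> {1..n + 1} \<Longrightarrow> i \<noteq> k \<Longrightarrow> i \<noteq> Suc k \<Longrightarrow> f2 i = f1 i"
    using hecke_low(3,4)[OF f1(1) k, of k] hecke_low(5)[OF f1(1) k] hecke_weyl[OF f1(1)] f1(3)
      f1(4)[of "Suc k"] one k
    unfolding f2_def by auto
  have f3: "f3 \<in> weyl n" "f3 ` {Suc k..n + 1} = f2 ` {Suc k..n + 1}"
    "f3 (n + 1) = Min (f2 ` {Suc k..n + 1})" "\<And>i. i \<in> {1..k} \<Longrightarrow> f3 i = f2 i"
    using foldl_hecke_up[OF f2(1), of "Suc k" "n + 1" k] k unfolding f3_def by auto
  have f4: "f4 \<in> weyl n" "f4 (n + 1) = max (f3 (n + 1)) (bar n (f3 (n + 1)))"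
    "\<And>i. i \<in> {1..n} \<Longrightarrow> f4 i = f3 i"
    using hecke_top[OF f3(1), of k] hecke_weyl[OF f3(1), of "n + 1"] k unfolding f4_def by auto
  have f5: "f5 \<in> weyl n" "f5 (Suc k) = M" "\<And>i. i \<in> {1..k} \<Longrightarrow> f5 i = f4 i"
    using foldl_hecke_down[OF f4(1), of "Suc k" "n + 1" k] k unfolding f5_def M_def by auto
  have f6: "f6 \<in> weyl n" "f6 k = M" "f6 (Suc k) = f5 k"
    "\<And>i. i \<in> {1..n + 1} \<Longrightarrow> i \<noteq> k \<Longrightarrow> i \<noteq> Suc k \<Longrightarrow> f6 i = f5 i"
    using hecke_low(3,4)[OF f5(1) k, of k] hecke_low(5)[OF f5(1) k] hecke_weyl[OF f5(1)] f5(2) k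
    unfolding f6_def by auto
  have f7: "w' \<in> weyl n" "w' ` {1..k} = f6 ` {1..k}" "w' (Suc k) = f6 (Suc k)"
    using foldl_hecke_down[OF f6(1), of 1 k k] k unfolding w' by auto
  have low: "f5 i = f1 i" "f6 i = f1 i" if "i \<in> {1..<k}" for i
    using f2(4)[of i] f3(4)[of i] f4(3)[of i] f5(3)[of i] f6(4)[of i] that k by auto
  have f5k: "f5 k = 1" using f2(2) f3(4)[of k] f4(3)[of k] f5(3)[of k] k by auto
  show wW: "w' \<in> weyl n" by fact
  show w'1: "w' (Suc k) = 1" using f7 f6 f5k by simp
  have ins: "{1..k} = insert k {1..<k}" using k by auto
  have low_img: "f1 ` {1..<k} = w ` {1..k} - {m}"
  proof -
    have "f1 ` {1..k} = insert m (f1 ` {1..<k})" unfolding ins image_insert f1(3) ..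
    then have "w ` {1..k} = insert m (f1 ` {1..<k})" unfolding f1(2) .
    moreover have "m \<notin> f1 ` {1..<k}"
    proof
      assume "m \<in> f1 ` {1..<k}"
      then obtain i where i: "i \<in> {1..<k}" "f1 k = f1 i" using f1(3) by auto
      then show False using injD[OF weyl_inj[OF f1(1)] i(2)] by simp
    qed
    ultimately show ?thesis by auto
  qed
  have img: "w' ` {1..k} = insert M (w ` {1..k} - {m})"
  proof -
    have "f6 ` {1..k} = insert (f6 k) (f6 ` {1..<k})" unfolding ins image_insert ..
    also have "f6 ` {1..<k} = f1 ` {1..<k}" using low(2) by (intro image_cong) auto
    finally show ?thesis unfolding f7(2) f6(2) low_img .
  qed
  have wm: "w i \<in> {1..2 * n + 2}" if "i \<in> {1..2 * n + 2}" for i using weyl_mem[OF w that] .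
  have m_in: "m \<in> w ` {1..k}" unfolding m_def using k by (intro Min_in) auto
  have m_le: "m \<le> w i" if "i \<in> {1..k}" for i unfolding m_def using that by (intro Min_le) auto
  have one_unique: "i = Suc k" if "w i = 1" for i
    using weyl_inj[OF w] one that by (metis injD)
  have M_notin: "M \<notin> w ` {1..k} - {m}"
  proof
    assume "M \<in> w ` {1..k} - {m}"
    then obtain i where "i \<in> {1..<k}" "M = f1 i" unfolding low_img[symmetric] by blast
    then have "f5 (Suc k) = f5 i" using f5(2) low(1) by simp
    then show False using injD[OF weyl_inj[OF f5(1)], of "Suc k" i] \<open>i \<in> {1..<k}\<close> by simp
  qed
  have M_in: "M \<in> w' ` {1..k}" using img by simp
  \<comment> \<open>As 1 is at place k+1, the value 2n+2 is at its mirror image, which lies beyond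
    place k.\<close>
  have w'_range: "y \<in> {1..2 * n + 1}" if yW: "y \<in> w' ` {1..k}" for y
  proof -
    obtain i where i: "i \<in> {1..k}" "y = w' i" using yW by blast
    have "w' (bar n (Suc k)) = bar n 1"
      using weyl_bar[OF wW, of "Suc k"] w'1 k by simp
    moreover have "bar n (Suc k) \<noteq> i" using i k by (auto simp: bar_def)
    ultimately have "y \<noteq> 2 * n + 2"
      using injD[OF weyl_inj[OF wW], of "bar n (Suc k)" i] i
      by (auto simp: bar_def[of n "Suc 0"])
    moreover have "y \<in> {1..2 * n + 2}" using weyl_mem[OF wW, of i] i k by auto
    ultimately show ?thesis by auto
  qed
  define T where "T = f2 ` {Suc k..n + 1}"
  \<comment> \<open>Only the minimum of the block is replaced by its bar, but bar reverses the
    order, so this one bar bounds the bars of all values in the block.\<close>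
  have T_le: "t \<le> M" "bar n t \<le> M" if tT: "t \<in> T" for t
  proof -
    have fin: "finite (f4 ` {Suc k..n + 1})" by simp
    have top: "max (f3 (n + 1)) (bar n (f3 (n + 1))) \<le> M"
      unfolding M_def f4(2)[symmetric] using k by (intro Max_ge fin imageI) auto
    have "Min T \<le> t" unfolding T_def using that by (intro Min_le) (auto simp: T_def)
    then have "bar n t \<le> bar n (f3 (n + 1))" unfolding f3(3) T_def[symmetric] by (simp add: bar_def)
    then show "bar n t \<le> M" using top by simp
    obtain i where i: "i \<in> {Suc k..n + 1}" "t = f3 i"
      using tT unfolding T_def f3(2)[symmetric] by blast
    show "t \<le> M"
    proof (cases "i = n + 1")
      case True
      then show ?thesis using top i by simp
    next
      case False
      then have "f4 i \<le> M" unfolding M_def using i by (intro Max_ge fin imageI) auto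
      then show ?thesis using f4(3)[of i] False i by auto
    qed
  qed
  have mT: "m \<in> T" unfolding T_def using f2(3) k by (intro image_eqI[of _ _ "Suc k"]) auto
  have wT: "w i \<in> T" if "i \<in> {Suc (Suc k)..n + 1}" for i
    unfolding T_def using f2(4)[of i] f1(4)[of i] that by (intro image_eqI[of _ _ i]) auto
  \<comment> \<open>Write y as a value of w. Beyond the middle it is the bar of the value at a place
    i' <= n+1. For i' <= k this is at most the bar of m, since m is the least of these values, and m
    has moved into the block. For i' = k+1 it would be 2n+2.\<close>
  have M_max: "y \<le> M" if y: "y \<in> {1..2 * n + 1}" "y \<notin> w ` {1..k} - {m}" for y
  proof -
    have "y \<in> w ` {1..2 * n + 2}"
      using permutes_image[OF weyl_permutes[OF w]] y by auto
    then obtain i where i: "i \<in> {1..2 * n + 2}" "y = w i" by blast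
    consider "i \<le> k" | "i = Suc k" | "i \<in> {Suc (Suc k)..n + 1}" | "n + 1 < i" using i by force
    then show ?thesis
    proof cases
      case 1
      then show ?thesis using i y mT T_le(1) by auto
    next
      case 2
      then show ?thesis using i one w'_range[OF M_in] by auto
    next
      case 3
      then show ?thesis using i wT T_le by auto
    next
      case 4
      define i' where "i' = bar n i"
      have i': "i' \<in> {1..n + 1}" "i = bar n i'" using 4 i by (auto simp: i'_def bar_def)
      have yb: "y = bar n (w i')" using weyl_bar[OF w, of i'] i' i by auto
      consider "i' \<le> k" | "i' = Suc k" | "i' \<in> {Suc (Suc k)..n + 1}" using i' by force
      then show ?thesis
      proof cases
        case 1
        then have "bar n (w i') \<le> bar n m" using m_le[of i'] i' by (auto simp: bar_def)
        then show ?thesis using yb T_le(2)[OF mT] by simp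
      next
        case 2
        then show ?thesis using yb one y by (simp add: bar_def)
      next
        case 3
        then show ?thesis using yb wT T_le by auto
      qed
    qed
  qed
  have pos: "1 \<le> y" if "y \<in> w ` {1..k}" for y using that wm k by force
  have M1: "1 \<le> M" "M \<le> 2 * n + 1" using w'_range[OF M_in] by auto
  have S: "index_set k w = (\<lambda>y. y - 1) ` w ` {1..k}" by (auto simp: index_set_def)
  have minS: "Min (index_set k w) = m - 1"
    unfolding S m_def using k by (subst mono_Min_commute[symmetric]) (auto intro!: monoI)
  have SmM: "index_set k w - {Min (index_set k w)} = (\<lambda>y. y - 1) ` (w ` {1..k} - {m})"
  proof -
    have "inj_on (\<lambda>y. y - 1) (w ` {1..k})"
    proof (rule inj_onI)
      fix x y assume "x \<in> w ` {1..k}" "y \<in> w ` {1..k}" "x - 1 = y - 1"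
      then show "x = y" using pos[of x] pos[of y] by simp
    qed
    then have "(\<lambda>y. y - 1) ` (w ` {1..k} - {m}) = (\<lambda>y. y - 1) ` w ` {1..k} - (\<lambda>y. y - 1) ` {m}"
      by (rule inj_on_image_set_diff) (use m_in in auto)
    then show ?thesis unfolding minS unfolding S by simp
  qed
  have "Max ({..2 * n} - (index_set k w - {Min (index_set k w)})) = M - 1"
    unfolding SmM
  proof (rule Max_eqI)
    fix z assume z: "z \<in> {..2 * n} - (\<lambda>y. y - 1) ` (w ` {1..k} - {m})"
    then have "Suc z \<notin> w ` {1..k} - {m}" by force
    then have "Suc z \<le> M" using z by (intro M_max) auto
    then show "z \<le> M - 1" by simp
  next
    have "M - 1 \<noteq> y - 1" if "y \<in> w ` {1..k} - {m}" for y
    proof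
      assume "M - 1 = y - 1"
      then have "M = y" using pos[of y] that M1 by auto
      then show False using that M_notin by simp
    qed
    then show "M - 1 \<in> {..2 * n} - (\<lambda>y. y - 1) ` (w ` {1..k} - {m})" using M1 by auto
  qed simp
  then have "lift_min n (index_set k w) = (\<lambda>y. y - 1) ` w' ` {1..k}"
    unfolding lift_min_def img SmM by simp
  then show "index_set k w' = lift_min n (index_set k w)" by (auto simp: index_set_def)
qed

lemma hecke_O_index_set:
  assumes w: "w \<in> weyl n" and k: "1 \<le> k" "k \<le> n" and one: "w (Suc k) = 1"
  shows "hecke_O n k d w \<in> weyl n \<and> hecke_O n k d w (Suc k) = 1 \<and>
    index_set k (hecke_O n k d w) = (lift_min n ^^ d) (index_set k w)"
proof (induction d)
  case 0
  then show ?case using assms by (simp add: hecke_O_def)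
next
  case (Suc d)
  then show ?case
    using hecke_O_step[of "hecke_O n k d w" n k] k by (simp add: hecke_O_def)
qed

text \<open>Partner values are taken at mirrored places i and bar i, and of these only one can be at
  most n+1. Excluding the value 2n+2 keeps the positions inside E.\<close>

lemma index_set_admissible:
  assumes w: "w \<in> weyl n" and k: "k \<le> n + 1"
    and odd: "\<And>i. i \<in> {1..k} \<Longrightarrow> w i \<noteq> 2 * n + 2"
  shows "admissible n (index_set k w)" "card (index_set k w) = k"
proof -
  have range: "w i \<in> {1..2 * n + 1}" if "i \<in> {1..k}" for i
    using weyl_mem[OF w, of i] odd[OF that] that k by auto
  have "inj_on (\<lambda>i. w i - 1) {1..k}"
  proof (rule inj_onI)
    fix x y assume "x \<in> {1..k}" "y \<in> {1..k}" "w x - 1 = w y - 1"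
    then have "w x = w y" using range[of x] range[of y] by auto
    then show "x = y" using weyl_inj[OF w] by (simp add: injD)
  qed
  then show "card (index_set k w) = k" by (simp add: index_set_def card_image)
  show "admissible n (index_set k w)"
    unfolding admissible_def
  proof (intro conjI ballI)
    show "index_set k w \<subseteq> {..2 * n}" using range by (force simp: index_set_def)
    fix y assume "y \<in> index_set k w"
    then obtain i where i: "i \<in> {1..k}" "y = w i - 1" by (auto simp: index_set_def)
    show "2 * n + 1 - y \<notin> index_set k w"
    proof
      assume "2 * n + 1 - y \<in> index_set k w"
      then obtain j where j: "j \<in> {1..k}" "2 * n + 1 - y = w j - 1" by (auto simp: index_set_def)
      then have "w j = bar n (w i)" using i range[of i] range[of j] by (auto simp: bar_def)
      also have "\<dots> = w (bar n i)" using weyl_bar[OF w, of i] i k by auto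
      finally have "j = bar n i" by (rule injD[OF weyl_inj[OF w]])
      then show False using i j k by (auto simp: bar_def)
    qed
  qed
qed

lemma weyl_fixing_kernel:
  assumes w: "w \<in> weyl n" and k: "k \<le> n" and one: "w (Suc k) = 1" and i: "i \<in> {1..k}"
  shows "w i \<noteq> 2 * n + 2" "w i \<noteq> 1"
proof -
  have "w (bar n (Suc k)) = 2 * n + 2"
    using weyl_bar[OF w, of "Suc k"] k one by (simp add: bar_def)
  moreover have "bar n (Suc k) \<noteq> i" "Suc k \<noteq> i" using i k by (auto simp: bar_def)
  ultimately show "w i \<noteq> 2 * n + 2" "w i \<noteq> 1" using weyl_inj[OF w] one by (metis injD)+
qed

lemma zero_notin_index_set:
  assumes w: "w \<in> weyl n" and k: "k \<le> n + 1" and ne: "\<And>i. i \<in> {1..k} \<Longrightarrow> w i \<noteq> 1"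
  shows "0 \<notin> index_set k w"
proof
  assume "0 \<in> index_set k w"
  then obtain i where i: "i \<in> {1..k}" "w i \<le> 1" by (auto simp: index_set_def)
  then show False using weyl_mem[OF w, of i] ne[of i] k by auto
qed

text \<open>Minimality makes w increase from place k+1 on. By oddness the value 1 is taken at one of
  the first n+1 places, and not among the first k, so it is the first value of the increasing
  block.\<close>

lemma min_reps_one:
  assumes w: "w \<in> min_reps n k \<inter> weyl_odd n" and k: "1 \<le> k" "k \<le> n"
    and one: "\<And>i. i \<in> {1..k} \<Longrightarrow> w i \<noteq> 1"
  shows "w (Suc k) = 1"
proof -
  have W: "w \<in> weyl n" using w by (simp add: weyl_odd_def)
  have asc: "w i < w (i + 1)" if "Suc k \<le> i" "i \<le> n + 1" for i
  proof -
    have "word_prod n [i] \<in> weyl_P n k" using that k unfolding weyl_P_def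
      by (intro CollectI exI[of _ "[i]"]) auto
    then have "srefl n i \<in> weyl_P n k" by (simp add: word_prod_def)
    then have "wlength n w \<le> wlength n (w \<circ> srefl n i)" using w by (simp add: min_reps_def)
    then show ?thesis using wlength_ascent_iff(2)[OF W, of i] that k by auto
  qed
  have mono: "w (Suc k) \<le> w i" if "Suc k \<le> i" "i \<le> n + 1" for i
    using that
  proof (induction i rule: dec_induct)
    case (step i)
    then show ?case using asc[of i] by auto
  qed simp
  have "1 \<in> w ` {1..2 * n + 2}" using permutes_image[OF weyl_permutes[OF W]] by auto
  then obtain i where i: "i \<in> {1..2 * n + 2}" "w i = 1" by auto
  have "i \<le> n + 1"
  proof (rule ccontr)
    assume "\<not> i \<le> n + 1"
    then have "bar n i \<in> {1..n + 1}" using i by (auto simp: bar_def)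
    moreover have "w (bar n i) = bar n 1" using weyl_bar[OF W i(1)] i by simp
    ultimately show False using w by (auto simp: weyl_odd_def)
  qed
  moreover have "k < i" using one[of i] i by force
  ultimately have "w (Suc k) \<le> 1" using mono[of i] i by simp
  moreover have "w (Suc k) \<in> {1..2 * n + 2}" using weyl_mem[OF W, of "Suc k"] k by auto
  ultimately show "w (Suc k) = 1" by auto
qed

section \<open>Leading positions of subspaces\<close>

text \<open>A concrete form of the library notion (\<open>module_subspace_iff\<close>), so that
  arguments can be made coordinate by coordinate.\<close>

definition lin_subspace :: "nat \<Rightarrow> complex vec set \<Rightarrow> bool" where
  "lin_subspace N V \<longleftrightarrow> V \<subseteq> carrier_vec N \<and> 0\<^sub>v N \<in> V \<and>
     (\<forall>x\<in>V. \<forall>y\<in>V. x + y \<in> V) \<and> (\<forall>c. \<forall>x\<in>V. c \<cdot>\<^sub>v x \<in> V)"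

text \<open>The last nonzero coordinate is what invertible upper triangular matrices preserve, hence
  the choice of last rather than first.\<close>

definition lead_pos :: "complex vec \<Rightarrow> nat \<Rightarrow> bool" where
  "lead_pos x p \<longleftrightarrow> p < dim_vec x \<and> x $ p \<noteq> 0 \<and> (\<forall>i. p < i \<longrightarrow> i < dim_vec x \<longrightarrow> x $ i = 0)"

definition leads :: "complex vec set \<Rightarrow> nat set" where
  "leads V = {p. \<exists>x\<in>V. lead_pos x p}"

definition combo :: "nat \<Rightarrow> ('i \<Rightarrow> complex) \<Rightarrow> ('i \<Rightarrow> complex vec) \<Rightarrow> 'i set \<Rightarrow> complex vec" where
  "combo N c f S = vec N (\<lambda>i. \<Sum>a\<in>S. c a * f a $ i)"

lemma dim_combo [simp]: "dim_vec (combo N c f S) = N"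
  and combo_carrier [simp]: "combo N c f S \<in> carrier_vec N"
  and combo_index [simp]: "i < N \<Longrightarrow> combo N c f S $ i = (\<Sum>a\<in>S. c a * f a $ i)"
  by (auto simp: combo_def)

lemma lin_subspaceD:
  assumes "lin_subspace N V"
  shows "x \<in> V \<Longrightarrow> x \<in> carrier_vec N" "x \<in> V \<Longrightarrow> dim_vec x = N" "0\<^sub>v N \<in> V"
    "x \<in> V \<Longrightarrow> y \<in> V \<Longrightarrow> x + y \<in> V" "x \<in> V \<Longrightarrow> c \<cdot>\<^sub>v x \<in> V"
  using assms unfolding lin_subspace_def by auto

lemma combo_mem:
  assumes "lin_subspace N V" "finite S" "\<And>a. a \<in> S \<Longrightarrow> f a \<in> V"
  shows "combo N c f S \<in> V"
  using assms(2,3)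
proof (induction S)
  case empty
  have "combo N c f {} = 0\<^sub>v N" by (auto simp: combo_def)
  then show ?case using lin_subspaceD(3)[OF assms(1)] by simp
next
  case (insert a S)
  have "dim_vec (f a) = N" using insert lin_subspaceD(2)[OF assms(1)] by auto
  then have "combo N c f (insert a S) = c a \<cdot>\<^sub>v f a + combo N c f S"
    using insert by (intro eq_vecI) auto
  then show ?case using insert lin_subspaceD[OF assms(1)] by auto
qed

lemma lin_subspace_diff:
  assumes "lin_subspace N V" "x \<in> V" "y \<in> V"
  shows "x - y \<in> V"
proof -
  have "x - y = x + (- 1) \<cdot>\<^sub>v y"
    using lin_subspaceD(2)[OF assms(1)] assms by (intro eq_vecI) auto
  then show ?thesis using lin_subspaceD[OF assms(1)] assms by metis
qed

lemma lead_pos_exists: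
  assumes "x \<in> carrier_vec N" "x \<noteq> 0\<^sub>v N"
  shows "\<exists>p. lead_pos x p"
proof -
  let ?P = "{i. i < N \<and> x $ i \<noteq> 0}"
  define m where "m = Max ?P"
  have d: "dim_vec x = N" using assms by simp
  have "?P \<noteq> {}" using assms by (auto intro!: eq_vecI)
  then have "m \<in> ?P" unfolding m_def by (intro Max_in) auto
  moreover have "x $ i = 0" if "m < i" "i < N" for i
  proof (rule ccontr)
    assume "x $ i \<noteq> 0"
    then have "i \<le> m" unfolding m_def using that(2) by (intro Max_ge) auto
    then show False using that(1) by simp
  qed
  ultimately have "lead_pos x m" unfolding lead_pos_def d by blast
  then show ?thesis ..
qed

lemma lead_pos_unique: "lead_pos x p \<Longrightarrow> lead_pos x q \<Longrightarrow> p = q"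
  unfolding lead_pos_def by (cases p q rule: linorder_cases) auto

lemma leads_subset: "lin_subspace N V \<Longrightarrow> leads V \<subseteq> {..<N}"
  by (auto simp: leads_def lead_pos_def dest: lin_subspaceD(2))

lemma leads_mono: "V \<subseteq> W \<Longrightarrow> leads V \<subseteq> leads W"
  by (auto simp: leads_def)

lemma finite_leads: "lin_subspace N V \<Longrightarrow> finite (leads V)"
  using leads_subset finite_subset by blast

text \<open>A reduced echelon basis indexed by the leading positions: the coefficients of a vector
  of V are then its own entries at these positions.\<close>

definition is_echelon :: "complex vec set \<Rightarrow> (nat \<Rightarrow> complex vec) \<Rightarrow> bool" where
  "is_echelon V f \<longleftrightarrow> (\<forall>a\<in>leads V. f a \<in> V \<and> lead_pos (f a) a \<and>
     (\<forall>c\<in>leads V. f a $ c = (if c = a then 1 else 0)))"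

text \<open>Strong induction on the leading position: scale a vector with lead a to have entry 1
  there and clear its entries at smaller leading positions with the vectors already found. Entries
  at larger ones are zero already.\<close>

lemma echelon_exists:
  assumes V: "lin_subspace N V"
  shows "\<exists>f. is_echelon V f"
proof -
  let ?P = "\<lambda>a y. y \<in> V \<and> lead_pos y a \<and> (\<forall>c\<in>leads V. y $ c = (if c = a then 1 else 0))"
  note VD = lin_subspaceD[OF V]
  have "\<exists>y. ?P a y" if "a \<in> leads V" for a
    using that
  proof (induction a rule: less_induct)
    case (less a)
    define L where "L = {c \<in> leads V. c < a}"
    have "\<forall>c\<in>L. \<exists>y. ?P c y" using less.IH by (auto simp: L_def)
    then obtain f where f: "\<And>c. c \<in> L \<Longrightarrow> ?P c (f c)" by metis
    obtain x where x: "x \<in> V" "lead_pos x a" using less.prems by (auto simp: leads_def)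
    have aN: "a < N" using x VD(2) by (auto simp: lead_pos_def)
    have fL: "finite L" using finite_leads[OF V] by (simp add: L_def)
    define z where "z = (1 / x $ a) \<cdot>\<^sub>v x"
    have z: "z \<in> V" "z $ a = 1" "\<And>i. a < i \<Longrightarrow> i < N \<Longrightarrow> z $ i = 0" "dim_vec z = N"
      using x VD(5) aN VD(2)[OF x(1)] by (auto simp: z_def lead_pos_def)
    define y where "y = z - combo N (\<lambda>c. z $ c) f L"
    have yV: "y \<in> V" unfolding y_def
      by (intro lin_subspace_diff[OF V] z combo_mem[OF V fL]) (use f in auto)
    have y_idx: "y $ i = z $ i - (\<Sum>c\<in>L. z $ c * f c $ i)" if "i < N" for i
      using that by (simp add: y_def)
    have f0: "f c $ i = 0" if "c \<in> L" "a \<le> i" "i < N" for c i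
    proof -
      have "dim_vec (f c) = N" "lead_pos (f c) c" using f[OF that(1)] VD by auto
      then show ?thesis using that by (auto simp: lead_pos_def L_def)
    qed
    have high: "y $ i = z $ i" if "a \<le> i" "i < N" for i
      using that f0 by (simp add: y_idx)
    have low: "y $ c = 0" if "c \<in> L" for c
    proof -
      have "c < N" using that leads_subset[OF V] by (auto simp: L_def)
      moreover have "(\<Sum>e\<in>L. z $ e * f e $ c) = (\<Sum>e\<in>L. if e = c then z $ e else 0)"
        using f that by (intro sum.cong) (auto simp: L_def)
      ultimately show ?thesis using that fL by (simp add: y_idx)
    qed
    have "?P a y"
    proof (intro conjI ballI)
      show "lead_pos y a" using high z aN by (auto simp: lead_pos_def y_def)
      fix c assume c: "c \<in> leads V"
      then have "c < N" using leads_subset[OF V] by auto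
      then show "y $ c = (if c = a then 1 else 0)"
        using low[of c] high[of c] z c by (cases "c < a") (auto simp: L_def)
    qed (rule yV)
    then show ?case by blast
  qed
  then have "\<exists>f. \<forall>a\<in>leads V. ?P a (f a)" by metis
  then show ?thesis by (simp add: is_echelon_def)
qed

text \<open>The difference lies in V and vanishes at every leading position of V, so it has no
  leading position at all and must be 0.\<close>

lemma echelon_expand:
  assumes V: "lin_subspace N V" and f: "is_echelon V f" and x: "x \<in> V"
  shows "x = combo N (\<lambda>a. x $ a) f (leads V)"
proof -
  let ?y = "x - combo N (\<lambda>a. x $ a) f (leads V)"
  note VD = lin_subspaceD[OF V]
  have y: "?y \<in> V"
    by (intro lin_subspace_diff[OF V] x combo_mem[OF V finite_leads[OF V]])
      (use f in \<open>auto simp: is_echelon_def\<close>)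
  have yc: "?y $ c = 0" if c: "c \<in> leads V" for c
  proof -
    have "c < N" using c leads_subset[OF V] by auto
    moreover have "(\<Sum>a\<in>leads V. x $ a * f a $ c) = (\<Sum>a\<in>leads V. if a = c then x $ a else 0)"
      using f c by (intro sum.cong) (auto simp: is_echelon_def)
    ultimately show ?thesis using c finite_leads[OF V] by simp
  qed
  have "\<not> lead_pos ?y p" for p
  proof
    assume p: "lead_pos ?y p"
    then have "p \<in> leads V" using y unfolding leads_def by blast
    then show False using yc[of p] p unfolding lead_pos_def by blast
  qed
  then have zero: "?y = 0\<^sub>v N" using lead_pos_exists[of ?y N] VD(1)[OF y] by blast
  show ?thesis
  proof (rule eq_vecI)
    fix i assume i: "i < dim_vec (combo N (\<lambda>a. x $ a) f (leads V))"
    then have "?y $ i = 0" by (simp only: zero) simp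
    then show "x $ i = combo N (\<lambda>a. x $ a) f (leads V) $ i" using i VD(2)[OF x] by simp
  qed (simp add: VD(2)[OF x])
qed

lemma module_subspace_iff:
  "VectorSpace.subspace class_ring V (module_vec TYPE(complex) N) \<longleftrightarrow> lin_subspace N V"
proof -
  interpret vec_space "TYPE(complex)" N .
  show ?thesis
    unfolding VectorSpace.subspace_def submodule_def lin_subspace_def
    using vectorspace_axioms module_axioms by (auto simp: module_vec_simps class_ring_simps)
qed

lemma lin_subspace_span:
  assumes "S \<subseteq> carrier_vec N"
  shows "lin_subspace N (LinearCombinations.module.span class_ring (module_vec TYPE(complex) N) S)"
    and "S \<subseteq> LinearCombinations.module.span class_ring (module_vec TYPE(complex) N) S"
    and "lin_subspace N W \<Longrightarrow> S \<subseteq> W \<Longrightarrow>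
      LinearCombinations.module.span class_ring (module_vec TYPE(complex) N) S \<subseteq> W"
proof -
  interpret vec_space "TYPE(complex)" N .
  show "lin_subspace N (span S)"
    using span_is_subspace[OF assms] by (simp add: module_subspace_iff[symmetric])
  show "S \<subseteq> span S" using in_own_span assms by simp
  show "lin_subspace N W \<Longrightarrow> S \<subseteq> W \<Longrightarrow> span S \<subseteq> W"
    using span_is_subset[of S W] by (simp add: module_subspace_iff[symmetric] VectorSpace.subspace_def)
qed

text \<open>The echelon vectors form a basis: they span by \<open>echelon_expand\<close>, and a
  relation read at the leading position of one of them isolates its coefficient.\<close>

lemma dim_lin_subspace:
  assumes V: "lin_subspace N V"
  shows "vectorspace.fin_dim class_ring ((module_vec TYPE(complex) N)\<lparr>carrier := V\<rparr>)"
    and "vectorspace.dim class_ring ((module_vec TYPE(complex) N)\<lparr>carrier := V\<rparr>) = card (leads V)"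
proof -
  interpret M: vec_space "TYPE(complex)" N .
  have sub: "VectorSpace.subspace class_ring V M.V" using V by (simp add: module_subspace_iff)
  then have submod: "submodule class_ring V M.V" by (simp add: VectorSpace.subspace_def)
  interpret W: vectorspace class_ring "M.V\<lparr>carrier := V\<rparr>"
    using sub by (rule M.subspace_is_vs)
  obtain f where f: "is_echelon V f" using echelon_exists[OF V] by blast
  define B where "B = f ` leads V"
  have BV: "B \<subseteq> V" using f by (auto simp: B_def is_echelon_def)
  then have Bc: "B \<subseteq> carrier_vec N" using lin_subspaceD(1)[OF V] by blast
  have fin: "finite B" using finite_leads[OF V] by (simp add: B_def)
  have inj: "inj_on f (leads V)"
  proof (rule inj_onI)
    fix a b assume ab: "a \<in> leads V" "b \<in> leads V" "f a = f b"
    have "f a $ a = 1" using f ab(1) unfolding is_echelon_def by simp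
    moreover have "f b $ a = (if a = b then 1 else 0)"
      using f ab(1,2) unfolding is_echelon_def by blast
    ultimately show "a = b" using ab(3) by (auto split: if_splits)
  qed
  have "W.span B = M.span B" "W.lin_dep B = M.lin_dep B"
    using M.span_li_not_depend[OF BV submod] by auto
  moreover have "M.span B = V"
  proof
    show "M.span B \<subseteq> V" using lin_subspace_span(3)[OF Bc V BV] .
    show "V \<subseteq> M.span B"
    proof
      fix x assume "x \<in> V"
      then have "x = combo N (\<lambda>a. x $ a) f (leads V)" by (rule echelon_expand[OF V f])
      also have "\<dots> \<in> M.span B"
        using lin_subspace_span(2)[OF Bc]
        by (intro combo_mem[OF lin_subspace_span(1)[OF Bc] finite_leads[OF V]]) (auto simp: B_def)
      finally show "x \<in> M.span B" .
    qed
  qed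
  moreover have "\<not> M.lin_dep B"
  proof
    assume "M.lin_dep B"
    then obtain A a v where A: "finite A" "A \<subseteq> B" "M.lincomb a A = 0\<^sub>v N" "v \<in> A" "a v \<noteq> 0"
      unfolding M.lin_dep_def by (auto simp: module_vec_simps class_ring_simps)
    obtain b where b: "b \<in> leads V" "v = f b" using A by (auto simp: B_def)
    have bN: "b < N" using b leads_subset[OF V] by auto
    have "0 = M.lincomb a A $ b" using A bN by simp
    also have "\<dots> = (\<Sum>x\<in>A. a x * x $ b)"
      using M.lincomb_index[OF bN] A Bc by blast
    also have "\<dots> = (\<Sum>x\<in>A. if x = v then a x else 0)"
    proof (rule sum.cong)
      fix x assume "x \<in> A"
      then obtain e where "e \<in> leads V" "x = f e" using A by (auto simp: B_def)
      then show "a x * x $ b = (if x = v then a x else 0)"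
        using f b inj by (auto simp: is_echelon_def dest: inj_onD)
    qed simp
    also have "\<dots> = a v" using A by simp
    finally show False using A by simp
  qed
  ultimately have "W.basis B" using BV by (simp add: W.basis_def)
  then show "W.fin_dim" "W.dim = card (leads V)"
    using W.dim_basis[OF fin] fin BV inj
    by (auto simp: W.fin_dim_def W.basis_def B_def card_image)
qed

section \<open>The symplectic form in coordinates\<close>

lemma coord_index_lt: "2 * n + 1 - i < dimE n \<longleftrightarrow> 1 \<le> i" for i n :: nat
  by (auto simp: dimE_def)

definition esign :: "nat \<Rightarrow> nat \<Rightarrow> complex" where
  "esign n i = (if i \<le> n then 1 else - 1)"

text \<open>For each i one j remains, namely the partner. Position 0 would be paired with 2n+1,
  which is outside E, so the sum runs over 1..2n only.\<close>

lemma omega_eq: "omega n x y = (\<Sum>i\<in>{1..2 * n}. esign n i * x $ i * y $ (2 * n + 1 - i))"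
proof -
  have inner: "(\<Sum>j = 1..dimE n. omega_basis n i j * x $ (i - 1) * y $ (j - 1)) =
      (if 2 \<le> i then esign n (i - 1) * x $ (i - 1) * y $ (2 * n + 2 - i) else 0)"
    if i: "i \<in> {1..dimE n}" for i
  proof -
    have "(\<Sum>j = 1..dimE n. omega_basis n i j * x $ (i - 1) * y $ (j - 1)) =
        (\<Sum>j = 1..dimE n. if j = 2 * n + 3 - i
          then esign n (i - 1) * x $ (i - 1) * y $ (2 * n + 2 - i) else 0)"
    proof (rule sum.cong)
      fix j assume j: "j \<in> {1..dimE n}"
      have eq: "i = bar n j \<longleftrightarrow> j = 2 * n + 3 - i" using i j by (auto simp: bar_def dimE_def)
      show "omega_basis n i j * x $ (i - 1) * y $ (j - 1) = (if j = 2 * n + 3 - i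
          then esign n (i - 1) * x $ (i - 1) * y $ (2 * n + 2 - i) else 0)"
      proof (cases "j = 2 * n + 3 - i")
        case True
        then have "i \<le> j \<longleftrightarrow> i - 1 \<le> n" "j - 1 = 2 * n + 2 - i" using i by (auto simp: dimE_def)
        then show ?thesis using True eq by (simp add: omega_basis_def esign_def)
      qed (simp add: omega_basis_def eq)
    qed simp
    also have "\<dots> = (if 2 \<le> i then esign n (i - 1) * x $ (i - 1) * y $ (2 * n + 2 - i) else 0)"
      using i by (auto simp: sum.delta dimE_def)
    finally show ?thesis .
  qed
  have "omega n x y = (\<Sum>i = 1..dimE n. if 2 \<le> i
      then esign n (i - 1) * x $ (i - 1) * y $ (2 * n + 2 - i) else 0)"
    unfolding omega_def using inner by (rule sum.cong[OF refl])
  also have "\<dots> = (\<Sum>i\<in>{2..dimE n}. esign n (i - 1) * x $ (i - 1) * y $ (2 * n + 2 - i))"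
    by (rule sum.mono_neutral_cong_right) auto
  also have "\<dots> = (\<Sum>i\<in>{1..2 * n}. esign n i * x $ i * y $ (2 * n + 1 - i))"
    by (rule sum.reindex_bij_witness[of _ Suc "\<lambda>i. i - 1"]) (auto simp: dimE_def)
  finally show ?thesis .
qed

lemma esign_swap: "i \<in> {1..2 * n} \<Longrightarrow> esign n (2 * n + 1 - i) = - esign n i"
  by (auto simp: esign_def)

lemma esign_square [simp]: "esign n i * esign n i = 1"
  by (simp add: esign_def)

lemma omega_antisym: "omega n x y = - omega n y x"
proof -
  have "omega n x y = (\<Sum>i\<in>{1..2 * n}. esign n (2 * n + 1 - i) * x $ (2 * n + 1 - i) * y $ i)"
    unfolding omega_eq
    by (rule sum.reindex_bij_witness[of _ "\<lambda>i. 2 * n + 1 - i" "\<lambda>i. 2 * n + 1 - i"]) auto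
  also have "\<dots> = (\<Sum>i\<in>{1..2 * n}. - (esign n i * y $ i * x $ (2 * n + 1 - i)))"
    by (rule sum.cong) (simp_all add: esign_swap[simplified])
  finally show ?thesis by (simp add: omega_eq sum_negf)
qed

lemma omega_combo_left:
  "omega n (combo (dimE n) c f S) y = (\<Sum>a\<in>S. c a * omega n (f a) y)"
proof -
  have "omega n (combo (dimE n) c f S) y =
      (\<Sum>i\<in>{1..2 * n}. \<Sum>a\<in>S. c a * (esign n i * f a $ i * y $ (2 * n + 1 - i)))"
    unfolding omega_eq
    by (rule sum.cong) (auto simp: dimE_def sum_distrib_left sum_distrib_right mult_ac)
  also have "\<dots> = (\<Sum>a\<in>S. \<Sum>i\<in>{1..2 * n}. c a * (esign n i * f a $ i * y $ (2 * n + 1 - i)))"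
    by (rule sum.swap)
  finally show ?thesis by (simp add: omega_eq sum_distrib_left)
qed

lemma omega_combo_right:
  "omega n x (combo (dimE n) c f S) = (\<Sum>a\<in>S. c a * omega n x (f a))"
proof -
  have "omega n x (combo (dimE n) c f S) = - omega n (combo (dimE n) c f S) x"
    by (rule omega_antisym)
  also have "\<dots> = (\<Sum>a\<in>S. c a * - omega n (f a) x)"
    unfolding omega_combo_left by (simp add: sum_negf)
  finally show ?thesis by (simp only: omega_antisym[of n x, symmetric])
qed

lemma omega_add_left: "x \<in> carrier_vec (dimE n) \<Longrightarrow> z \<in> carrier_vec (dimE n) \<Longrightarrow>
    omega n (x + z) y = omega n x y + omega n z y"
  unfolding omega_eq
  by (subst sum.distrib[symmetric], rule sum.cong) (auto simp: dimE_def algebra_simps)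

lemma omega_smult_left: "x \<in> carrier_vec (dimE n) \<Longrightarrow> omega n (c \<cdot>\<^sub>v x) y = c * omega n x y"
  unfolding omega_eq sum_distrib_left by (rule sum.cong) (auto simp: dimE_def)

lemma omega_add_right: "x \<in> carrier_vec (dimE n) \<Longrightarrow> z \<in> carrier_vec (dimE n) \<Longrightarrow>
    omega n y (x + z) = omega n y x + omega n y z"
  using omega_antisym[of n y "x + z"] omega_antisym[of n y x] omega_antisym[of n y z]
    omega_add_left[of x n z y] by simp

lemma omega_smult_right: "x \<in> carrier_vec (dimE n) \<Longrightarrow> omega n y (c \<cdot>\<^sub>v x) = c * omega n y x"
  using omega_antisym[of n y "c \<cdot>\<^sub>v x"] omega_antisym[of n y x] omega_smult_left[of x n c y] by simp

lemma omega_unit_left: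
  assumes "i < dimE n"
  shows "omega n (unit_vec (dimE n) i) y = (if 1 \<le> i then esign n i * y $ (2 * n + 1 - i) else 0)"
proof -
  have "omega n (unit_vec (dimE n) i) y =
      (\<Sum>j\<in>{1..2 * n}. if j = i then esign n i * y $ (2 * n + 1 - i) else 0)"
    unfolding omega_eq using assms by (intro sum.cong) (auto simp: dimE_def)
  then show ?thesis using assms by (simp add: sum.delta dimE_def)
qed

lemma omega_self [simp]: "omega n x x = 0"
  using omega_antisym[of n x x] by simp

lemma IG_iff: "V \<in> IG n k \<longleftrightarrow> lin_subspace (dimE n) V \<and> card (leads V) = k \<and>
    (\<forall>x\<in>V. \<forall>y\<in>V. omega n x y = 0)"
  unfolding IG_def using dim_lin_subspace[of "dimE n" V] module_subspace_iff[of V "dimE n"] by auto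

section \<open>Coordinate subspaces\<close>

definition coord_space :: "nat \<Rightarrow> nat set \<Rightarrow> complex vec set" where
  "coord_space N S = {x \<in> carrier_vec N. \<forall>i<N. i \<notin> S \<longrightarrow> x $ i = 0}"

lemma coord_space_subspace: "lin_subspace N (coord_space N S)"
  by (auto simp: lin_subspace_def coord_space_def)

lemma unit_vec_coord_space: "i \<in> S \<Longrightarrow> unit_vec N i \<in> coord_space N S"
  by (auto simp: coord_space_def unit_vec_def)

lemma coord_space_expand:
  assumes "x \<in> coord_space N S" "S \<subseteq> {..<N}"
  shows "x = combo N (\<lambda>a. x $ a) (unit_vec N) S"
proof (rule eq_vecI)
  have "finite S" using assms(2) finite_subset by blast
  fix i assume "i < dim_vec (combo N (\<lambda>a. x $ a) (unit_vec N) S)"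
  then have i: "i < N" by simp
  then have "(\<Sum>a\<in>S. x $ a * unit_vec N a $ i) = (\<Sum>a\<in>S. if a = i then x $ i else 0)"
    using assms by (intro sum.cong) auto
  also have "\<dots> = x $ i" using assms i \<open>finite S\<close> by (auto simp: coord_space_def)
  finally show "x $ i = combo N (\<lambda>a. x $ a) (unit_vec N) S $ i" using i by simp
qed (use assms in \<open>auto simp: coord_space_def\<close>)

lemma coord_subspace_eq:
  assumes "index_set k w \<subseteq> {..<dimE n}"
  shows "coord_subspace n k w = coord_space (dimE n) (index_set k w)"
proof
  let ?B = "(\<lambda>i. ev n (w i)) ` {1..k}"
  have B: "?B = unit_vec (dimE n) ` index_set k w"
    by (auto simp: ev_def index_set_def)
  have Bc: "?B \<subseteq> carrier_vec (dimE n)" by (auto simp: ev_def)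
  show "coord_subspace n k w \<subseteq> coord_space (dimE n) (index_set k w)"
    unfolding coord_subspace_def using B unit_vec_coord_space
    by (intro lin_subspace_span(3)[OF Bc coord_space_subspace]) auto
  show "coord_space (dimE n) (index_set k w) \<subseteq> coord_subspace n k w"
  proof
    fix x assume "x \<in> coord_space (dimE n) (index_set k w)"
    then have "x = combo (dimE n) (\<lambda>a. x $ a) (unit_vec (dimE n)) (index_set k w)"
      using assms by (rule coord_space_expand)
    also have "\<dots> \<in> coord_subspace n k w"
      unfolding coord_subspace_def using lin_subspace_span(2)[OF Bc] B
      by (intro combo_mem[OF lin_subspace_span(1)[OF Bc]]) (auto simp: index_set_def)
    finally show "x \<in> coord_subspace n k w" .
  qed
qed

lemma leads_coord_space:
  assumes "S \<subseteq> {..<N}"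
  shows "leads (coord_space N S) = S"
proof
  show "leads (coord_space N S) \<subseteq> S" by (auto simp: leads_def coord_space_def lead_pos_def)
  show "S \<subseteq> leads (coord_space N S)"
  proof
    fix i assume "i \<in> S"
    then show "i \<in> leads (coord_space N S)"
      using assms unit_vec_coord_space[of i S N]
      by (auto simp: leads_def lead_pos_def intro!: bexI[of _ "unit_vec N i"])
  qed
qed

section \<open>Cells\<close>

lemma mult_mat_vec_combo:
  assumes "g \<in> carrier_mat N m" "x \<in> carrier_vec m"
  shows "g *\<^sub>v x = combo N (\<lambda>j. x $ j) (col g) {..<m}"
proof (rule eq_vecI)
  fix i assume "i < dim_vec (combo N (\<lambda>j. x $ j) (col g) {..<m})"
  then have i: "i < N" by simp
  then show "(g *\<^sub>v x) $ i = combo N (\<lambda>j. x $ j) (col g) {..<m} $ i"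
    using assms by (auto simp: scalar_prod_def atLeast0LessThan mult.commute intro!: sum.cong)
qed (use assms in auto)

lemma borel_diag_nonzero:
  assumes g: "g \<in> borel n" and i: "i < dimE n"
  shows "g $$ (i, i) \<noteq> 0"
proof -
  have c: "g \<in> carrier_mat (dimE n) (dimE n)" and inv: "invertible_mat g" and ut: "upper_triangular g"
    using g by (auto simp: borel_def Sp_odd_def)
  obtain h where h: "g * h = 1\<^sub>m (dimE n)" "h * g = 1\<^sub>m (dim_row h)"
    using inv c by (auto simp: invertible_mat_def inverts_mat_def)
  have "dim_col (g * h) = dimE n" "dim_col (h * g) = dim_row h" unfolding h by auto
  then have hc: "h \<in> carrier_mat (dimE n) (dimE n)" using c by auto
  have "det g * det h = 1" using det_mult[OF c hc] h by simp
  then have "det g \<noteq> 0" by auto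
  then have "0 \<notin> set (diag_mat g)" using upper_triangular_imp_det_eq_0_iff[OF c ut] by simp
  then show ?thesis using i c by (auto simp: diag_mat_def)
qed

lemma borelD:
  assumes "g \<in> borel n"
  shows "g \<in> carrier_mat (dimE n) (dimE n)" "\<And>i j. j < i \<Longrightarrow> i < dimE n \<Longrightarrow> g $$ (i, j) = 0"
    "\<And>x y. x \<in> carrier_vec (dimE n) \<Longrightarrow> y \<in> carrier_vec (dimE n) \<Longrightarrow>
      omega n (g *\<^sub>v x) (g *\<^sub>v y) = omega n x y"
  using assms by (auto simp: borel_def Sp_odd_def)

text \<open>The nonzero diagonal makes the determinant nonzero, hence the matrix invertible; by
  bilinearity the form has to be compared on columns only.\<close>

lemma borelI:
  assumes g: "g \<in> carrier_mat (dimE n) (dimE n)"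
    and ut: "\<And>i j. j < i \<Longrightarrow> i < dimE n \<Longrightarrow> g $$ (i, j) = 0"
    and diag: "\<And>i. i < dimE n \<Longrightarrow> g $$ (i, i) \<noteq> 0"
    and om: "\<And>i j. i < dimE n \<Longrightarrow> j < dimE n \<Longrightarrow>
      omega n (col g i) (col g j) = omega n (unit_vec (dimE n) i) (unit_vec (dimE n) j)"
  shows "g \<in> borel n"
proof -
  let ?N = "dimE n"
  have u: "upper_triangular g" using ut g by auto
  then have "det g \<noteq> 0"
    using upper_triangular_imp_det_eq_0_iff[OF g u] diag g by (auto simp: diag_mat_def)
  then have "g \<in> Units (ring_mat TYPE(complex) ?N ())" by (rule det_non_zero_imp_unit[OF g])
  then obtain h where h: "h \<in> carrier_mat ?N ?N" "h * g = 1\<^sub>m ?N" "g * h = 1\<^sub>m ?N"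
    unfolding Units_def ring_mat_def by auto
  then have "invertible_mat g" using g by (auto simp: invertible_mat_def inverts_mat_def)
  moreover have "omega n (g *\<^sub>v x) (g *\<^sub>v y) = omega n x y"
    if xy: "x \<in> carrier_vec ?N" "y \<in> carrier_vec ?N" for x y
  proof -
    have full: "z = combo ?N (\<lambda>j. z $ j) (unit_vec ?N) {..<?N}" if "z \<in> carrier_vec ?N" for z
      using that by (intro coord_space_expand) (auto simp: coord_space_def)
    have "omega n (g *\<^sub>v x) (g *\<^sub>v y) =
        (\<Sum>j<?N. y $ j * (\<Sum>i<?N. x $ i * omega n (col g i) (col g j)))"
      unfolding mult_mat_vec_combo[OF g xy(1)] mult_mat_vec_combo[OF g xy(2)]
        omega_combo_right omega_combo_left ..
    also have "\<dots> = (\<Sum>j<?N. y $ j * (\<Sum>i<?N. x $ i * omega n (unit_vec ?N i) (unit_vec ?N j)))"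
      using om by simp
    also have "\<dots> = omega n (combo ?N (\<lambda>j. x $ j) (unit_vec ?N) {..<?N})
        (combo ?N (\<lambda>j. y $ j) (unit_vec ?N) {..<?N})"
      unfolding omega_combo_right omega_combo_left ..
    also have "\<dots> = omega n x y" using full[OF xy(1)] full[OF xy(2)] by metis
    finally show ?thesis .
  qed
  ultimately show ?thesis using g u by (simp add: borel_def Sp_odd_def)
qed

lemma lin_subspace_image:
  assumes g: "g \<in> carrier_mat N N" and V: "lin_subspace N V"
  shows "lin_subspace N ((\<lambda>x. g *\<^sub>v x) ` V)"
  unfolding lin_subspace_def
proof (intro conjI allI ballI)
  note VD = lin_subspaceD[OF V]
  show "(*\<^sub>v) g ` V \<subseteq> carrier_vec N" using g VD by auto
  show "0\<^sub>v N \<in> (*\<^sub>v) g ` V" using g VD(3) by (intro image_eqI[of _ _ "0\<^sub>v N"]) auto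
  fix x assume "x \<in> (*\<^sub>v) g ` V"
  then obtain x' where x': "x' \<in> V" "x = g *\<^sub>v x'" by blast
  fix c
  show "c \<cdot>\<^sub>v x \<in> (*\<^sub>v) g ` V"
    using x' VD(1,5) g by (intro image_eqI[of _ _ "c \<cdot>\<^sub>v x'"]) (auto simp: mult_mat_vec)
next
  note VD = lin_subspaceD[OF V]
  fix x y assume "x \<in> (*\<^sub>v) g ` V" "y \<in> (*\<^sub>v) g ` V"
  then obtain x' y' where xy: "x' \<in> V" "x = g *\<^sub>v x'" "y' \<in> V" "y = g *\<^sub>v y'" by blast
  then show "x + y \<in> (*\<^sub>v) g ` V"
    using VD(1,4) g by (intro image_eqI[of _ _ "x' + y'"]) (auto simp: mult_add_distrib_mat_vec[of g N N])
qed

text \<open>At the lead p only the diagonal term survives, and beyond p nothing does. The converse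
  follows because a nonzero vector has exactly one lead.\<close>

lemma lead_pos_borel:
  assumes g: "g \<in> borel n" and x: "x \<in> carrier_vec (dimE n)"
  shows "lead_pos (g *\<^sub>v x) p \<longleftrightarrow> lead_pos x p"
proof -
  let ?N = "dimE n"
  note gD = borelD[OF g]
  have idx: "(g *\<^sub>v x) $ i = (\<Sum>j<?N. g $$ (i, j) * x $ j)" if "i < ?N" for i
    using that gD(1) x by (auto simp: scalar_prod_def atLeast0LessThan intro!: sum.cong)
  have imp: "lead_pos (g *\<^sub>v x) p" if p: "lead_pos x p" for p
  proof -
    have pN: "p < ?N" and xp: "x $ p \<noteq> 0" and x0: "\<And>i. p < i \<Longrightarrow> i < ?N \<Longrightarrow> x $ i = 0"
      using p x by (auto simp: lead_pos_def)
    have "(g *\<^sub>v x) $ p = (\<Sum>j<?N. if j = p then g $$ (p, p) * x $ p else 0)"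
      unfolding idx[OF pN]
    proof (rule sum.cong)
      fix j assume "j \<in> {..<?N}"
      then show "g $$ (p, j) * x $ j = (if j = p then g $$ (p, p) * x $ p else 0)"
        using gD(2)[of j p] x0[of j] pN by (cases j p rule: linorder_cases) auto
    qed simp
    then have 1: "(g *\<^sub>v x) $ p \<noteq> 0" using pN xp borel_diag_nonzero[OF g pN] by simp
    have 2: "(g *\<^sub>v x) $ i = 0" if i: "p < i" "i < ?N" for i
      unfolding idx[OF i(2)]
    proof (rule sum.neutral, rule ballI)
      fix j assume "j \<in> {..<?N}"
      then show "g $$ (i, j) * x $ j = 0" using gD(2)[of j i] x0[of j] i by (cases "j < i") auto
    qed
    have "dim_vec (g *\<^sub>v x) = ?N" using gD(1) by simp
    then show ?thesis using 1 2 pN by (simp add: lead_pos_def)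
  qed
  show ?thesis
  proof
    assume gp: "lead_pos (g *\<^sub>v x) p"
    have "x \<noteq> 0\<^sub>v ?N"
    proof
      assume "x = 0\<^sub>v ?N"
      then have "(g *\<^sub>v x) $ i = 0" if "i < ?N" for i using idx[OF that] by simp
      then show False using gp gD(1) by (auto simp: lead_pos_def)
    qed
    then obtain q where "lead_pos x q" using lead_pos_exists[OF x] by blast
    then show "lead_pos x p" using lead_pos_unique[OF imp gp] by blast
  qed (rule imp)
qed

lemma leads_borel:
  assumes g: "g \<in> borel n" and V: "V \<subseteq> carrier_vec (dimE n)"
  shows "leads ((\<lambda>x. g *\<^sub>v x) ` V) = leads V"
  using lead_pos_borel[OF g] V unfolding leads_def by blast

lemma IG_borel:
  assumes g: "g \<in> borel n" and V: "V \<in> IG n k"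
  shows "(\<lambda>x. g *\<^sub>v x) ` V \<in> IG n k"
proof -
  have sub: "lin_subspace (dimE n) V" and c: "V \<subseteq> carrier_vec (dimE n)"
    using V lin_subspaceD(1) by (auto simp: IG_iff)
  then show ?thesis
    using V lin_subspace_image[OF borelD(1)[OF g] sub] leads_borel[OF g c] borelD(3)[OF g]
    by (auto simp: IG_iff subset_iff)
qed

lemma omega_unit_unit:
  assumes "i < dimE n" "j < dimE n"
  shows "omega n (unit_vec (dimE n) i) (unit_vec (dimE n) j) = (if i + j = 2 * n + 1 then esign n i else 0)"
proof -
  have "2 * n + 1 - i = j \<longleftrightarrow> i + j = 2 * n + 1" using assms by (auto simp: dimE_def)
  moreover have "1 \<le> i" if "i + j = 2 * n + 1" using that assms by (auto simp: dimE_def)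
  ultimately show ?thesis
    unfolding omega_unit_left[OF assms(1)] using assms coord_index_lt[of n i]
    by (auto simp del: One_nat_def)
qed

lemma omega_unit_right:
  assumes "i < dimE n"
  shows "omega n y (unit_vec (dimE n) i) = (if 1 \<le> i then esign n (2 * n + 1 - i) * y $ (2 * n + 1 - i) else 0)"
  using omega_antisym[of n y "unit_vec (dimE n) i"] omega_unit_left[OF assms, of y] assms esign_swap[of i n]
  by (auto simp: dimE_def)

text \<open>If x leads at a and y at the partner of a, the form has just one nonzero term: for i < a
  the partner of i is past the lead of y, and for i > a the position i is past the lead of
  x.\<close>

lemma isotropic_leads_admissible:
  assumes V: "lin_subspace (dimE n) V" and iso: "\<And>x y. x \<in> V \<Longrightarrow> y \<in> V \<Longrightarrow> omega n x y = 0"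
  shows "admissible n (leads V)"
  unfolding admissible_def
proof (intro conjI ballI)
  show "leads V \<subseteq> {..2 * n}" using leads_subset[OF V] by (auto simp: dimE_def less_Suc_eq_le)
  fix a assume "a \<in> leads V"
  then obtain x where x: "x \<in> V" "lead_pos x a" by (auto simp: leads_def)
  show "2 * n + 1 - a \<notin> leads V"
  proof
    assume "2 * n + 1 - a \<in> leads V"
    then obtain y where y: "y \<in> V" "lead_pos y (2 * n + 1 - a)" by (auto simp: leads_def)
    have d: "dim_vec x = dimE n" "dim_vec y = dimE n" using x y lin_subspaceD(2)[OF V] by auto
    then have a: "a < dimE n" "1 \<le> a" using x y by (auto simp: lead_pos_def dimE_def)
    have "omega n x y = (\<Sum>i\<in>{1..2 * n}. if i = a then esign n a * x $ a * y $ (2 * n + 1 - a) else 0)"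
      unfolding omega_eq
    proof (rule sum.cong)
      fix i assume i: "i \<in> {1..2 * n}"
      show "esign n i * x $ i * y $ (2 * n + 1 - i) =
          (if i = a then esign n a * x $ a * y $ (2 * n + 1 - a) else 0)"
      proof (cases i a rule: linorder_cases)
        case less
        then have "y $ (2 * n + 1 - i) = 0" using y d i a by (auto simp: lead_pos_def dimE_def)
        then show ?thesis using less by simp
      next
        case greater
        then have "x $ i = 0" using x d i by (auto simp: lead_pos_def dimE_def)
        then show ?thesis using greater by simp
      qed simp
    qed simp
    also have "\<dots> = esign n a * x $ a * y $ (2 * n + 1 - a)" using a by (simp add: dimE_def)
    also have "\<dots> \<noteq> 0" using x y by (simp add: lead_pos_def esign_def)
    finally show False using iso[OF x(1) y(1)] by simp
  qed
qed

text \<open>The element \<open>g\<close> maps \<open>e\<^sub>j\<close> to the echelon vector of \<open>V\<close> when \<open>j\<close> is a leading position, fixes it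
  when its partner is one, and otherwise corrects it so as to become orthogonal to \<open>V\<close>.\<close>
lemma bruhat_cell:
  assumes V: "lin_subspace (dimE n) V" and iso: "\<And>x y. x \<in> V \<Longrightarrow> y \<in> V \<Longrightarrow> omega n x y = 0"
  shows "\<exists>g\<in>borel n. V = (\<lambda>x. g *\<^sub>v x) ` coord_space (dimE n) (leads V)"
proof -
  let ?N = "dimE n"
  let ?b = "\<lambda>i. 2 * n + 1 - i"
  define L where "L = leads V"
  have adm: "admissible n L" unfolding L_def using isotropic_leads_admissible[OF V iso] .
  have LN: "L \<subseteq> {..<?N}" using leads_subset[OF V] by (simp add: L_def)
  have fL: "finite L" using finite_leads[OF V] by (simp add: L_def)
  note VD = lin_subspaceD[OF V]
  obtain f where f: "is_echelon V f" using echelon_exists[OF V] by blast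
  have fV: "f a \<in> V" and flead: "lead_pos (f a) a"
    and fL1: "\<And>c. c \<in> L \<Longrightarrow> f a $ c = (if c = a then 1 else 0)" if "a \<in> L" for a
    using f that by (auto simp: is_echelon_def L_def)
  have fhigh: "f a $ i = 0" if "a \<in> L" "a < i" "i < ?N" for a i
    using flead[OF that(1)] VD(2)[OF fV[OF that(1)]] that by (auto simp: lead_pos_def)
  \<comment> \<open>The entries at partners of L are chosen so that pairing x with
    \<open>corr m\<close> gives, up to sign, the coordinate of x at the partner of m minus the same
    coordinate of the echelon expansion of x. For x in V these agree.\<close>
  define corr where "corr m = vec ?N (\<lambda>i. if i = m then 1
      else if 0 < i \<and> 0 < m \<and> ?b i \<in> L then - esign n (?b m) * esign n (?b i) * f (?b i) $ ?b m
      else 0)" for m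
  define u where "u j = (if j \<in> L then f j else if ?b j \<in> L then unit_vec ?N j else corr j)" for j
  define g where "g = mat ?N ?N (\<lambda>(i, j). u j $ i)"
  have ud: "dim_vec (u j) = ?N" for j using VD(2)[OF fV] by (auto simp: u_def corr_def)
  have colg: "col g j = u j" if "j < ?N" for j
    using that ud by (intro eq_vecI) (auto simp: g_def)
  have gc: "g \<in> carrier_mat ?N ?N" by (simp add: g_def)
  have pair: "?b i \<in> {1..2 * n}" "?b (?b i) = i" if "i \<in> {1..2 * n}" for i using that by auto
  have om_corr: "omega n x (corr m) = (if 0 < m then esign n (?b m) *
      (x $ ?b m - (\<Sum>i\<in>L \<inter> {1..2 * n}. x $ i * f i $ ?b m)) else 0)"
    if m: "m < ?N" "m \<notin> L" "?b m \<notin> L" and x: "x \<in> carrier_vec ?N" for x m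
  proof (cases "0 < m")
    case False
    have "omega n x (corr m) = (\<Sum>i\<in>{1..2 * n}. 0)"
      unfolding omega_eq
    proof (rule sum.cong)
      fix i assume "i \<in> {1..2 * n}"
      then have "corr m $ ?b i = 0" using False by (auto simp: corr_def dimE_def)
      then show "esign n i * x $ i * corr m $ ?b i = 0" by simp
    qed simp
    then show ?thesis using False by simp
  next
    case True
    have m2: "m \<in> {1..2 * n}" using True m by (auto simp: dimE_def)
    have "omega n x (corr m) = (\<Sum>i\<in>{1..2 * n}. (if i = ?b m then esign n (?b m) * x $ ?b m else 0)
        + (if i \<in> L then - (esign n (?b m) * (x $ i * f i $ ?b m)) else 0))"
      unfolding omega_eq
    proof (rule sum.cong)
      fix i assume i: "i \<in> {1..2 * n}"
      then have bi: "?b i < ?N" "0 < ?b i" "?b (?b i) = i" by (auto simp: dimE_def)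
      have eq: "?b i = m \<longleftrightarrow> i = ?b m" using i m2 by auto
      have s: "esign n i * (esign n i * z) = z" for z
        by (simp add: mult.assoc[symmetric])
      show "esign n i * x $ i * corr m $ ?b i = (if i = ?b m then esign n (?b m) * x $ ?b m else 0)
        + (if i \<in> L then - (esign n (?b m) * (x $ i * f i $ ?b m)) else 0)"
      proof (cases "i = ?b m")
        case True
        then have "corr m $ ?b i = 1" using bi eq by (simp add: corr_def)
        then show ?thesis using True m by simp
      next
        case False
        then have "corr m $ ?b i =
            (if i \<in> L then - esign n (?b m) * esign n i * f i $ ?b m else 0)"
          using bi eq \<open>0 < m\<close> by (simp add: corr_def)
        then show ?thesis using False s by (simp add: mult_ac)
      qed
    qed simp
    also have "\<dots> = (\<Sum>i\<in>{1..2 * n}. if i = ?b m then esign n (?b m) * x $ ?b m else 0) +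
        (\<Sum>i\<in>{1..2 * n}. if i \<in> L then - (esign n (?b m) * (x $ i * f i $ ?b m)) else 0)"
      by (rule sum.distrib)
    also have "(\<Sum>i\<in>{1..2 * n}. if i = ?b m then esign n (?b m) * x $ ?b m else 0) =
        esign n (?b m) * x $ ?b m"
      using pair(1)[OF m2] by (simp only: sum.delta' sum.delta finite_atLeastAtMost if_True)
    also have "(\<Sum>i\<in>{1..2 * n}. if i \<in> L then - (esign n (?b m) * (x $ i * f i $ ?b m)) else 0) =
        (\<Sum>i\<in>{1..2 * n} \<inter> L. - (esign n (?b m) * (x $ i * f i $ ?b m)))"
      by (rule sum.inter_restrict[symmetric]) simp
    finally show ?thesis
      using True by (simp add: sum_negf sum_distrib_left Int_commute algebra_simps)
  qed
  have om_corr_V: "omega n x (corr m) = 0" if m: "m < ?N" "m \<notin> L" "?b m \<notin> L" and x: "x \<in> V" for x m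
  proof (cases "0 < m")
    case True
    have bm: "?b m < ?N" "?b m \<noteq> 0" using True m by (auto simp: dimE_def)
    have "x $ ?b m = combo ?N (\<lambda>a. x $ a) f L $ ?b m"
      using echelon_expand[OF V f x] by (simp only: L_def)
    also have "\<dots> = (\<Sum>a\<in>L. x $ a * f a $ ?b m)" using bm by simp
    \<comment> \<open>The form does not see position 0, so the term a = 0 must be dropped; an
      echelon vector with lead 0 has no other nonzero coordinate.\<close>
    also have "\<dots> = (\<Sum>a\<in>L \<inter> {1..2 * n}. x $ a * f a $ ?b m)"
    proof (rule sum.mono_neutral_right)
      show "\<forall>a\<in>L - L \<inter> {1..2 * n}. x $ a * f a $ ?b m = 0"
      proof
        fix a assume "a \<in> L - L \<inter> {1..2 * n}"
        then have "a \<in> L" "a = 0" using LN by (auto simp: dimE_def)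
        then have "f a $ ?b m = 0" using fhigh[of a "?b m"] bm by auto
        then show "x $ a * f a $ ?b m = 0" by simp
      qed
    qed (use fL in auto)
    finally show ?thesis using om_corr[OF m] x VD(1) by simp
  qed (use om_corr[OF m] x VD(1) in auto)
  have om_right: "omega n (u i) (corr j) = omega n (unit_vec ?N i) (unit_vec ?N j)"
    if i: "i < ?N" and j: "j < ?N" "j \<notin> L" "?b j \<notin> L" for i j
  proof -
    have rhs: "omega n (unit_vec ?N i) (unit_vec ?N j) = (if i + j = 2 * n + 1 then esign n i else 0)"
      by (rule omega_unit_unit[OF i j(1)])
    show ?thesis
    proof (cases "i \<in> L")
      case True
      then have "i + j \<noteq> 2 * n + 1" using j by (metis add_diff_cancel_right')
      then show ?thesis using rhs om_corr_V[OF j fV[OF True]] True by (simp add: u_def)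
    next
      case False
      \<comment> \<open>For i outside L all entries of \<open>u i\<close> at positions of L in 1..2n
        vanish, since partners of L are not in L. The correction terms disappear and only the entry
        at the partner of j is left.\<close>
      have ui0: "u i $ a = 0" if "a \<in> L \<inter> {1..2 * n}" for a
      proof -
        have a: "a < ?N" "a \<noteq> i" "?b a \<notin> L" using that False adm by (auto simp: dimE_def admissible_def)
        then have "corr i $ a = 0" by (simp add: corr_def)
        then show ?thesis using False i a by (simp add: u_def)
      qed
      have sum0: "(\<Sum>a\<in>L \<inter> {1..2 * n}. u i $ a * f a $ ?b j) = 0"
        by (rule sum.neutral) (use ui0 in auto)
      have *: "omega n (u i) (corr j) = (if 0 < j then esign n (?b j) * u i $ ?b j else 0)"
        unfolding om_corr[OF j carrier_vecI[OF ud]] sum0 by (simp only: diff_zero)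
      show ?thesis
      proof (cases "0 < j")
        case True
        then have bj: "?b j < ?N" "0 < ?b j" "?b (?b j) = j" using j by (auto simp: dimE_def)
        have cij: "corr i $ ?b j = (if i = ?b j then 1 else 0)" using j bj by (simp add: corr_def)
        have "u i $ ?b j = (if i = ?b j then 1 else 0)"
        proof (cases "?b i \<in> L")
          case bi: True
          then have "i \<noteq> ?b j" using j bj by auto
          moreover have "u i = unit_vec ?N i" using bi False by (simp add: u_def)
          ultimately show ?thesis using bj i by auto
        next
          case bi: False
          then have "u i = corr i" using False by (simp add: u_def)
          then show ?thesis using cij by simp
        qed
        moreover have "i = ?b j \<longleftrightarrow> i + j = 2 * n + 1" using bj True j by (auto simp: dimE_def)
        ultimately show ?thesis using rhs * True by auto
      next
        case False
        then show ?thesis using rhs * i by (auto simp: dimE_def)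
      qed
    qed
  qed
  have "g \<in> borel n"
  proof (rule borelI[OF gc])
    fix i j assume ij: "j < i" "i < ?N"
    have "u j $ i = 0"
    proof -
      have "corr j $ i = 0" if "j \<notin> L" "?b j \<notin> L"
      proof -
        \<comment> \<open>Taking partners reverses the order: j < i puts the partner of j past the
          lead of this echelon vector.\<close>
        have "f (?b i) $ ?b j = 0" if "?b i \<in> L" "0 < j"
          using that fhigh[of "?b i" "?b j"] ij by (auto simp: dimE_def)
        then show ?thesis using ij by (auto simp: corr_def)
      qed
      then show ?thesis using fhigh[of j i] ij by (auto simp: u_def)
    qed
    then show "g $$ (i, j) = 0" using ij by (simp add: g_def)
  next
    fix i assume i: "i < ?N"
    have "u i $ i = 1" using fL1[of i i] i by (auto simp: u_def corr_def)
    then show "g $$ (i, i) \<noteq> 0" using i by (simp add: g_def)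
  next
    fix i j assume ij: "i < ?N" "j < ?N"
    have unit: "omega n (unit_vec ?N i) (unit_vec ?N j) = (if i + j = 2 * n + 1 then esign n i else 0)"
      by (rule omega_unit_unit[OF ij])
    consider "j \<notin> L" "?b j \<notin> L" | "i \<notin> L" "?b i \<notin> L" | "i \<in> L" "j \<in> L"
      | "i \<in> L" "j \<notin> L" "?b j \<in> L" | "i \<notin> L" "?b i \<in> L" "j \<in> L"
      | "i \<notin> L" "?b i \<in> L" "j \<notin> L" "?b j \<in> L" by blast
    then have "omega n (u i) (u j) = omega n (unit_vec ?N i) (unit_vec ?N j)"
    proof cases
      case 1
      then show ?thesis using om_right[OF ij(1) ij(2)] by (simp add: u_def[of j])
    next
      case 2
      then show ?thesis
        using om_right[OF ij(2) ij(1)] omega_antisym[of n "u i" "u j"]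
          omega_antisym[of n "unit_vec ?N i" "unit_vec ?N j"] by (simp add: u_def[of i])
    next
      case 3
      then have "i + j \<noteq> 2 * n + 1"
        using adm unfolding admissible_def by (metis add_diff_cancel_left')
      then show ?thesis using 3 unit iso[OF fV fV] by (simp add: u_def)
    next
      case 4
      then have b: "?b j \<in> {1..2 * n}" using LN ij by (auto simp: dimE_def)
      have "omega n (u i) (u j) = esign n (?b j) * (if ?b j = i then 1 else 0)"
        using 4 ij b fL1[of i "?b j"] by (auto simp: u_def omega_unit_right)
      moreover have "?b j = i \<longleftrightarrow> i + j = 2 * n + 1" using b by auto
      ultimately show ?thesis using unit by auto
    next
      case 5
      then have b: "?b i \<in> {1..2 * n}" using LN ij by (auto simp: dimE_def)
      have "omega n (u i) (u j) = esign n i * (if ?b i = j then 1 else 0)"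
        using 5 ij b fL1[of j "?b i"] by (auto simp: u_def omega_unit_left)
      moreover have "?b i = j \<longleftrightarrow> i + j = 2 * n + 1" using b by auto
      ultimately show ?thesis using unit by auto
    next
      case 6
      then show ?thesis by (simp add: u_def)
    qed
    then show "omega n (col g i) (col g j) = omega n (unit_vec ?N i) (unit_vec ?N j)"
      using colg ij by simp
  qed
  moreover have "V = (\<lambda>x. g *\<^sub>v x) ` coord_space ?N L"
  proof -
    have gx: "g *\<^sub>v x = combo ?N (\<lambda>a. x $ a) f L" if x: "x \<in> coord_space ?N L" for x
    proof (rule eq_vecI)
      have xc: "x \<in> carrier_vec ?N" using x by (simp add: coord_space_def)
      fix i assume "i < dim_vec (combo ?N (\<lambda>a. x $ a) f L)"
      then have i: "i < ?N" by simp
      have "(g *\<^sub>v x) $ i = (\<Sum>j<?N. x $ j * u j $ i)"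
        unfolding mult_mat_vec_combo[OF gc xc] using i colg by simp
      also have "\<dots> = (\<Sum>j\<in>L. x $ j * u j $ i)"
        by (rule sum.mono_neutral_right) (use LN x in \<open>auto simp: coord_space_def\<close>)
      also have "\<dots> = (\<Sum>j\<in>L. x $ j * f j $ i)" by (rule sum.cong) (auto simp: u_def)
      finally show "(g *\<^sub>v x) $ i = combo ?N (\<lambda>a. x $ a) f L $ i" using i by simp
    qed (simp add: g_def)
    show ?thesis
    proof
      show "(\<lambda>x. g *\<^sub>v x) ` coord_space ?N L \<subseteq> V"
        using gx combo_mem[OF V fL fV] by auto
      show "V \<subseteq> (\<lambda>x. g *\<^sub>v x) ` coord_space ?N L"
      proof
        fix x assume x: "x \<in> V"
        define y where "y = vec ?N (\<lambda>i. if i \<in> L then x $ i else 0)"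
        have "y \<in> coord_space ?N L" by (auto simp: y_def coord_space_def)
        moreover have "combo ?N (\<lambda>a. y $ a) f L = combo ?N (\<lambda>a. x $ a) f L"
          unfolding combo_def y_def using LN by (intro eq_vecI) (auto intro!: sum.cong)
        ultimately have "g *\<^sub>v y = x" using gx echelon_expand[OF V f x] by (simp add: L_def)
        then show "x \<in> (\<lambda>x. g *\<^sub>v x) ` coord_space ?N L" using \<open>y \<in> coord_space ?N L\<close> by blast
      qed
    qed
  qed
  ultimately show ?thesis unfolding L_def by blast
qed

lemma coord_space_isotropic:
  assumes "admissible n S" "x \<in> coord_space (dimE n) S" "y \<in> coord_space (dimE n) S"
  shows "omega n x y = 0"
  unfolding omega_eq
proof (rule sum.neutral, rule ballI)
  fix i assume i: "i \<in> {1..2 * n}"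
  then have "i \<notin> S \<or> 2 * n + 1 - i \<notin> S" using assms(1) by (auto simp: admissible_def)
  moreover have "i < dimE n" "2 * n + 1 - i < dimE n" using i by (auto simp: dimE_def)
  ultimately have "x $ i = 0 \<or> y $ (2 * n + 1 - i) = 0"
    using assms(2,3) unfolding coord_space_def by blast
  then show "esign n i * x $ i * y $ (2 * n + 1 - i) = 0" by auto
qed

lemma coord_space_IG:
  assumes S: "admissible n S" and "card S = k"
  shows "coord_space (dimE n) S \<in> IG n k"
proof -
  have "leads (coord_space (dimE n) S) = S"
    by (rule leads_coord_space) (use S in \<open>auto simp: admissible_def dimE_def less_Suc_eq_le\<close>)
  then show ?thesis
    using assms(2) coord_space_isotropic[OF S] coord_space_subspace by (simp add: IG_iff)
qed

section \<open>Pluecker coordinates\<close>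

text \<open>Rows are chosen by a function instead of a set, so that they may be repeated, reordered
  or replaced one at a time.\<close>

definition rowsel :: "nat \<Rightarrow> 'a mat \<Rightarrow> (nat \<Rightarrow> nat) \<Rightarrow> 'a mat" where
  "rowsel k A r = mat k k (\<lambda>(i, j). A $$ (r i, j))"

lemma rowsel_carrier [simp]: "rowsel k A r \<in> carrier_mat k k"
  by (simp add: rowsel_def)

lemma rowsel_index [simp]: "i < k \<Longrightarrow> j < k \<Longrightarrow> rowsel k A r $$ (i, j) = A $$ (r i, j)"
  by (simp add: rowsel_def)

lemma bij_betw_pick:
  assumes "finite T"
  shows "bij_betw (pick T) {..<card T} T"
proof -
  have inj: "inj_on (pick T) {..<card T}"
  proof (rule inj_onI)
    fix x y assume xy: "x \<in> {..<card T}" "y \<in> {..<card T}" "pick T x = pick T y"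
    then show "x = y"
      using pick_mono_le[of y T x] pick_mono_le[of x T y] by (cases x y rule: linorder_cases) auto
  qed
  have "pick T ` {..<card T} \<subseteq> T" using pick_in_set_le by auto
  moreover have "card (pick T ` {..<card T}) = card T" using inj by (simp add: card_image)
  ultimately show ?thesis using inj assms by (simp add: bij_betw_def card_subset_eq)
qed

lemma card_pick_filter:
  assumes "finite T"
  shows "card {i \<in> {..<card T}. P (pick T i)} = card {x \<in> T. P x}"
proof -
  have "bij_betw (pick T) {i \<in> {..<card T}. P (pick T i)} {x \<in> T. P x}"
    using bij_betw_pick[OF assms] unfolding bij_betw_def by (auto intro: inj_on_subset)
  then show ?thesis by (rule bij_betw_same_card)
qed

lemma card_pick_ge:
  assumes "finite T" "card T = k"
  shows "card {i \<in> {..<k}. \<not> pick T i < j} + cnt T j = k"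
    and "card {i \<in> {..<k}. pick T i < j} = cnt T j"
proof -
  show c: "card {i \<in> {..<k}. pick T i < j} = cnt T j"
    using card_pick_filter[OF assms(1), of "\<lambda>x. x < j"] assms(2) by (simp add: cnt_def Int_def)
  have "card ({i \<in> {..<k}. \<not> pick T i < j} \<union> {i \<in> {..<k}. pick T i < j}) =
      card {i \<in> {..<k}. \<not> pick T i < j} + card {i \<in> {..<k}. pick T i < j}"
    by (rule card_Un_disjoint) auto
  moreover have "{i \<in> {..<k}. \<not> pick T i < j} \<union> {i \<in> {..<k}. pick T i < j} = {..<k}" by auto
  ultimately show "card {i \<in> {..<k}. \<not> pick T i < j} + cnt T j = k" using c by simp
qed

lemma pluecker_rowsel:
  assumes "A \<in> carrier_mat (dimE n) k" "T \<subseteq> {..<dimE n}" "card T = k"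
  shows "pluecker n k A T = det (rowsel k A (pick T))"
proof -
  have "{i. i < dim_row A \<and> i \<in> T} = T" "{j. j < dim_col A \<and> j \<in> UNIV} = {..<k}"
    using assms by auto
  then have "submatrix A T UNIV = rowsel k A (pick T)"
    using assms by (simp add: submatrix_def rowsel_def pick_UNIV)
  then show ?thesis using assms by (simp add: pluecker_def)
qed

lemma frame_iff: "frame n k V A \<longleftrightarrow> A \<in> carrier_mat (dimE n) k \<and> V = (\<lambda>x. A *\<^sub>v x) ` carrier_vec k"
proof -
  have "vec_space.col_space (dimE n) A = (\<lambda>x. A *\<^sub>v x) ` carrier_vec k"
    if "A \<in> carrier_mat (dimE n) k"
  proof -
    interpret vec_space "TYPE(complex)" "dimE n" .
    show ?thesis using col_space_eq[OF that] that by auto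
  qed
  then show ?thesis unfolding frame_def by auto
qed

definition echelon_frame :: "nat \<Rightarrow> nat \<Rightarrow> complex vec set \<Rightarrow> (nat \<Rightarrow> complex vec) \<Rightarrow> complex mat" where
  "echelon_frame N k V f = mat N k (\<lambda>(i, j). f (pick (leads V) j) $ i)"

lemma combo_pick:
  assumes "finite S"
  shows "combo N c f S = combo N (\<lambda>j. c (pick S j)) (\<lambda>j. f (pick S j)) {..<card S}"
  unfolding combo_def
  by (rule eq_vecI) (simp_all add: sum.reindex_bij_betw[OF bij_betw_pick[OF assms], symmetric])

text \<open>The columns of a frame lie in V, and their coefficients in the echelon basis are their
  entries at the leading positions. Hence all maximal minors of A are those of the echelon frame
  times one common factor.\<close>

lemma frame_factor:
  assumes V: "lin_subspace (dimE n) V" "card (leads V) = k" and f: "is_echelon V f"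
    and A: "frame n k V A" and r: "\<And>i. i < k \<Longrightarrow> r i < dimE n"
  shows "rowsel k A r = rowsel k (echelon_frame (dimE n) k V f) r * rowsel k A (pick (leads V))"
proof (rule eq_matI)
  let ?E = "echelon_frame (dimE n) k V f" and ?p = "pick (leads V)"
  have Ac: "A \<in> carrier_mat (dimE n) k" and AV: "V = (\<lambda>x. A *\<^sub>v x) ` carrier_vec k"
    using A by (auto simp: frame_iff)
  fix i l assume "i < dim_row (rowsel k ?E r * rowsel k A ?p)" "l < dim_col (rowsel k ?E r * rowsel k A ?p)"
  then have il: "i < k" "l < k" by (auto simp: rowsel_def)
  have pN: "?p j < dimE n" if "j < k" for j
    using pick_in_set_le[of j "leads V"] that V leads_subset[OF V(1)] by auto
  have "col A l = A *\<^sub>v unit_vec k l"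
    using Ac il by (intro eq_vecI) (auto simp: scalar_prod_right_unit)
  then have "col A l \<in> V" unfolding AV using il by auto
  then have "col A l = combo (dimE n) (\<lambda>a. col A l $ a) f (leads V)"
    by (rule echelon_expand[OF V(1) f])
  also have "\<dots> = combo (dimE n) (\<lambda>j. col A l $ ?p j) (\<lambda>j. f (?p j)) {..<k}"
    using combo_pick[OF finite_leads[OF V(1)]] V(2) by metis
  finally have "col A l $ r i = (\<Sum>j<k. col A l $ ?p j * f (?p j) $ r i)"
    using r[OF il(1)] by (metis combo_index)
  also have "\<dots> = (\<Sum>j<k. ?E $$ (r i, j) * A $$ (?p j, l))"
    using Ac il r[OF il(1)] pN by (intro sum.cong) (auto simp: echelon_frame_def)
  finally show "rowsel k A r $$ (i, l) = (rowsel k ?E r * rowsel k A ?p) $$ (i, l)"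
    using il r[OF il(1)] Ac by (simp add: scalar_prod_def atLeast0LessThan rowsel_def)
qed (auto simp: rowsel_def)

text \<open>The echelon vectors are images under A of some vectors; these form an inverse of the
  submatrix, because the echelon vectors restrict to the identity at the leading positions.\<close>

lemma frame_det_leads:
  assumes V: "lin_subspace (dimE n) V" "card (leads V) = k" and A: "frame n k V A"
  shows "det (rowsel k A (pick (leads V))) \<noteq> 0"
proof -
  let ?p = "pick (leads V)"
  obtain f where f: "is_echelon V f" using echelon_exists[OF V(1)] by blast
  have Ac: "A \<in> carrier_mat (dimE n) k" and AV: "V = (\<lambda>x. A *\<^sub>v x) ` carrier_vec k"
    using A by (auto simp: frame_iff)
  have pL: "?p j \<in> leads V" if "j < k" for j using pick_in_set_le[of j "leads V"] that V by auto
  have pN: "?p j < dimE n" if "j < k" for j using pL[OF that] leads_subset[OF V(1)] by auto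
  have "\<exists>h. h \<in> carrier_vec k \<and> f (?p j) = A *\<^sub>v h" if "j < k" for j
    using f pL[OF that] AV unfolding is_echelon_def by blast
  then obtain h where h: "\<And>j. j < k \<Longrightarrow> h j \<in> carrier_vec k \<and> f (?p j) = A *\<^sub>v h j" by metis
  define H where "H = mat k k (\<lambda>(i, j). h j $ i)"
  have Hc: "H \<in> carrier_mat k k" by (simp add: H_def)
  have "rowsel k A ?p * H = 1\<^sub>m k"
  proof (rule eq_matI)
    fix i j assume ij: "i < dim_row (1\<^sub>m k)" "j < dim_col (1\<^sub>m k)"
    then have ij: "i < k" "j < k" by auto
    have "(rowsel k A ?p * H) $$ (i, j) = (\<Sum>l<k. A $$ (?p i, l) * h j $ l)"
      using ij by (simp add: scalar_prod_def atLeast0LessThan rowsel_def H_def)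
    also have "\<dots> = (A *\<^sub>v h j) $ ?p i"
      using Ac h[OF ij(2)] pN[OF ij(1)] by (auto simp: scalar_prod_def atLeast0LessThan intro!: sum.cong)
    also have "\<dots> = f (?p j) $ ?p i" using h[OF ij(2)] by simp
    also have "\<dots> = (if ?p i = ?p j then 1 else 0)"
      using f pL[OF ij(1)] pL[OF ij(2)] unfolding is_echelon_def by blast
    also have "?p i = ?p j \<longleftrightarrow> i = j"
      using bij_betw_pick[OF finite_leads[OF V(1)]] ij V(2) unfolding bij_betw_def inj_on_def by auto
    finally show "(rowsel k A ?p * H) $$ (i, j) = 1\<^sub>m k $$ (i, j)" using ij by simp
  qed (auto simp: rowsel_def H_def)
  then have "det (rowsel k A ?p) * det H = 1" using det_mult[OF rowsel_carrier[of k A ?p] Hc] by simp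
  then show ?thesis by auto
qed

lemma echelon_frame_frame:
  assumes V: "lin_subspace (dimE n) V" "card (leads V) = k" and f: "is_echelon V f"
  shows "frame n k V (echelon_frame (dimE n) k V f)"
proof -
  let ?E = "echelon_frame (dimE n) k V f" and ?p = "pick (leads V)" and ?N = "dimE n"
  have Ec: "?E \<in> carrier_mat ?N k" by (simp add: echelon_frame_def)
  have pL: "?p j \<in> leads V" if "j < k" for j using pick_in_set_le[of j "leads V"] that V by auto
  have fV: "f (?p j) \<in> V" if "j < k" for j using f pL[OF that] by (simp add: is_echelon_def)
  have act: "?E *\<^sub>v x = combo ?N (\<lambda>j. x $ j) (\<lambda>j. f (?p j)) {..<k}" if "x \<in> carrier_vec k" for x
    unfolding mult_mat_vec_combo[OF Ec that] combo_def
    by (rule eq_vecI) (auto simp: echelon_frame_def intro!: sum.cong)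
  have "V = (\<lambda>x. ?E *\<^sub>v x) ` carrier_vec k"
  proof
    show "(\<lambda>x. ?E *\<^sub>v x) ` carrier_vec k \<subseteq> V"
    proof
      fix y assume "y \<in> (\<lambda>x. ?E *\<^sub>v x) ` carrier_vec k"
      then obtain x where x: "x \<in> carrier_vec k" "y = ?E *\<^sub>v x" by blast
      show "y \<in> V" unfolding x(2) act[OF x(1)]
        by (rule combo_mem[OF V(1)]) (use fV in auto)
    qed
    show "V \<subseteq> (\<lambda>x. ?E *\<^sub>v x) ` carrier_vec k"
    proof
      fix x assume x: "x \<in> V"
      let ?y = "vec k (\<lambda>j. x $ ?p j)"
      have "x = combo ?N (\<lambda>j. x $ ?p j) (\<lambda>j. f (?p j)) {..<k}"
        using echelon_expand[OF V(1) f x] combo_pick[OF finite_leads[OF V(1)]] V(2) by metis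
      also have "\<dots> = ?E *\<^sub>v ?y" unfolding act[OF vec_carrier] combo_def
        by (rule eq_vecI) (auto intro!: sum.cong)
      finally show "x \<in> (\<lambda>x. ?E *\<^sub>v x) ` carrier_vec k" by auto
    qed
  qed
  then show ?thesis using Ec by (simp add: frame_iff)
qed

text \<open>A permutation must send at least |I| + |J| - k elements of I into J, so each term of the
  Leibniz formula contains that many factors divisible by X. Taking X = 0 shows that too large a
  block of zeros kills the determinant; taking X to be the variable bounds an order of
  vanishing.\<close>

lemma power_dvd_det_block:
  fixes M :: "'a :: comm_ring_1 mat"
  assumes M: "M \<in> carrier_mat k k" and I: "I \<subseteq> {..<k}" and J: "J \<subseteq> {..<k}"
    and X: "\<And>i j. i \<in> I \<Longrightarrow> j \<in> J \<Longrightarrow> X dvd M $$ (i, j)"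
  shows "X ^ (card I + card J - k) dvd det M"
  unfolding det_def'[OF M]
proof (rule dvd_sum)
  fix p assume "p \<in> {p. p permutes {0..<k}}"
  then have p: "p permutes {0..<k}" by simp
  define D where "D = {i \<in> I. p i \<in> J}"
  have fin: "finite I" "finite J" using I J finite_subset by blast+
  have "p ` I \<union> J \<subseteq> {..<k}" using I J permutes_in_image[OF p] by auto
  then have "card (p ` I \<union> J) \<le> k" using card_mono[of "{..<k}"] by fastforce
  moreover have "card (p ` I) = card I" using permutes_inj_on[OF p] by (rule card_image)
  moreover have "card (p ` I \<inter> J) + card (p ` I \<union> J) = card (p ` I) + card J"
    using card_Un_Int[of "p ` I" J] fin by simp
  moreover have "card (p ` I \<inter> J) = card D"
  proof -
    have "p ` I \<inter> J = p ` D" by (auto simp: D_def)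
    then show ?thesis using card_image[OF permutes_inj_on[OF p], of D] by simp
  qed
  ultimately have le: "card I + card J - k \<le> card D" by linarith
  have "X ^ card D dvd (\<Prod>i\<in>D. M $$ (i, p i))"
    using prod_dvd_prod[of D "\<lambda>_. X" "\<lambda>i. M $$ (i, p i)"] X by (simp add: D_def)
  moreover have "(\<Prod>i\<in>D. M $$ (i, p i)) dvd (\<Prod>i = 0..<k. M $$ (i, p i))"
    by (rule prod_dvd_prod_subset) (use I in \<open>auto simp: D_def\<close>)
  ultimately have "X ^ card D dvd (\<Prod>i = 0..<k. M $$ (i, p i))" by (rule dvd_trans)
  with le_imp_power_dvd[OF le] have "X ^ (card I + card J - k) dvd (\<Prod>i = 0..<k. M $$ (i, p i))"
    by (rule dvd_trans)
  then show "X ^ (card I + card J - k) dvd signof p * (\<Prod>i = 0..<k. M $$ (i, p i))"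
    by (rule dvd_mult)
qed

text \<open>In the echelon frame the columns with lead below j vanish in the rows from j on. Among
  the rows in T this is a zero block of k - \<open>cnt T j\<close> rows and
  \<open>cnt (leads U) j\<close> columns, too large for a nonzero minor.\<close>

lemma pluecker_zero_below:
  assumes U: "lin_subspace (dimE n) U" "card (leads U) = k" and A: "frame n k U A"
    and T: "T \<subseteq> {..<dimE n}" "card T = k" and lt: "cnt T j < cnt (leads U) j"
  shows "pluecker n k A T = 0"
proof -
  let ?S = "leads U"
  obtain f where f: "is_echelon U f" using echelon_exists[OF U(1)] by blast
  let ?E = "echelon_frame (dimE n) k U f"
  have fT: "finite T" using T finite_subset by blast
  have fS: "finite ?S" using finite_leads[OF U(1)] .
  have pT: "pick T i \<in> T" if "i < k" for i using pick_in_set_le[of i T] T that by auto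
  have pS: "pick ?S i \<in> ?S" if "i < k" for i using pick_in_set_le[of i ?S] U that by auto
  define I where "I = {i \<in> {..<k}. \<not> pick T i < j}"
  define J where "J = {i \<in> {..<k}. pick ?S i < j}"
  have pos: "card I + card J - k > 0"
    using card_pick_ge(1)[OF fT T(2), of j] card_pick_ge(2)[OF fS U(2), of j] lt
    unfolding I_def J_def by linarith
  have "(0::complex) ^ (card I + card J - k) dvd det (rowsel k ?E (pick T))"
  proof (rule power_dvd_det_block)
    fix i c assume ic: "i \<in> I" "c \<in> J"
    then have lt: "pick ?S c < pick T i" "i < k" "c < k" by (auto simp: I_def J_def)
    have "pick T i < dimE n" using pT[OF lt(2)] T by auto
    moreover have "f (pick ?S c) \<in> U" "lead_pos (f (pick ?S c)) (pick ?S c)"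
      using f pS[OF lt(3)] by (auto simp: is_echelon_def)
    ultimately have "f (pick ?S c) $ pick T i = 0"
      using lt lin_subspaceD(2)[OF U(1)] by (auto simp: lead_pos_def)
    then show "0 dvd rowsel k ?E (pick T) $$ (i, c)"
      using lt \<open>pick T i < dimE n\<close> by (simp add: echelon_frame_def)
  qed (auto simp: I_def J_def)
  then have "det (rowsel k ?E (pick T)) = 0" using pos by (simp add: power_0_left)
  moreover have "rowsel k A (pick T) = rowsel k ?E (pick T) * rowsel k A (pick ?S)"
    by (rule frame_factor[OF U f A]) (use pT T in auto)
  ultimately have "det (rowsel k A (pick T)) = 0" by (simp add: det_mult[OF rowsel_carrier rowsel_carrier])
  then show ?thesis using A T by (simp add: pluecker_rowsel frame_iff)
qed

text \<open>One coordinate separates: if the count of V at j were too small, the Pluecker coordinate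
  at \<open>leads V\<close> would vanish on all of Y but not at V.\<close>

lemma dominated_zariski_closure:
  assumes orb: "\<And>U. U \<in> Y \<Longrightarrow> U \<in> IG n k \<and> leads U = S" and V: "V \<in> zariski_closure n k Y"
  shows "dominated (leads V) S"
  unfolding dominated_def
proof (rule allI, rule ccontr)
  fix j assume "\<not> cnt S j \<le> cnt (leads V) j"
  then have lt: "cnt (leads V) j < cnt S j" by simp
  have VIG: "V \<in> IG n k" using V by (simp add: zariski_closure_def)
  then have Vs: "lin_subspace (dimE n) V" "card (leads V) = k" by (auto simp: IG_iff)
  have T: "leads V \<subseteq> {..<dimE n}" using leads_subset[OF Vs(1)] .
  let ?F = "\<lambda>x :: nat set \<Rightarrow> complex. x (leads V)"
  have "vanishes_at n k ?F U" if "U \<in> Y" for U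
    using orb[OF that] lt pluecker_zero_below[of n U k _ "leads V" j] T Vs
    by (auto simp: vanishes_at_def IG_iff)
  then have "vanishes_at n k ?F V"
    using V hom_poly.var[of "leads V"] unfolding zariski_closure_def by blast
  moreover obtain f where "is_echelon V f" using echelon_exists[OF Vs(1)] by blast
  then have fr: "frame n k V (echelon_frame (dimE n) k V f)" by (rule echelon_frame_frame[OF Vs])
  ultimately have "pluecker n k (echelon_frame (dimE n) k V f) (leads V) = 0"
    by (auto simp: vanishes_at_def)
  then show False
    using frame_det_leads[OF Vs fr] pluecker_rowsel[OF _ T Vs(2)] fr by (simp add: frame_iff)
qed

section \<open>Root subgroups acting on coordinate subspaces\<close>

lemma mult_mat_vec_index:
  assumes "g \<in> carrier_mat N m" "x \<in> carrier_vec m" "i < N"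
  shows "(g *\<^sub>v x) $ i = (\<Sum>j<m. g $$ (i, j) * x $ j)"
  using assms by (auto simp: scalar_prod_def atLeast0LessThan intro!: sum.cong)

text \<open>The root subgroup that adds t times coordinate a to coordinate b; s is the coefficient
  of the mirrored entry. It is also used with s = 0, where it may fail to be symplectic on all of E;
  only isotropy of the image of one coordinate subspace is required.\<close>

definition shear :: "nat \<Rightarrow> nat \<Rightarrow> nat \<Rightarrow> complex \<Rightarrow> complex \<Rightarrow> complex mat" where
  "shear n a b s t = mat (dimE n) (dimE n) (\<lambda>(i, j). (if i = j then 1 else 0) +
     t * ((if i = b \<and> j = a then 1 else 0) + (if i = 2 * n + 1 - a \<and> j = 2 * n + 1 - b then s else 0)))"

lemma shear_carrier [simp]: "shear n a b s t \<in> carrier_mat (dimE n) (dimE n)"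
  by (simp add: shear_def)

lemma shear_apply:
  assumes x: "x \<in> carrier_vec (dimE n)" and ab: "a < dimE n" "1 \<le> b"
  shows "shear n a b s t *\<^sub>v x = vec (dimE n) (\<lambda>i. x $ i + t * ((if i = b then x $ a else 0) +
     (if i = 2 * n + 1 - a then s * x $ (2 * n + 1 - b) else 0)))"
proof (rule eq_vecI)
  let ?N = "dimE n"
  fix i assume "i < dim_vec (vec ?N (\<lambda>i. x $ i + t * ((if i = b then x $ a else 0) +
     (if i = 2 * n + 1 - a then s * x $ (2 * n + 1 - b) else 0))))"
  then have i: "i < ?N" by simp
  define A B where "A = 2 * n + 1 - a" and "B = 2 * n + 1 - b"
  have B: "B < ?N" using ab by (simp add: dimE_def B_def)
  have "(shear n a b s t *\<^sub>v x) $ i = (\<Sum>j<?N. shear n a b s t $$ (i, j) * x $ j)"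
    by (rule mult_mat_vec_index[OF shear_carrier x i])
  also have "\<dots> = (\<Sum>j<?N. (if j = i then x $ i else 0) + (if j = a then (if i = b then t * x $ a else 0) else 0)
      + (if j = B then (if i = A then t * (s * x $ B) else 0) else 0))"
  proof (rule sum.cong)
    fix j assume "j \<in> {..<?N}"
    then have "shear n a b s t $$ (i, j) =
        (if i = j then 1 else 0) + t * ((if i = b \<and> j = a then 1 else 0) + (if i = A \<and> j = B then s else 0))"
      using i by (simp add: shear_def A_def B_def)
    then show "shear n a b s t $$ (i, j) * x $ j =
        (if j = i then x $ i else 0) + (if j = a then (if i = b then t * x $ a else 0) else 0)
        + (if j = B then (if i = A then t * (s * x $ B) else 0) else 0)"
      by (simp only:) (cases "i = j"; cases "j = a"; cases "j = B"; cases "i = b"; cases "i = A"; simp add: distrib_left distrib_right mult.assoc)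
  qed simp
  also have "\<dots> = x $ i + (if i = b then t * x $ a else 0) + (if i = A then t * (s * x $ B) else 0)"
    unfolding sum.distrib using i ab B by simp
  finally show "(shear n a b s t *\<^sub>v x) $ i = vec ?N (\<lambda>i. x $ i + t * ((if i = b then x $ a else 0) +
     (if i = 2 * n + 1 - a then s * x $ (2 * n + 1 - b) else 0))) $ i"
    using i unfolding A_def[symmetric] B_def[symmetric] by (simp add: distrib_left)
qed (simp add: shear_def)

text \<open>A nonzero coordinate at r i now also appears at the larger position i, so r i is no
  longer a lead and i becomes one. The images of unit vectors realise all the positions
  claimed.\<close>

lemma leads_substitution:
  assumes T: "T \<subseteq> {..<N}" and D: "D \<subseteq> {..<N} - T" and r: "inj_on r D" "r ` D \<subseteq> T"
    and lt: "\<And>i. i \<in> D \<Longrightarrow> r i < i" and c: "\<And>i. i \<in> D \<Longrightarrow> c i \<noteq> 0"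
    and h: "\<And>x i. x \<in> coord_space N T \<Longrightarrow> i < N \<Longrightarrow>
      h x $ i = (if i \<in> D then c i * x $ r i else x $ i)"
    and dim: "\<And>x. dim_vec (h x) = N"
  shows "leads (h ` coord_space N T) = D \<union> (T - r ` D)"
proof
  show "leads (h ` coord_space N T) \<subseteq> D \<union> (T - r ` D)"
  proof
    fix p assume "p \<in> leads (h ` coord_space N T)"
    then obtain x where x: "x \<in> coord_space N T" "lead_pos (h x) p" by (auto simp: leads_def)
    have p: "p < N" "h x $ p \<noteq> 0" "\<And>i. p < i \<Longrightarrow> i < N \<Longrightarrow> h x $ i = 0"
      using x(2) dim by (auto simp: lead_pos_def)
    show "p \<in> D \<union> (T - r ` D)"
    proof (cases "p \<in> D")
      case False
      then have xp: "x $ p \<noteq> 0" using p h[OF x(1) p(1)] by simp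
      then have "p \<in> T" using x(1) p(1) by (auto simp: coord_space_def)
      moreover have "p \<noteq> r i" if i: "i \<in> D" for i
      proof
        assume eq: "p = r i"
        then have "h x $ i = 0" using p(3) lt[OF i] D i by auto
        then show False using h[OF x(1), of i] D i c[OF i] xp eq by auto
      qed
      ultimately show ?thesis by auto
    qed simp
  qed
  show "D \<union> (T - r ` D) \<subseteq> leads (h ` coord_space N T)"
  proof
    fix p assume "p \<in> D \<union> (T - r ` D)"
    then obtain q where q: "q \<in> T" "p \<in> D \<and> q = r p \<or> p \<in> T - r ` D \<and> q = p" using r(2) by blast
    let ?x = "unit_vec N q"
    have x: "?x \<in> coord_space N T" using q(1) by (rule unit_vec_coord_space)
    have N: "p < N" "q < N" "q \<le> p" using q T D lt by (auto simp: less_imp_le)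
    have "h ?x $ p \<noteq> 0" using h[OF x N(1)] q N D c by auto
    moreover have "h ?x $ i = 0" if i: "p < i" "i < N" for i
    proof (cases "i \<in> D")
      case True
      then have "r i \<noteq> q" using q(2) r(1) i(1) by (auto dest: inj_onD)
      moreover have "r i < N" using True r(2) T by auto
      ultimately show ?thesis using h[OF x i(2)] True N by simp
    qed (use h[OF x i(2)] N i in simp)
    ultimately have "lead_pos (h ?x) p" using dim N by (simp add: lead_pos_def)
    then show "p \<in> leads (h ` coord_space N T)" using x unfolding leads_def by blast
  qed
qed

text \<open>Moving a to b creates in the form the cross terms of the coordinates at a and at the
  partner of b. If that partner is outside T these are zero, and if it is a itself they cancel.
  Otherwise the partner of b has to move to the partner of a as well, and the sign s is the one for
  which the two sets of cross terms cancel.\<close>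

lemma shear_coord_space:
  assumes T: "admissible n T" "card T = k" and a: "a \<in> T" and b: "a < b" "b \<notin> T" "b \<le> 2 * n"
    and U: "card U = k" and t: "t \<noteq> 0"
    and move: "((2 * n + 1 - b = a \<or> 2 * n + 1 - b \<notin> T) \<and> U = insert b (T - {a}) \<and> s = 0) \<or>
     (1 \<le> a \<and> 2 * n + 1 - b \<in> T - {a} \<and>
      U = insert (2 * n + 1 - a) (insert b (T - {a}) - {2 * n + 1 - b}) \<and>
      s = esign n (2 * n + 1 - b) * esign n a)"
  defines "W \<equiv> (\<lambda>x. shear n a b s t *\<^sub>v x) ` coord_space (dimE n) T"
  shows "W \<in> IG n k" "leads W = U"
proof -
  let ?N = "dimE n" and ?b = "\<lambda>i. 2 * n + 1 - i"
  let ?h = "\<lambda>x. shear n a b s t *\<^sub>v x"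
  let ?p = "\<lambda>z. t * z $ a" and ?q = "\<lambda>z. t * (s * z $ ?b b)"
  let ?eb = "unit_vec ?N b" and ?ea = "unit_vec ?N (?b a)"
  have TN: "T \<subseteq> {..<?N}" and Tb: "\<And>i. i \<in> T \<Longrightarrow> ?b i \<notin> T"
    using T(1) by (auto simp: admissible_def dimE_def less_Suc_eq_le)
  have aN: "a < ?N" "1 \<le> b" "b < ?N" "?b b < ?N" using a TN b by (auto simp: dimE_def)
  have dim: "dim_vec (?h x) = ?N" for x by (simp add: shear_def)
  have cs: "z \<in> carrier_vec ?N" "\<And>i. i < ?N \<Longrightarrow> i \<notin> T \<Longrightarrow> z $ i = 0" if "z \<in> coord_space ?N T" for z
    using that by (auto simp: coord_space_def)
  have app: "?h x $ i = x $ i + t * ((if i = b then x $ a else 0) + (if i = ?b a then s * x $ ?b b else 0))"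
    if "x \<in> coord_space ?N T" "i < ?N" for x i
    using that(2) shear_apply[OF cs(1)[OF that(1)] aN(1,2), of s t] by simp
  have form: "?h z = z + (?p z \<cdot>\<^sub>v ?eb + ?q z \<cdot>\<^sub>v ?ea)" if z: "z \<in> coord_space ?N T" for z
  proof (rule eq_vecI)
    fix i assume "i < dim_vec (z + (?p z \<cdot>\<^sub>v ?eb + ?q z \<cdot>\<^sub>v ?ea))"
    then have i: "i < ?N" by simp
    then show "?h z $ i = (z + (?p z \<cdot>\<^sub>v ?eb + ?q z \<cdot>\<^sub>v ?ea)) $ i"
      unfolding app[OF z i] by (simp add: unit_vec_def distrib_left)
  qed (simp add: shear_def)
  have v: "omega n x ?eb = esign n (?b b) * x $ ?b b" "omega n ?eb x = - esign n (?b b) * x $ ?b b" for x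
    using aN(2) b esign_swap[of b n] unfolding omega_unit_left[OF aN(3)] omega_unit_right[OF aN(3)] by auto
  have expand: "omega n (?h x) (?h y) = t * esign n (?b b) * (y $ a * x $ ?b b - x $ a * y $ ?b b)
      + ?q y * omega n x ?ea + ?q x * omega n ?ea y + ?p x * ?q y * omega n ?eb ?ea + ?q x * ?p y * omega n ?ea ?eb"
    if x: "x \<in> coord_space ?N T" and y: "y \<in> coord_space ?N T" for x y
    unfolding form[OF x] form[OF y] using cs(1)[OF x] cs(1)[OF y] coord_space_isotropic[OF T(1) x y]
    by (simp add: omega_add_left omega_add_right omega_smult_left omega_smult_right v(1)[of x] v(2)[of y]
        algebra_simps)
  have "leads W = U \<and> (\<forall>x\<in>coord_space ?N T. \<forall>y\<in>coord_space ?N T. omega n (?h x) (?h y) = 0)"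
    using move
  proof (rule disjE)
    assume "(?b b = a \<or> ?b b \<notin> T) \<and> U = insert b (T - {a}) \<and> s = 0"
    then have c: "?b b = a \<or> ?b b \<notin> T" and U': "U = insert b (T - {a})" and s: "s = 0" by auto
    have "?h x $ i = (if i \<in> {b} then t * x $ a else x $ i)"
      if x: "x \<in> coord_space ?N T" and i: "i < ?N" for x i
      using app[OF x i] cs(2)[OF x aN(3) b(2)] s by auto
    then have "leads W = {b} \<union> (T - (\<lambda>_. a) ` {b})"
      unfolding W_def by (intro leads_substitution[where c = "\<lambda>_. t"] TN dim) (use a b aN t in auto)
    moreover have "omega n (?h x) (?h y) = 0"
      if x: "x \<in> coord_space ?N T" and y: "y \<in> coord_space ?N T" for x y
      using c cs(2)[OF x aN(4)] cs(2)[OF y aN(4)] s unfolding expand[OF x y] by auto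
    ultimately show ?thesis using U' by auto
  next
    assume "1 \<le> a \<and> ?b b \<in> T - {a} \<and> U = insert (?b a) (insert b (T - {a}) - {?b b}) \<and>
      s = esign n (?b b) * esign n a"
    then have a1: "1 \<le> a" and c: "?b b \<in> T - {a}"
      and U': "U = insert (?b a) (insert b (T - {a}) - {?b b})"
      and s: "s = esign n (?b b) * esign n a" by blast+
    have a': "?b a < ?N" "?b a \<notin> T" "?b a \<noteq> b" "?b b < ?b a" "?b b \<noteq> b"
    proof -
      show "?b a < ?N" using a1 by (simp add: dimE_def)
      show "?b a \<notin> T" by (rule Tb[OF a])
      show "?b a \<noteq> b"
      proof
        assume "?b a = b"
        then have "?b b = a" using b by simp
        then show False using c by simp
      qed
      show "?b b < ?b a" using b by simp
      show "?b b \<noteq> b" using c b(2) by (metis Diff_iff)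
    qed
    have s0: "s \<noteq> 0" using s by (simp add: esign_def)
    define a' b' where "a' = ?b a" and "b' = ?b b"
    note ab = a'[folded a'_def b'_def] c[folded b'_def] aN(4)[folded b'_def]
    have "?h x $ i = (if i \<in> {b, a'} then (if i = b then t else t * s) * x $ (if i = b then a else b') else x $ i)"
      if x: "x \<in> coord_space ?N T" and i: "i < ?N" for x i
      using app[OF x i] cs(2)[OF x aN(3) b(2)] cs(2)[OF x ab(1,2)] ab(3)
      unfolding a'_def[symmetric] b'_def[symmetric] by auto
    then have "leads W = {b, a'} \<union> (T - (\<lambda>i. if i = b then a else b') ` {b, a'})"
      unfolding W_def
      by (intro leads_substitution[where c = "\<lambda>i. if i = b then t else t * s"] TN dim)
        (use a b aN t s0 ab in \<open>auto simp: inj_on_def\<close>)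
    also have "\<dots> = U" unfolding U'[folded a'_def b'_def] using ab b by auto
    finally have "leads W = U" .
    moreover have "omega n (?h x) (?h y) = 0"
      if x: "x \<in> coord_space ?N T" and y: "y \<in> coord_space ?N T" for x y
    proof -
      have "b + ?b a \<noteq> 2 * n + 1" "?b a + b \<noteq> 2 * n + 1" using b by arith+
      then have ab0: "omega n ?eb ?ea = 0" "omega n ?ea ?eb = 0"
        unfolding omega_unit_unit[OF aN(3) a'(1)] omega_unit_unit[OF a'(1) aN(3)] by (simp_all only: if_False)
      have bb: "?b (?b a) = a" using aN by (simp add: dimE_def)
      have "1 \<le> ?b a" "a \<in> {1..2 * n}" using a1 b by auto
      then have va: "omega n x ?ea = esign n a * x $ a" "omega n ?ea y = - esign n a * y $ a"
        unfolding omega_unit_left[OF a'(1)] omega_unit_right[OF a'(1)] bb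
        by (simp_all only: if_True esign_swap)
      have ss: "s * esign n a = esign n (?b b)" unfolding s by (simp add: mult.assoc)
      have "omega n (?h x) (?h y) = t * esign n (?b b) * (y $ a * x $ ?b b - x $ a * y $ ?b b)
          + t * (s * esign n a) * (y $ ?b b * x $ a - x $ ?b b * y $ a)"
        unfolding expand[OF x y] va ab0 by (simp add: algebra_simps)
      also have "\<dots> = 0" unfolding ss by (simp add: algebra_simps)
      finally show ?thesis .
    qed
    ultimately show ?thesis by blast
  qed
  then show "leads W = U" "W \<in> IG n k"
    using lin_subspace_image[OF shear_carrier coord_space_subspace, of n a b s t T] U
    by (auto simp: IG_iff W_def)
qed

section \<open>Schubert varieties as rank conditions\<close>

lemma hom_poly_continuous:
  assumes "hom_poly m F" "\<And>v. continuous_on UNIV (\<lambda>t. x t v)"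
  shows "continuous_on UNIV (\<lambda>t :: complex. F (x t))"
  using assms by (induction rule: hom_poly.induct) (auto intro!: continuous_intros)

lemma continuous_on_zero_extend:
  fixes h :: "complex \<Rightarrow> complex"
  assumes "continuous_on UNIV h" "\<And>t. t \<noteq> 0 \<Longrightarrow> h t = 0"
  shows "h 0 = 0"
proof -
  have "isCont h 0" using assms(1) by (simp add: continuous_on_eq_continuous_at)
  then have "h \<midarrow>0\<rightarrow> h 0" by (simp add: isCont_def)
  moreover have "h \<midarrow>0\<rightarrow> 0"
    using LIM_equal[of 0 h "\<lambda>_. 0" 0] assms(2) by auto
  ultimately show ?thesis by (rule LIM_unique)
qed

lemma pluecker_continuous:
  assumes A: "\<And>t. A t \<in> carrier_mat (dimE n) k"
    and cont: "\<And>i j. i < dimE n \<Longrightarrow> j < k \<Longrightarrow> continuous_on UNIV (\<lambda>t :: complex. A t $$ (i, j))"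
  shows "continuous_on UNIV (\<lambda>t. pluecker n k (A t) I)"
proof (cases "I \<subseteq> {..<dimE n} \<and> card I = k")
  case True
  have pN: "pick I i < dimE n" if "i < k" for i using pick_in_set_le[of i I] True that by auto
  have "continuous_on UNIV (\<lambda>t. \<Sum>p | p permutes {0..<k}. signof p * (\<Prod>i = 0..<k. A t $$ (pick I i, p i)))"
  proof (intro continuous_intros)
    fix p i assume "p \<in> {p. p permutes {0..<k}}" "i \<in> {0..<k}"
    then show "continuous_on UNIV (\<lambda>t. A t $$ (pick I i, p i))"
      using permutes_in_image[of p "{0..<k}" i] pN by (intro cont) auto
  qed
  moreover have "pluecker n k (A t) I =
      (\<Sum>p | p permutes {0..<k}. signof p * (\<Prod>i = 0..<k. A t $$ (pick I i, p i)))" for t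
  proof -
    have "(\<Prod>i = 0..<k. rowsel k (A t) (pick I) $$ (i, p i)) = (\<Prod>i = 0..<k. A t $$ (pick I i, p i))"
      if "p permutes {0..<k}" for p
      by (rule prod.cong) (use permutes_in_image[OF that] in auto)
    then have "det (rowsel k (A t) (pick I)) =
        (\<Sum>p | p permutes {0..<k}. signof p * (\<Prod>i = 0..<k. A t $$ (pick I i, p i)))"
      unfolding det_def'[OF rowsel_carrier] by (intro sum.cong) auto
    then show ?thesis using pluecker_rowsel[OF A, of I] True by simp
  qed
  ultimately show ?thesis by simp
next
  case False
  then have "pluecker n k (A t) I = 0" for t unfolding pluecker_def by (rule if_not_P)
  then show ?thesis by simp
qed

lemma mult_mat_index:
  assumes "A \<in> carrier_mat N m" "B \<in> carrier_mat m k" "i < N" "j < k"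
  shows "(A * B) $$ (i, j) = (\<Sum>l<m. A $$ (i, l) * B $$ (l, j))"
  using assms by (auto simp: scalar_prod_def atLeast0LessThan intro!: sum.cong)

lemma borel_inverse:
  assumes "g \<in> borel n"
  obtains h where "h \<in> carrier_mat (dimE n) (dimE n)" "h * g = 1\<^sub>m (dimE n)" "g * h = 1\<^sub>m (dimE n)"
proof -
  have c: "g \<in> carrier_mat (dimE n) (dimE n)" and inv: "invertible_mat g"
    using assms by (auto simp: borel_def Sp_odd_def)
  obtain h where h: "g * h = 1\<^sub>m (dimE n)" "h * g = 1\<^sub>m (dim_row h)"
    using inv c by (auto simp: invertible_mat_def inverts_mat_def)
  have "dim_col (g * h) = dimE n" "dim_col (h * g) = dim_row h" unfolding h by auto
  then have "h \<in> carrier_mat (dimE n) (dimE n)" using c by auto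
  then show thesis using that h by auto
qed

text \<open>Induction on the distance of the sum of leading positions from its bound. If
  \<open>leads V\<close> differs from S, \<open>raising_move\<close> gives a type U with larger sum,
  and a shear conjugated by g moves V to subspaces of type U for all t other than 0. These lie in
  the closure by induction. A form that vanishes on Y vanishes on them, and by continuity also at t
  = 0, where the subspace is V.\<close>

lemma zariski_closure_orbit:
  assumes S: "admissible n S" "card S = k"
  defines "Y \<equiv> {(\<lambda>x. g *\<^sub>v x) ` coord_space (dimE n) S | g. g \<in> borel n}"
  shows "V \<in> IG n k \<Longrightarrow> dominated (leads V) S \<Longrightarrow> V \<in> zariski_closure n k Y"
proof (induction "k * (2 * n) - \<Sum>(leads V)" arbitrary: V rule: less_induct)
  case less
  let ?N = "dimE n"
  define T where "T = leads V"
  have V: "lin_subspace ?N V" "card T = k" and iso: "\<And>x y. x \<in> V \<Longrightarrow> y \<in> V \<Longrightarrow> omega n x y = 0"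
    using less.prems by (auto simp: IG_iff T_def)
  have T: "admissible n T" unfolding T_def by (rule isotropic_leads_admissible[OF V(1) iso])
  obtain g where g: "g \<in> borel n" "V = (\<lambda>x. g *\<^sub>v x) ` coord_space ?N T"
    using bruhat_cell[OF V(1) iso] unfolding T_def by blast
  show ?case
  proof (cases "S = T")
    case True
    then have "V \<in> Y" using g by (auto simp: Y_def)
    then show ?thesis using less.prems by (auto simp: zariski_closure_def)
  next
    case False
    obtain a b U where U: "a \<in> T" "a < b" "b \<notin> T" "b \<le> 2 * n" "dominated U S" "admissible n U"
      "card U = card T" "\<Sum>T < \<Sum>U"
      "((2 * n + 1 - b = a \<or> 2 * n + 1 - b \<notin> T) \<and> U = insert b (T - {a})) \<or>
       (1 \<le> a \<and> 2 * n + 1 - b \<in> T - {a} \<and>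
        U = insert (2 * n + 1 - a) (insert b (T - {a}) - {2 * n + 1 - b}))"
      using raising_move[OF S(1) T _ _ False] less.prems S V by (auto simp: T_def)
    obtain s where s: "((2 * n + 1 - b = a \<or> 2 * n + 1 - b \<notin> T) \<and> U = insert b (T - {a}) \<and> s = 0) \<or>
       (1 \<le> a \<and> 2 * n + 1 - b \<in> T - {a} \<and>
        U = insert (2 * n + 1 - a) (insert b (T - {a}) - {2 * n + 1 - b}) \<and>
        s = esign n (2 * n + 1 - b) * esign n a)"
      using U(9) by blast
    obtain h where h: "h \<in> carrier_mat ?N ?N" "h * g = 1\<^sub>m ?N" "g * h = 1\<^sub>m ?N"
      using borel_inverse[OF g(1)] by blast
    have gc: "g \<in> carrier_mat ?N ?N" using borelD(1)[OF g(1)] .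
    define G where "G t = g * (shear n a b s t * h)" for t
    have Gc: "G t \<in> carrier_mat ?N ?N" for t unfolding G_def
      by (intro mult_carrier_mat[OF gc] mult_carrier_mat[OF shear_carrier h(1)])
    define Vt where "Vt t = (\<lambda>x. G t *\<^sub>v x) ` V" for t
    have Vt_eq: "Vt t = (\<lambda>x. g *\<^sub>v x) ` (\<lambda>x. shear n a b s t *\<^sub>v x) ` coord_space ?N T" for t
    proof -
      have "G t *\<^sub>v (g *\<^sub>v x) = g *\<^sub>v (shear n a b s t *\<^sub>v x)" if "x \<in> coord_space ?N T" for x
      proof -
        have x: "x \<in> carrier_vec ?N" using that by (simp add: coord_space_def)
        have sh: "shear n a b s t * h \<in> carrier_mat ?N ?N"
          by (rule mult_carrier_mat[OF shear_carrier h(1)])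
        have "G t *\<^sub>v (g *\<^sub>v x) = g *\<^sub>v ((shear n a b s t * h) *\<^sub>v (g *\<^sub>v x))"
          unfolding G_def using gc x by (intro assoc_mult_mat_vec[OF gc sh]) auto
        also have "(shear n a b s t * h) *\<^sub>v (g *\<^sub>v x) = shear n a b s t *\<^sub>v (h *\<^sub>v (g *\<^sub>v x))"
          using gc x by (intro assoc_mult_mat_vec[OF shear_carrier h(1)]) auto
        also have "h *\<^sub>v (g *\<^sub>v x) = (h * g) *\<^sub>v x"
          by (rule assoc_mult_mat_vec[OF h(1) gc x, symmetric])
        finally show ?thesis using x by (simp add: h(2))
      qed
      then show ?thesis unfolding Vt_def g(2) image_image by (rule image_cong[OF refl])
    qed
    have Vt: "Vt t \<in> zariski_closure n k Y" if "t \<noteq> 0" for t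
    proof -
      let ?W = "(\<lambda>x. shear n a b s t *\<^sub>v x) ` coord_space ?N T"
      have W: "?W \<in> IG n k" "leads ?W = U"
        using shear_coord_space[OF T V(2) U(1-4) _ that s] U(7) V(2) by auto
      have Wc: "?W \<subseteq> carrier_vec ?N" using W lin_subspaceD(1) by (auto simp: IG_iff)
      have VIG: "Vt t \<in> IG n k" "leads (Vt t) = U"
        using IG_borel[OF g(1) W(1)] leads_borel[OF g(1) Wc] W(2) Vt_eq by auto
      \<comment> \<open>This bound keeps the subtraction of naturals from truncating, so the measure
        really decreases.\<close>
      have "\<Sum>U \<le> card U * (2 * n)"
        using sum_bounded_above[of U "\<lambda>x. x" "2 * n"] U(6) by (auto simp: admissible_def)
      then have "k * (2 * n) - \<Sum>(leads (Vt t)) < k * (2 * n) - \<Sum>(leads V)"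
        using U(7,8) V(2) unfolding VIG(2) T_def[symmetric] by auto
      then show ?thesis using less.hyps VIG U(5) by auto
    qed
    show ?thesis
      unfolding zariski_closure_def
    proof (intro CollectI conjI allI impI)
      show "V \<in> IG n k" by fact
      fix m F assume F: "hom_poly m F" and van: "\<forall>U\<in>Y. vanishes_at n k F U"
      show "vanishes_at n k F V"
        unfolding vanishes_at_def
      proof (intro allI impI)
        fix A assume A: "frame n k V A"
        then have Ac: "A \<in> carrier_mat ?N k" and VA: "V = (\<lambda>x. A *\<^sub>v x) ` carrier_vec k"
          by (auto simp: frame_iff)
        define B where "B = h * A"
        have Bc: "B \<in> carrier_mat ?N k" using h Ac by (auto simp: B_def)
        \<comment> \<open>Moving the given frame along yields a frame of \<open>Vt t\<close> whose
          entries are affine in t and which is A at t = 0.\<close>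
        define At where "At t = g * (shear n a b s t * B)" for t
        have Atc: "At t \<in> carrier_mat ?N k" for t
          using gc Bc by (auto simp: At_def intro!: mult_carrier_mat[of _ _ ?N] mult_carrier_mat[OF shear_carrier])
        have At_G: "At t = G t * A" for t
          unfolding At_def G_def B_def
            assoc_mult_mat[OF gc mult_carrier_mat[OF shear_carrier h(1)] Ac]
            assoc_mult_mat[OF shear_carrier h(1) Ac] ..
        have "frame n k (Vt t) (At t)" for t
        proof -
          have "At t *\<^sub>v x = G t *\<^sub>v (A *\<^sub>v x)" if "x \<in> carrier_vec k" for x
            unfolding At_G by (rule assoc_mult_mat_vec[OF Gc Ac that])
          then have "Vt t = (\<lambda>x. At t *\<^sub>v x) ` carrier_vec k"
            unfolding Vt_def VA image_image by (intro image_cong) auto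
          then show ?thesis using Atc by (simp add: frame_iff)
        qed
        then have zero: "F (pluecker n k (At t)) = 0" if "t \<noteq> 0" for t
          using Vt[OF that] F van unfolding zariski_closure_def vanishes_at_def by blast
        have "continuous_on UNIV (\<lambda>t. At t $$ (i, j))" if ij: "i < ?N" "j < k" for i j
        proof -
          have entry: "At t $$ (i, j) =
              (\<Sum>l<?N. g $$ (i, l) * (\<Sum>q<?N. shear n a b s t $$ (l, q) * B $$ (q, j)))" for t
          proof -
            have "(shear n a b s t * B) $$ (l, j) = (\<Sum>q<?N. shear n a b s t $$ (l, q) * B $$ (q, j))"
              if "l < ?N" for l
              by (rule mult_mat_index[OF shear_carrier Bc that ij(2)])
            moreover have "At t $$ (i, j) = (\<Sum>l<?N. g $$ (i, l) * (shear n a b s t * B) $$ (l, j))"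
              unfolding At_def by (rule mult_mat_index[OF gc mult_carrier_mat[OF shear_carrier Bc] ij])
            ultimately show ?thesis by simp
          qed
          have "continuous_on UNIV (\<lambda>t. shear n a b s t $$ (l, q))" if lq: "l < ?N" "q < ?N" for l q
          proof -
            have "shear n a b s t $$ (l, q) = (if l = q then 1 else 0) +
                t * ((if l = b \<and> q = a then 1 else 0) +
                (if l = 2 * n + 1 - a \<and> q = 2 * n + 1 - b then s else 0))" for t
              unfolding shear_def using lq by (subst index_mat(1)) auto
            then show ?thesis by (simp only:) (intro continuous_intros)
          qed
          then show ?thesis unfolding entry by (intro continuous_intros) auto
        qed
        then have "continuous_on UNIV (\<lambda>t. F (pluecker n k (At t)))"
          by (intro hom_poly_continuous[OF F] pluecker_continuous Atc) auto
        then have "F (pluecker n k (At 0)) = 0"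
          by (rule continuous_on_zero_extend) (rule zero)
        moreover have "At 0 = A"
        proof -
          have "shear n a b s 0 = 1\<^sub>m ?N" by (rule eq_matI) (auto simp: shear_def)
          then have "At 0 = g * B" using Bc by (simp add: At_def)
          also have "\<dots> = (g * h) * A" unfolding B_def by (rule assoc_mult_mat[OF gc h(1) Ac, symmetric])
          finally show ?thesis using Ac by (simp add: h(3))
        qed
        ultimately show "F (pluecker n k A) = 0" by simp
      qed
    qed
  qed
qed

lemma schubert_eq:
  assumes S: "admissible n (index_set k w)" "card (index_set k w) = k"
  shows "schubert n k w = {V \<in> IG n k. dominated (leads V) (index_set k w)}"
proof -
  let ?S = "index_set k w" and ?N = "dimE n"
  have SN: "?S \<subseteq> {..<?N}" using S by (auto simp: admissible_def dimE_def less_Suc_eq_le)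
  have cs: "coord_subspace n k w = coord_space ?N ?S" using SN by (rule coord_subspace_eq)
  define Y where "Y = {(\<lambda>x. g *\<^sub>v x) ` coord_space ?N ?S | g. g \<in> borel n}"
  have "U \<in> IG n k \<and> leads U = ?S" if U: "U \<in> Y" for U
  proof -
    obtain g where g: "g \<in> borel n" "U = (\<lambda>x. g *\<^sub>v x) ` coord_space ?N ?S"
      using U by (auto simp: Y_def)
    have "coord_space ?N ?S \<subseteq> carrier_vec ?N" by (auto simp: coord_space_def)
    then show ?thesis
      using IG_borel[OF g(1) coord_space_IG[OF S]] leads_borel[OF g(1)] leads_coord_space[OF SN] g(2)
      by simp
  qed
  then have "dominated (leads V) ?S" if "V \<in> zariski_closure n k Y" for V
    using dominated_zariski_closure that by blast
  moreover have "schubert n k w = zariski_closure n k Y"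
    unfolding schubert_def cs Y_def ..
  ultimately show ?thesis
    using zariski_closure_orbit[OF S] by (auto simp: zariski_closure_def Y_def)
qed

section \<open>Degrees and leading positions\<close>

text \<open>A repeated row gives 0, and otherwise sorting the rows costs a sign. The factor depends
  on r alone, so along a curve every such minor is a constant times a Pluecker coordinate.\<close>

lemma det_rowsel_pluecker:
  assumes r: "\<And>i. i < k \<Longrightarrow> r i < dimE n"
  shows "\<exists>s. \<forall>A\<in>carrier_mat (dimE n) k. det (rowsel k A r) = s * pluecker n k A (r ` {..<k})"
proof (cases "inj_on r {..<k}")
  case False
  then obtain i j where ij: "i < k" "j < k" "i \<noteq> j" "r i = r j" by (auto simp: inj_on_def)
  have "det (rowsel k A r) = 0" for A :: "complex mat"
    by (rule det_identical_rows[OF rowsel_carrier ij(3,1,2)]) (use ij in \<open>auto intro!: eq_vecI simp: rowsel_def\<close>)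
  then show ?thesis by (intro exI[of _ 0]) auto
next
  case True
  define I where "I = r ` {..<k}"
  have I: "I \<subseteq> {..<dimE n}" "card I = k" "finite I"
    using True r by (auto simp: I_def card_image)
  have bij: "bij_betw (pick I) {..<k} I" using bij_betw_pick[OF I(3)] I(2) by simp
  define p where "p i = (if i < k then the_inv_into {..<k} (pick I) (r i) else i)" for i
  have rI: "r i \<in> pick I ` {..<k}" if "i < k" for i
    using bij that by (auto simp: bij_betw_def I_def)
  have inj: "inj_on (pick I) {..<k}" using bij by (simp add: bij_betw_def)
  have pp: "pick I (p i) = r i" "p i < k" if "i < k" for i
    using f_the_inv_into_f[OF inj rI[OF that]] the_inv_into_into[OF inj rI[OF that], of "{..<k}"] that
    by (auto simp: p_def)
  have "p permutes {0..<k}"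
  proof (rule bij_imp_permutes)
    have "inj_on p {0..<k}"
    proof (rule inj_onI)
      fix x y assume "x \<in> {0..<k}" "y \<in> {0..<k}" "p x = p y"
      then have "r x = r y" using pp(1)[of x] pp(1)[of y] by auto
      then show "x = y" using True \<open>x \<in> _\<close> \<open>y \<in> _\<close> by (auto simp: inj_on_def)
    qed
    moreover have "p ` {0..<k} \<subseteq> {0..<k}" using pp(2) by auto
    ultimately show "bij_betw p {0..<k} {0..<k}"
      by (simp add: bij_betw_def endo_inj_surj)
  qed (simp add: p_def)
  then have "det (mat k k (\<lambda>(i, j). rowsel k A (pick I) $$ (p i, j))) = signof p * det (rowsel k A (pick I))"
    for A :: "complex mat"
    by (intro det_permute_rows[OF rowsel_carrier]) auto
  moreover have "mat k k (\<lambda>(i, j). rowsel k A (pick I) $$ (p i, j)) = rowsel k A r" for A :: "complex mat"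
    by (rule eq_matI) (use pp in \<open>auto simp: rowsel_def\<close>)
  ultimately have "det (rowsel k A r) = signof p * pluecker n k A I" if "A \<in> carrier_mat (dimE n) k" for A
    using pluecker_rowsel[OF that I(1,2)] by simp
  then show ?thesis unfolding I_def by blast
qed

lemma det_replaced_row:
  assumes a: "a < k"
  shows "det (rowsel k A (s(a := x))) = (\<Sum>b<k. A $$ (x, b) * cofactor (rowsel k A s) a b)"
proof -
  let ?B = "rowsel k A (s(a := x))"
  have "det ?B = (\<Sum>b<k. ?B $$ (a, b) * cofactor ?B a b)"
    by (rule laplace_expansion_row[OF rowsel_carrier a])
  also have "\<dots> = (\<Sum>b<k. A $$ (x, b) * cofactor (rowsel k A s) a b)"
  proof (rule sum.cong)
    fix b assume b: "b \<in> {..<k}"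
    have "mat_delete ?B a b = mat_delete (rowsel k A s) a b"
      using a b by (intro eq_matI) (auto simp: mat_delete_def rowsel_def)
    then show "?B $$ (a, b) * cofactor ?B a b = A $$ (x, b) * cofactor (rowsel k A s) a b"
      using a b by (simp add: cofactor_def)
  qed simp
  finally show ?thesis .
qed

text \<open>Cramer's rule: by row expansion the matrix of these determinants is R times the adjugate
  of S, where R and S are the submatrices for r and s. It expresses any minor through minors that
  differ from the one at s in a single row.\<close>

lemma det_replaced_rows:
  fixes A :: "'a :: idom mat"
  shows "det (mat k k (\<lambda>(i, a). det (rowsel k A (s(a := r i))))) * det (rowsel k A s) =
    det (rowsel k A s) ^ k * det (rowsel k A r)"
proof -
  let ?S = "rowsel k A s" and ?R = "rowsel k A r"
  let ?M = "mat k k (\<lambda>(i, a). det (rowsel k A (s(a := r i))))"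
  have adj: "adj_mat ?S \<in> carrier_mat k k" "adj_mat ?S * ?S = det ?S \<cdot>\<^sub>m 1\<^sub>m k"
    using adj_mat[OF rowsel_carrier[of k A s]] by auto
  have "?M = ?R * adj_mat ?S"
  proof (rule eq_matI)
    fix i a assume "i < dim_row (?R * adj_mat ?S)" "a < dim_col (?R * adj_mat ?S)"
    then have ia: "i < k" "a < k" using adj(1) by (auto simp: rowsel_def)
    have "(?R * adj_mat ?S) $$ (i, a) = (\<Sum>b<k. ?R $$ (i, b) * adj_mat ?S $$ (b, a))"
      by (rule mult_mat_index[OF rowsel_carrier adj(1) ia])
    also have "\<dots> = (\<Sum>b<k. A $$ (r i, b) * cofactor ?S a b)"
      using ia by (intro sum.cong) (auto simp: adj_mat_def rowsel_def)
    finally show "?M $$ (i, a) = (?R * adj_mat ?S) $$ (i, a)"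
      using ia by (simp add: det_replaced_row)
  qed (use adj in \<open>auto simp: rowsel_def\<close>)
  then have "?M * ?S = ?R * (adj_mat ?S * ?S)"
    using assoc_mult_mat[OF rowsel_carrier adj(1) rowsel_carrier, of A r A s] by simp
  also have "\<dots> = det ?S \<cdot>\<^sub>m ?R"
    unfolding adj(2) using mult_smult_distrib[OF rowsel_carrier[of k A r] one_carrier_mat[of k], of "det ?S"]
      right_mult_one_mat[OF rowsel_carrier[of k A r]] by simp
  finally have "det (?M * ?S) = det ?S ^ k * det ?R" by (simp add: rowsel_def)
  moreover have "det (?M * ?S) = det ?M * det ?S" by (rule det_mult[OF _ rowsel_carrier]) simp
  ultimately show ?thesis by simp
qed

lemma poly_det:
  assumes "M \<in> carrier_mat k k"
  shows "poly (det M) t = det (map_mat (\<lambda>p. poly p t) M)"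
proof -
  have "map_mat (\<lambda>p. poly p t) M \<in> carrier_mat k k" using assms by simp
  then have "det (map_mat (\<lambda>p. poly p t) M) =
      (\<Sum>p | p permutes {0..<k}. signof p * (\<Prod>i = 0..<k. map_mat (\<lambda>p. poly p t) M $$ (i, p i)))"
    by (rule det_def')
  also have "\<dots> = (\<Sum>p | p permutes {0..<k}. signof p * (\<Prod>i = 0..<k. poly (M $$ (i, p i)) t))"
  proof (rule sum.cong)
    fix p assume "p \<in> {p. p permutes {0..<k}}"
    then have "p i < k" if "i < k" for i using that permutes_in_image[of p "{0..<k}" i] by auto
    then show "signof p * (\<Prod>i = 0..<k. map_mat (\<lambda>p. poly p t) M $$ (i, p i)) =
        signof p * (\<Prod>i = 0..<k. poly (M $$ (i, p i)) t)"
      using assms by (intro arg_cong2[of _ _ _ _ "(*)"] prod.cong) auto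
  qed simp
  finally show ?thesis by (simp add: det_def'[OF assms] poly_sum poly_prod)
qed

text \<open>Normalise the frames so that the rows at the leading positions \<open>S\<close> of \<open>f p\<close> form the
  identity. At \<open>p\<close>, the \<open>cnt S j\<close> columns with leading position below \<open>j\<close> vanish in the rows from
  \<open>j\<close> on, so the Pluecker coordinate at the leading positions \<open>T\<close> of \<open>f q\<close> vanishes to order at
  least \<open>cnt S j - cnt T j\<close> at \<open>p\<close>. It is a form of degree \<open>m\<close> which is nonzero at \<open>q\<close>.\<close>
lemma P1_morphism_cnt_le:
  assumes f: "P1_morphism n k m f" and p: "p \<in> P1_coords" and q: "q \<in> P1_coords"
    and pq: "\<not> P1_eq p q"
  shows "cnt (leads (f p)) j \<le> cnt (leads (f q)) j + m"
proof -
  obtain c where "\<forall>p\<in>P1_coords. \<exists>A. frame n k (f p) A \<and>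
      (\<forall>I. I \<subseteq> {..<dimE n} \<and> card I = k \<longrightarrow> pluecker n k A I = binary_form m (c I) p)"
    using f unfolding P1_morphism_def by blast
  then obtain A where A: "\<And>x. x \<in> P1_coords \<Longrightarrow> frame n k (f x) (A x)"
    and Ap: "\<And>x I. x \<in> P1_coords \<Longrightarrow> I \<subseteq> {..<dimE n} \<Longrightarrow> card I = k \<Longrightarrow>
      pluecker n k (A x) I = binary_form m (c I) x"
    by metis
  \<comment> \<open>The affine line from p at t = 0 to q at t = 1. It misses the origin because p
    and q are not proportional.\<close>
  define x where "x t = ((1 - t) * fst p + t * fst q, (1 - t) * snd p + t * snd q)" for t :: complex
  have x01: "x 0 = p" "x 1 = q" by (auto simp: x_def)
  have xP: "x t \<in> P1_coords" for t
  proof (rule ccontr)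
    assume "x t \<notin> P1_coords"
    then have z: "(1 - t) * fst p + t * fst q = 0" "(1 - t) * snd p + t * snd q = 0"
      by (auto simp: x_def P1_coords_def)
    have "(1 - t) * (fst p * snd q - fst q * snd p) =
        ((1 - t) * fst p + t * fst q) * snd q - ((1 - t) * snd p + t * snd q) * fst q"
      by (simp add: algebra_simps)
    then have "t = 1" using pq z by (auto simp: P1_eq_def)
    then show False using z q by (cases q) (auto simp: P1_coords_def)
  qed
  \<comment> \<open>The form of degree m restricted to this line, a polynomial in t of degree at
    most m.\<close>
  define P where "P I = (\<Sum>i\<le>m. Polynomial.smult (c I i) ([:fst p, fst q - fst p:] ^ i * [:snd p, snd q - snd p:] ^ (m - i)))"
    for I
  have P: "poly (P I) t = binary_form m (c I) (x t)" for I t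
    by (simp add: P_def binary_form_def x_def poly_sum algebra_simps)
  have degP: "degree (P I) \<le> m" for I
    unfolding P_def
  proof (rule degree_sum_le)
    fix i assume i: "i \<in> {..m}"
    have "degree ([:fst p, fst q - fst p:] ^ i) \<le> i" "degree ([:snd p, snd q - snd p:] ^ (m - i)) \<le> m - i"
      using degree_power_le[of "[:fst p, fst q - fst p:]" i]
        degree_power_le[of "[:snd p, snd q - snd p:]" "m - i"]
      by (auto intro: order_trans split: if_splits)
    then have "degree ([:fst p, fst q - fst p:] ^ i * [:snd p, snd q - snd p:] ^ (m - i)) \<le> m"
      using degree_mult_le[of "[:fst p, fst q - fst p:] ^ i" "[:snd p, snd q - snd p:] ^ (m - i)"] i by simp
    then show "degree (Polynomial.smult (c I i) ([:fst p, fst q - fst p:] ^ i * [:snd p, snd q - snd p:] ^ (m - i))) \<le> m"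
      using degree_smult_le order_trans by blast
  qed simp
  have frac: "frame n k (f (x t)) (A (x t))" "A (x t) \<in> carrier_mat (dimE n) k" for t
    using A[OF xP, of t] by (auto simp: frame_iff)
  have IG: "f (x t) \<in> IG n k" for t using f xP by (simp add: P1_morphism_def)
  define S where "S = leads (f p)"
  define T where "T = leads (f q)"
  have Vp: "lin_subspace (dimE n) (f p)" "card S = k" and Vq: "lin_subspace (dimE n) (f q)" "card T = k"
    using IG[of 0] IG[of 1] by (auto simp: IG_iff x01 S_def T_def)
  have SN: "S \<subseteq> {..<dimE n}" "finite S" and TN: "T \<subseteq> {..<dimE n}" "finite T"
    using leads_subset finite_leads Vp Vq by (auto simp: S_def T_def)
  have pS: "pick S i \<in> S" "pick S i < dimE n" and pT: "pick T i \<in> T" "pick T i < dimE n" if "i < k" for i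
    using pick_in_set_le[of i S] pick_in_set_le[of i T] that Vp Vq SN TN by auto
  define r where "r i a = (pick S)(a := pick T i)" for i a
  have rN: "r i a b < dimE n" if "i < k" "b < k" for i a b using pS pT that by (auto simp: r_def)
  \<comment> \<open>The frames \<open>A (x t)\<close> are chosen separately for each t; only their
    minors are polynomial in t.\<close>
  have "\<exists>Q. \<forall>t. det (rowsel k (A (x t)) (r i a)) = poly Q t" if ia: "i < k" "a < k" for i a
  proof -
    obtain s where s: "\<And>B. B \<in> carrier_mat (dimE n) k \<Longrightarrow>
        det (rowsel k B (r i a)) = s * pluecker n k B (r i a ` {..<k})"
      using det_rowsel_pluecker[of k "r i a" n] rN[OF ia(1)] by blast
    let ?I = "r i a ` {..<k}"
    have IN: "?I \<subseteq> {..<dimE n}" using rN[OF ia(1)] by auto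
    show ?thesis
    proof (cases "card ?I = k")
      case True
      then have "det (rowsel k (A (x t)) (r i a)) = poly (Polynomial.smult s (P ?I)) t" for t
        using s[OF frac(2)] Ap[OF xP IN True] P by simp
      then show ?thesis by blast
    next
      case False
      then have "det (rowsel k (A (x t)) (r i a)) = poly 0 t" for t
        using s[OF frac(2)] by (simp add: pluecker_def)
      then show ?thesis by blast
    qed
  qed
  then obtain Q where Q: "\<And>i a t. i < k \<Longrightarrow> a < k \<Longrightarrow> det (rowsel k (A (x t)) (r i a)) = poly (Q i a) t"
    by metis
  have PS: "det (rowsel k (A (x t)) (pick S)) = poly (P S) t" for t
    using pluecker_rowsel[OF frac(2) SN(1) Vp(2)] Ap[OF xP SN(1) Vp(2)] P by simp
  have PT: "det (rowsel k (A (x t)) (pick T)) = poly (P T) t" for t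
    using pluecker_rowsel[OF frac(2) TN(1) Vq(2)] Ap[OF xP TN(1) Vq(2)] P by simp
  define M where "M = mat k k (\<lambda>(i, a). Q i a)"
  have Mc: "M \<in> carrier_mat k k" by (simp add: M_def)
  \<comment> \<open>Cramer's rule at each t, kept free of division by the minor at S so that it
    becomes an identity of polynomials.\<close>
  have "poly (det M * P S) t = poly (P S ^ k * P T) t" for t
  proof -
    have "map_mat (\<lambda>p. poly p t) M = mat k k (\<lambda>(i, a). det (rowsel k (A (x t)) ((pick S)(a := pick T i))))"
      by (rule eq_matI) (auto simp: M_def Q[symmetric] r_def)
    then show ?thesis
      using det_replaced_rows[of k "A (x t)" "pick S" "pick T"] poly_det[OF Mc, of t] PS PT by simp
  qed
  then have eq: "det M * P S = P S ^ k * P T" by (intro poly_eq_poly_eq_iff[THEN iffD1] ext)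
  define I where "I = {i \<in> {..<k}. \<not> pick T i < j}"
  define J where "J = {a \<in> {..<k}. pick S a < j}"
  define e where "e = card I + card J - k"
  have ce: "cnt S j \<le> cnt T j + e"
    using card_pick_ge(1)[OF TN(2) Vq(2), of j] card_pick_ge(2)[OF SN(2) Vp(2), of j]
    unfolding e_def I_def J_def by linarith
  obtain g where g: "is_echelon (f p) g" using echelon_exists[OF Vp(1)] by blast
  let ?E = "echelon_frame (dimE n) k (f p) g"
  have "[:0, 1:] ^ e dvd det M"
    unfolding e_def
  proof (rule power_dvd_det_block[OF Mc])
    fix i a assume "i \<in> I" "a \<in> J"
    then have ia: "i < k" "a < k" "pick S a < pick T i" by (auto simp: I_def J_def)
    have ga: "g (pick S a) \<in> f p" "lead_pos (g (pick S a)) (pick S a)"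
      "\<And>y. y \<in> S \<Longrightarrow> g (pick S a) $ y = (if y = pick S a then 1 else 0)"
      using g pS(1)[OF ia(2)] unfolding is_echelon_def S_def by blast+
    \<comment> \<open>All k rows and the single column a form the block. That column is zero: the
      new row lies past the lead of its vector, and the other rows are at other leading positions of
      the echelon basis.\<close>
    have "(0::complex) ^ (card {..<k} + card {a} - k) dvd det (rowsel k ?E (r i a))"
    proof (rule power_dvd_det_block[OF rowsel_carrier])
      fix b a' assume "b \<in> {..<k}" "a' \<in> {a}"
      then have b: "b < k" "a' = a" by auto
      have "g (pick S a) $ r i a b = 0"
      proof (cases "b = a")
        case True
        have "dim_vec (g (pick S a)) = dimE n" using ga(1) lin_subspaceD(2)[OF Vp(1)] by blast
        then show ?thesis using True ga(2) ia pT(2)[OF ia(1)] by (simp add: r_def lead_pos_def)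
      next
        case False
        have "pick S b \<noteq> pick S a"
          using bij_betw_pick[OF SN(2)] Vp(2) b(1) ia(2) False unfolding bij_betw_def inj_on_def by auto
        then show ?thesis using ga(3)[OF pS(1)[OF b(1)]] False by (simp add: r_def)
      qed
      then show "0 dvd rowsel k ?E (r i a) $$ (b, a')"
        using b ia rN[OF ia(1) b(1)] by (simp add: echelon_frame_def S_def)
    qed (use ia in auto)
    then have "det (rowsel k ?E (r i a)) = 0" by simp
    moreover have "rowsel k (A p) (r i a) = rowsel k ?E (r i a) * rowsel k (A p) (pick (leads (f p)))"
      using frame_factor[OF Vp(1) _ g A[OF p], of "r i a"] Vp(2) rN[OF ia(1)] by (simp add: S_def)
    ultimately have "det (rowsel k (A p) (r i a)) = 0" by (simp add: det_mult[OF rowsel_carrier rowsel_carrier])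
    then have "poly (Q i a) 0 = 0" using Q[OF ia(1,2), of 0] x01 by simp
    then show "[:0, 1:] dvd M $$ (i, a)"
      using ia poly_eq_0_iff_dvd[of "Q i a" 0] by (simp add: M_def)
  qed (auto simp: I_def J_def)
  then have dvd: "[:- 0, 1:] ^ e dvd P S ^ k * P T" using eq by (metis dvd_mult2 minus_zero)
  \<comment> \<open>The minor at S is nonzero at p, so the full order e of vanishing falls on the
    minor at T, which is a nonzero polynomial because of its value at q.\<close>
  have S0: "poly (P S) 0 \<noteq> 0"
    using frame_det_leads[OF Vp(1) _ A[OF p]] Vp(2) PS[of 0] x01 by (simp add: S_def)
  have "poly (P T) 1 \<noteq> 0"
    using frame_det_leads[OF Vq(1) _ A[OF q]] Vq(2) PT[of 1] x01 by (simp add: T_def)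
  then have PT0: "P T \<noteq> 0" by auto
  have PS0: "P S ^ k \<noteq> 0" using S0 by auto
  have "P S ^ k * P T \<noteq> 0" using PT0 PS0 by (simp only: mult_eq_0_iff) blast
  then have "e \<le> order 0 (P S ^ k * P T)" using dvd order_divides[of 0 e "P S ^ k * P T"] by blast
  also have "\<dots> = order 0 (P S ^ k) + order 0 (P T)" using PT0 PS0 by (intro order_mult) auto
  also have "order 0 (P S ^ k) = 0" using S0 by (intro order_0I) simp
  also have "order 0 (P T) \<le> m" using order_degree[OF PT0] degP order_trans by blast
  finally have "e \<le> m" by simp
  then show ?thesis using ce by (simp add: S_def T_def)
qed

section \<open>Paths of components in a stable map\<close>

lemma rtrancl_simple_path:
  "(u, v) \<in> r\<^sup>* \<Longrightarrow> \<exists>xs. distinct (u # xs) \<and> last (u # xs) = v \<and> successively (\<lambda>x y. (x, y) \<in> r) (u # xs)"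
proof (induction rule: converse_rtrancl_induct)
  case base
  then show ?case by (intro exI[of _ "[]"]) auto
next
  case (step u w)
  then obtain xs where xs: "distinct (w # xs)" "last (w # xs) = v"
    "successively (\<lambda>x y. (x, y) \<in> r) (w # xs)" by blast
  show ?case
  proof (cases "u \<in> set (w # xs)")
    case False
    then show ?thesis using xs step.hyps(1) by (intro exI[of _ "w # xs"]) auto
  next
    case True
    then obtain ys zs where yz: "w # xs = ys @ u # zs" by (metis split_list)
    then have "distinct (u # zs)" "last (u # zs) = v" "successively (\<lambda>x y. (x, y) \<in> r) (u # zs)"
      using xs by (auto simp: successively_append_iff)
    then show ?thesis by blast
  qed
qed

lemma stable_mapsD:
  assumes "C \<in> stable_maps n k d"
  shows "finite (comps C)" "adj C \<subseteq> comps C \<times> comps C" "sym (adj C)"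
    "\<And>u v. u \<in> comps C \<Longrightarrow> v \<in> comps C \<Longrightarrow> (u, v) \<in> (adj C)\<^sup>*"
    "mark_comp C 1 \<in> comps C" "mark_comp C 2 \<in> comps C"
    "\<And>v a. v \<in> comps C \<Longrightarrow> a \<in> specials C v \<Longrightarrow> special_pt C v a \<in> P1_coords"
    "\<And>v a b. v \<in> comps C \<Longrightarrow> a \<in> specials C v \<Longrightarrow> b \<in> specials C v \<Longrightarrow> a \<noteq> b \<Longrightarrow>
      \<not> P1_eq (special_pt C v a) (special_pt C v b)"
    "\<And>v. v \<in> comps C \<Longrightarrow> P1_morphism n k (cdeg C v) (cmap C v)"
    "\<And>u v. (u, v) \<in> adj C \<Longrightarrow> cmap C u (node C u v) = cmap C v (node C v u)"
    "(\<Sum>v\<in>comps C. cdeg C v) = d"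
  using assms unfolding stable_maps_def tree_of_lines_def by blast+

text \<open>On each component the bound is applied between the special point a where the path enters
  and the one where it leaves. The conditions on a make these two different, hence not proportional;
  the gluing condition passes on to the next component.\<close>

lemma stable_map_path_cnt_le:
  assumes C: "C \<in> stable_maps n k d"
  shows "distinct (v # xs) \<Longrightarrow> successively (\<lambda>x y. (x, y) \<in> adj C) (v # xs) \<Longrightarrow>
    last (v # xs) = mark_comp C 2 \<Longrightarrow> v \<in> comps C \<Longrightarrow> a \<in> specials C v \<Longrightarrow> a \<noteq> Inr 2 \<Longrightarrow>
    (\<forall>u. a = Inl u \<longrightarrow> u \<notin> set xs) \<Longrightarrow>
    cnt (leads (cmap C v (special_pt C v a))) j \<le>
      cnt (leads (eval_mark 2 C)) j + (\<Sum>u\<leftarrow>v # xs. cdeg C u)"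
proof (induction xs arbitrary: v a)
  case Nil
  note CD = stable_mapsD[OF C]
  have b: "Inr 2 \<in> specials C v" using Nil by (auto simp: specials_def)
  have "cnt (leads (cmap C v (special_pt C v a))) j \<le>
      cnt (leads (cmap C v (special_pt C v (Inr 2)))) j + cdeg C v"
    using Nil b CD by (intro P1_morphism_cnt_le[OF CD(9)]) auto
  moreover have "special_pt C v (Inr 2) = mark_pt C 2" by (simp add: special_pt_def)
  ultimately show ?case using Nil by (simp add: eval_mark_def)
next
  case (Cons w xs)
  note CD = stable_mapsD[OF C]
  have vw: "(v, w) \<in> adj C" "(w, v) \<in> adj C" using Cons.prems CD(3) by (auto dest: symD)
  have w: "w \<in> comps C" using vw CD(2) by auto
  have b: "Inl w \<in> specials C v" "Inl v \<in> specials C w" using vw by (auto simp: specials_def)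
  have "cnt (leads (cmap C v (special_pt C v a))) j \<le>
      cnt (leads (cmap C v (special_pt C v (Inl w)))) j + cdeg C v"
  proof (rule P1_morphism_cnt_le[OF CD(9)[OF Cons.prems(4)]])
    have "a \<noteq> Inl w" using Cons.prems(7) by auto
    then show "\<not> P1_eq (special_pt C v a) (special_pt C v (Inl w))"
      by (rule CD(8)[OF Cons.prems(4,5) b(1)])
    show "special_pt C v a \<in> P1_coords" "special_pt C v (Inl w) \<in> P1_coords"
      using CD(7)[OF Cons.prems(4)] Cons.prems(5) b(1) by auto
  qed
  also have "cmap C v (special_pt C v (Inl w)) = cmap C w (special_pt C w (Inl v))"
    using CD(10)[OF vw(1)] by (simp add: special_pt_def)
  also have "cnt (leads (cmap C w (special_pt C w (Inl v)))) j \<le>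
      cnt (leads (eval_mark 2 C)) j + (\<Sum>u\<leftarrow>w # xs. cdeg C u)"
    using Cons.prems w b by (intro Cons.IH) auto
  finally show ?case by simp
qed

text \<open>On a path without repetition every component contributes its degree at most once, so the
  total is at most d.\<close>

lemma stable_map_cnt_le:
  assumes C: "C \<in> stable_maps n k d"
  shows "cnt (leads (eval_mark 1 C)) j \<le> cnt (leads (eval_mark 2 C)) j + d"
proof -
  note CD = stable_mapsD[OF C]
  obtain xs where xs: "distinct (mark_comp C 1 # xs)" "last (mark_comp C 1 # xs) = mark_comp C 2"
    "successively (\<lambda>x y. (x, y) \<in> adj C) (mark_comp C 1 # xs)"
    using rtrancl_simple_path[OF CD(4)[OF CD(5,6)]] by blast
  have sub: "set ys \<subseteq> comps C" if "successively (\<lambda>x y. (x, y) \<in> adj C) (v # ys)" for v ys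
    using that
  proof (induction ys arbitrary: v)
    case (Cons w ys)
    then show ?case using CD(2) by auto
  qed simp
  have "Inr 1 \<in> specials C (mark_comp C 1)" by (auto simp: specials_def)
  then have "cnt (leads (eval_mark 1 C)) j \<le>
      cnt (leads (eval_mark 2 C)) j + (\<Sum>u\<leftarrow>mark_comp C 1 # xs. cdeg C u)"
    using stable_map_path_cnt_le[OF C xs(1,3,2) CD(5), of "Inr 1" j]
    by (simp add: eval_mark_def special_pt_def)
  also have "(\<Sum>u\<leftarrow>mark_comp C 1 # xs. cdeg C u) = (\<Sum>u\<in>set (mark_comp C 1 # xs). cdeg C u)"
    using xs(1) by (rule sum_list_distinct_conv_sum_set)
  also have "\<dots> \<le> (\<Sum>u\<in>comps C. cdeg C u)"
    using sub[OF xs(3)] CD(1,5) by (intro sum_mono2) auto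
  finally show ?thesis using CD(11) by simp
qed

lemma eval_mark_IG:
  assumes C: "C \<in> stable_maps n k d" and i: "i \<in> {1, 2}"
  shows "eval_mark i C \<in> IG n k"
proof -
  note CD = stable_mapsD[OF C]
  have c: "mark_comp C i \<in> comps C" using i CD by auto
  moreover have "Inr i \<in> specials C (mark_comp C i)" using i by (auto simp: specials_def)
  ultimately have "mark_pt C i \<in> P1_coords" using CD(7)[of "mark_comp C i" "Inr i"] by (simp add: special_pt_def)
  then show ?thesis using CD(9)[OF c] by (simp add: P1_morphism_def eval_mark_def)
qed

section \<open>Lines\<close>

definition add_line :: "complex vec set \<Rightarrow> complex vec \<Rightarrow> complex vec set" where
  "add_line W z = {w + c \<cdot>\<^sub>v z | w c. w \<in> W}"

lemma add_line_subspace: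
  assumes W: "lin_subspace N W" and z: "z \<in> carrier_vec N"
  shows "lin_subspace N (add_line W z)" "W \<subseteq> add_line W z" "z \<in> add_line W z"
proof -
  note WD = lin_subspaceD[OF W]
  have sub: "w + 0 \<cdot>\<^sub>v z = w" if "w \<in> W" for w using WD(2)[OF that] z by (intro eq_vecI) auto
  show W_sub: "W \<subseteq> add_line W z"
  proof
    fix w assume w: "w \<in> W"
    then have "w = w + 0 \<cdot>\<^sub>v z" using sub by simp
    then show "w \<in> add_line W z" unfolding add_line_def using w by blast
  qed
  have "z = 0\<^sub>v N + 1 \<cdot>\<^sub>v z" using z by simp
  then show "z \<in> add_line W z" unfolding add_line_def using WD(3) by blast
  show "lin_subspace N (add_line W z)"
    unfolding lin_subspace_def
  proof (intro conjI ballI allI)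
    show "add_line W z \<subseteq> carrier_vec N" using WD(1) z by (auto simp: add_line_def)
    show "0\<^sub>v N \<in> add_line W z" using W_sub WD(3) by blast
  next
    fix x y assume "x \<in> add_line W z" "y \<in> add_line W z"
    then obtain w c w' c' where x: "w \<in> W" "x = w + c \<cdot>\<^sub>v z" and y: "w' \<in> W" "y = w' + c' \<cdot>\<^sub>v z"
      by (auto simp: add_line_def)
    have "x + y = (w + w') + (c + c') \<cdot>\<^sub>v z"
      using x y WD(2)[of w] WD(2)[of w'] z by (intro eq_vecI) (auto simp: algebra_simps)
    then show "x + y \<in> add_line W z" unfolding add_line_def using WD(4)[OF x(1) y(1)] by blast
  next
    fix a x assume "x \<in> add_line W z"
    then obtain w c where x: "w \<in> W" "x = w + c \<cdot>\<^sub>v z" by (auto simp: add_line_def)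
    have "a \<cdot>\<^sub>v x = a \<cdot>\<^sub>v w + (a * c) \<cdot>\<^sub>v z"
      using x WD(2)[of w] z by (intro eq_vecI) (auto simp: algebra_simps)
    then show "a \<cdot>\<^sub>v x \<in> add_line W z" unfolding add_line_def using WD(5)[OF x(1)] by blast
  qed
qed

lemma add_line_least:
  assumes "lin_subspace N V" "W \<subseteq> V" "z \<in> V"
  shows "add_line W z \<subseteq> V"
  using lin_subspaceD(4,5)[OF assms(1)] assms(2,3) unfolding add_line_def by blast

text \<open>Nonzero multiples of z and nonzero vectors of W have different leads, so in a sum the
  larger lead survives.\<close>

lemma leads_add_line:
  assumes W: "lin_subspace N W" and z: "z \<in> carrier_vec N" "lead_pos z i" "i \<notin> leads W"
  shows "leads (add_line W z) = insert i (leads W)"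
proof
  note WD = lin_subspaceD[OF W]
  show "insert i (leads W) \<subseteq> leads (add_line W z)"
    using leads_mono[OF add_line_subspace(2)[OF W z(1)]] add_line_subspace(3)[OF W z(1)] z(2)
    unfolding leads_def by blast
  show "leads (add_line W z) \<subseteq> insert i (leads W)"
  proof
    fix p assume "p \<in> leads (add_line W z)"
    then obtain w c where w: "w \<in> W" "lead_pos (w + c \<cdot>\<^sub>v z) p" by (auto simp: leads_def add_line_def)
    have d: "dim_vec w = N" "dim_vec z = N" using WD(2)[OF w(1)] z(1) by auto
    show "p \<in> insert i (leads W)"
    proof (cases "c = 0 \<or> w = 0\<^sub>v N")
      case True
      then show ?thesis
      proof
        assume "c = 0"
        then have "w + c \<cdot>\<^sub>v z = w" using d by (intro eq_vecI) auto
        then show ?thesis using w by (auto simp: leads_def)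
      next
        assume "w = 0\<^sub>v N"
        then have "lead_pos z p" using w(2) d by (auto simp: lead_pos_def)
        then show ?thesis using lead_pos_unique[OF z(2)] by simp
      qed
    next
      case False
      then obtain q where q: "lead_pos w q" using lead_pos_exists WD(1)[OF w(1)] by blast
      then have "q \<in> leads W" using w(1) by (auto simp: leads_def)
      then have "q \<noteq> i" using z(3) by auto
      have "lead_pos (w + c \<cdot>\<^sub>v z) (max q i)"
        using q z(2) d False \<open>q \<noteq> i\<close> by (cases "q < i") (auto simp: lead_pos_def max_def)
      then have "p = max q i" using lead_pos_unique w(2) by blast
      then show ?thesis using \<open>q \<in> leads W\<close> by (auto simp: max_def)
    qed
  qed
qed

lemma add_line_cong:
  assumes W: "lin_subspace N W" and x: "x \<in> carrier_vec N" and w0: "w0 \<in> W" and c: "c \<noteq> 0"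
  shows "add_line W (w0 + c \<cdot>\<^sub>v x) = add_line W x"
proof
  note WD = lin_subspaceD[OF W]
  have d: "dim_vec w0 = N" "dim_vec x = N" using WD(2)[OF w0] x by auto
  let ?y = "w0 + c \<cdot>\<^sub>v x"
  have y: "?y \<in> carrier_vec N" using WD(1)[OF w0] x by simp
  show "add_line W ?y \<subseteq> add_line W x"
  proof (rule add_line_least[OF add_line_subspace(1,2)[OF W x]])
    show "?y \<in> add_line W x" using w0 unfolding add_line_def by blast
  qed
  show "add_line W x \<subseteq> add_line W ?y"
  proof (rule add_line_least[OF add_line_subspace(1,2)[OF W y]])
    have "x = (- 1 / c) \<cdot>\<^sub>v w0 + (1 / c) \<cdot>\<^sub>v ?y"
      using d c by (intro eq_vecI) (auto simp: field_simps)
    then show "x \<in> add_line W ?y" using WD(5)[OF w0] unfolding add_line_def by blast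
  qed
qed

text \<open>The lead of z may already occur in W. Subtracting the vector of W with the same entries
  at the leads of W changes neither the span nor orthogonality and produces a new lead.\<close>

lemma add_line_IG:
  assumes W: "W \<in> IG n k" and z: "z \<in> carrier_vec (dimE n)" "z \<notin> W"
    and orth: "\<And>w. w \<in> W \<Longrightarrow> omega n w z = 0"
  shows "add_line W z \<in> IG n (Suc k)"
proof -
  let ?N = "dimE n"
  have Ws: "lin_subspace ?N W" "card (leads W) = k" and iso: "\<And>x y. x \<in> W \<Longrightarrow> y \<in> W \<Longrightarrow> omega n x y = 0"
    using W by (auto simp: IG_iff)
  note WD = lin_subspaceD[OF Ws(1)]
  obtain f where f: "is_echelon W f" using echelon_exists[OF Ws(1)] by blast
  have fin: "finite (leads W)" using finite_leads[OF Ws(1)] .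
  define v where "v = combo ?N (\<lambda>a. z $ a) f (leads W)"
  have v: "v \<in> W" unfolding v_def
    by (rule combo_mem[OF Ws(1) fin]) (use f in \<open>auto simp: is_echelon_def\<close>)
  define z' where "z' = (- 1) \<cdot>\<^sub>v v + 1 \<cdot>\<^sub>v z"
  have eq: "add_line W z' = add_line W z"
    unfolding z'_def by (rule add_line_cong[OF Ws(1) z(1) WD(5)[OF v]]) simp
  have z'c: "z' \<in> carrier_vec ?N" using WD(1)[OF v] z(1) by (simp add: z'_def)
  have "z' \<noteq> 0\<^sub>v ?N"
  proof
    assume z0: "z' = 0\<^sub>v ?N"
    have "z = v"
    proof (rule eq_vecI)
      fix i assume "i < dim_vec v"
      then have "z' $ i = 0" "i < ?N" using z0 by (auto simp: v_def)
      then show "z $ i = v $ i" using z(1) WD(2)[OF v] by (simp add: z'_def)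
    qed (use z WD(2)[OF v] in auto)
    then show False using v z(2) by simp
  qed
  then obtain i where i: "lead_pos z' i" using lead_pos_exists[OF z'c] by blast
  have "i \<notin> leads W"
  proof
    assume iW: "i \<in> leads W"
    have iN: "i < ?N" using iW leads_subset[OF Ws(1)] by auto
    have "(\<Sum>a\<in>leads W. z $ a * f a $ i) = (\<Sum>a\<in>leads W. if a = i then z $ a else 0)"
      using f iW by (intro sum.cong) (auto simp: is_echelon_def)
    then have "v $ i = z $ i" using iN iW fin by (simp add: v_def)
    then have "z' $ i = 0" using iN z(1) WD(2)[OF v] by (simp add: z'_def)
    then show False using i by (simp add: lead_pos_def)
  qed
  then have "leads (add_line W z) = insert i (leads W)"
    using leads_add_line[OF Ws(1) z'c i] eq by simp
  then have "card (leads (add_line W z)) = Suc k" using \<open>i \<notin> leads W\<close> fin Ws(2) by simp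
  moreover have "omega n x y = 0" if "x \<in> add_line W z" "y \<in> add_line W z" for x y
  proof -
    obtain w c w' c' where x: "w \<in> W" "x = w + c \<cdot>\<^sub>v z" and y: "w' \<in> W" "y = w' + c' \<cdot>\<^sub>v z"
      using \<open>x \<in> _\<close> \<open>y \<in> _\<close> unfolding add_line_def by blast
    have "omega n z w' = 0" using orth[OF y(1)] omega_antisym[of n z w'] by simp
    then show ?thesis
      unfolding x(2) y(2) using orth[OF x(1)] iso[OF x(1) y(1)] WD(1)[OF x(1)] WD(1)[OF y(1)] z(1)
      by (simp add: omega_add_left omega_add_right omega_smult_left omega_smult_right)
  qed
  ultimately show ?thesis using add_line_subspace(1)[OF Ws(1) z(1)] by (simp add: IG_iff)
qed

text \<open>Two points on the line of all U between W and W + <x, y>. Both x and y are orthogonal to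
  W but possibly not to each other; each U contains only one combination of them modulo W and is
  therefore isotropic.\<close>

definition line_adj :: "nat \<Rightarrow> nat \<Rightarrow> (complex vec set \<times> complex vec set) set" where
  "line_adj n k = {(add_line W x, add_line W y) | W x y. W \<in> IG n (k - 1) \<and>
     x \<in> carrier_vec (dimE n) \<and> y \<in> carrier_vec (dimE n) \<and>
     (\<forall>w\<in>W. omega n w x = 0 \<and> omega n w y = 0) \<and>
     (\<forall>s t. (s, t) \<noteq> (0, 0) \<longrightarrow> s \<cdot>\<^sub>v x + t \<cdot>\<^sub>v y \<notin> W)}"

lemma line_adjI:
  assumes W: "W \<in> IG n (k - 1)" and x: "x \<in> carrier_vec (dimE n)" "x \<notin> W"
    and y: "y \<in> carrier_vec (dimE n)" "y \<notin> W"
    and orth: "\<And>w. w \<in> W \<Longrightarrow> omega n w x = 0" "\<And>w. w \<in> W \<Longrightarrow> omega n w y = 0"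
    and ne: "add_line W x \<noteq> add_line W y"
  shows "(add_line W x, add_line W y) \<in> line_adj n k"
proof -
  have Ws: "lin_subspace (dimE n) W" using W by (simp add: IG_iff)
  note WD = lin_subspaceD[OF Ws]
  have "s \<cdot>\<^sub>v x + t \<cdot>\<^sub>v y \<notin> W" if st: "(s, t) \<noteq> (0, 0)" for s t
  proof
    assume in_W: "s \<cdot>\<^sub>v x + t \<cdot>\<^sub>v y \<in> W"
    have d: "dim_vec x = dimE n" "dim_vec y = dimE n" using x y by auto
    show False
    proof (cases "s = 0")
      case True
      then have "(1 / t) \<cdot>\<^sub>v (s \<cdot>\<^sub>v x + t \<cdot>\<^sub>v y) = y" using st d by (intro eq_vecI) auto
      then show False using WD(5)[OF in_W, of "1 / t"] y(2) by simp
    next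
      case s: False
      have t: "t \<noteq> 0"
      proof
        assume "t = 0"
        then have "(1 / s) \<cdot>\<^sub>v (s \<cdot>\<^sub>v x + t \<cdot>\<^sub>v y) = x" using s d by (intro eq_vecI) auto
        then show False using WD(5)[OF in_W, of "1 / s"] x(2) by simp
      qed
      have "x = (1 / s) \<cdot>\<^sub>v (s \<cdot>\<^sub>v x + t \<cdot>\<^sub>v y) + (- t / s) \<cdot>\<^sub>v y"
        using s d by (intro eq_vecI) (auto simp: field_simps)
      then have "add_line W x = add_line W y"
        using add_line_cong[OF Ws y(1) WD(5)[OF in_W, of "1 / s"], of "- t / s"] s t by simp
      then show False using ne by simp
    qed
  qed
  then show ?thesis unfolding line_adj_def using W x y orth by blast
qed

section \<open>Parametrised lines\<close>

lemma frame_add_line: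
  assumes W: "lin_subspace (dimE n) W" "card (leads W) = k" and f: "is_echelon W f"
    and z: "z \<in> carrier_vec (dimE n)"
  shows "frame n (Suc k) (add_line W z)
    (mat (dimE n) (Suc k) (\<lambda>(i, j). if j < k then echelon_frame (dimE n) k W f $$ (i, j) else z $ i))"
    (is "frame n (Suc k) _ ?A")
proof -
  let ?N = "dimE n" and ?E = "echelon_frame (dimE n) k W f"
  have E: "?E \<in> carrier_mat ?N k" "W = (\<lambda>x. ?E *\<^sub>v x) ` carrier_vec k"
    using echelon_frame_frame[OF W f] by (auto simp: frame_iff)
  have Ac: "?A \<in> carrier_mat ?N (Suc k)" by simp
  have act: "?A *\<^sub>v x = ?E *\<^sub>v vec k (\<lambda>j. x $ j) + x $ k \<cdot>\<^sub>v z" if x: "x \<in> carrier_vec (Suc k)" for x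
  proof (rule eq_vecI)
    fix i assume "i < dim_vec (?E *\<^sub>v vec k (\<lambda>j. x $ j) + x $ k \<cdot>\<^sub>v z)"
    then have i: "i < ?N" using z by simp
    have "(?A *\<^sub>v x) $ i = (\<Sum>j<Suc k. ?A $$ (i, j) * x $ j)"
      by (rule mult_mat_vec_index[OF Ac x i])
    also have "\<dots> = (\<Sum>j<k. ?E $$ (i, j) * x $ j) + z $ i * x $ k" using i by simp
    also have "(\<Sum>j<k. ?E $$ (i, j) * x $ j) = (?E *\<^sub>v vec k (\<lambda>j. x $ j)) $ i"
      by (subst mult_mat_vec_index[OF E(1) _ i]) auto
    finally show "(?A *\<^sub>v x) $ i = (?E *\<^sub>v vec k (\<lambda>j. x $ j) + x $ k \<cdot>\<^sub>v z) $ i"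
      using i z E(1) by simp
  qed (use z in simp)
  have "add_line W z = (\<lambda>x. ?A *\<^sub>v x) ` carrier_vec (Suc k)"
  proof
    show "(\<lambda>x. ?A *\<^sub>v x) ` carrier_vec (Suc k) \<subseteq> add_line W z"
    proof
      fix y assume "y \<in> (\<lambda>x. ?A *\<^sub>v x) ` carrier_vec (Suc k)"
      then obtain x where x: "x \<in> carrier_vec (Suc k)" "y = ?A *\<^sub>v x" by blast
      have "?E *\<^sub>v vec k (\<lambda>j. x $ j) \<in> W" by (subst E(2)) (rule imageI, simp)
      then show "y \<in> add_line W z" unfolding x(2) act[OF x(1)] add_line_def by blast
    qed
    show "add_line W z \<subseteq> (\<lambda>x. ?A *\<^sub>v x) ` carrier_vec (Suc k)"
    proof
      fix y assume "y \<in> add_line W z"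
      then obtain w c where w: "w \<in> W" "y = w + c \<cdot>\<^sub>v z" by (auto simp: add_line_def)
      then have "w \<in> (\<lambda>x. ?E *\<^sub>v x) ` carrier_vec k" using E(2) by blast
      then obtain u where u: "u \<in> carrier_vec k" "w = ?E *\<^sub>v u" by blast
      define x where "x = vec (Suc k) (\<lambda>j. if j < k then u $ j else c)"
      have x: "x \<in> carrier_vec (Suc k)" by (simp add: x_def)
      have "vec k (\<lambda>j. x $ j) = u" "x $ k = c" using u by (auto simp: x_def)
      then have "?A *\<^sub>v x = y" unfolding act[OF x] w(2) u(2) by simp
      then show "y \<in> (\<lambda>x. ?A *\<^sub>v x) ` carrier_vec (Suc k)" using x by blast
    qed
  qed
  then show ?thesis using Ac by (simp add: frame_iff)
qed

text \<open>Expansion along the last column: the cofactors do not involve z, so the coordinates are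
  linear in z.\<close>

lemma pluecker_last_column:
  assumes E: "E \<in> carrier_mat (dimE n) k"
  shows "\<exists>c. \<forall>z. pluecker n (Suc k) (mat (dimE n) (Suc k) (\<lambda>(i, j). if j < k then E $$ (i, j) else z $ i)) I =
    (\<Sum>i<Suc k. c i * z $ pick I i)"
proof (cases "I \<subseteq> {..<dimE n} \<and> card I = Suc k")
  case False
  then have "pluecker n (Suc k) A I = 0" for A unfolding pluecker_def by (rule if_not_P)
  then show ?thesis by (intro exI[of _ "\<lambda>_. 0"]) simp
next
  case True
  let ?A = "\<lambda>z. mat (dimE n) (Suc k) (\<lambda>(i, j). if j < k then E $$ (i, j) else z $ i)"
  let ?R = "\<lambda>z. rowsel (Suc k) (?A z) (pick I)"
  have pN: "pick I i < dimE n" if "i < Suc k" for i using pick_in_set_le[of i I] True that by auto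
  have cof: "cofactor (?R z) i k = cofactor (?R (0\<^sub>v (dimE n))) i k" if i: "i < Suc k" for z i
  proof -
    have "mat_delete (?R z) i k = mat_delete (?R (0\<^sub>v (dimE n))) i k"
      using pN by (intro eq_matI) (auto simp: mat_delete_def rowsel_def)
    then show ?thesis by (simp add: cofactor_def)
  qed
  have "pluecker n (Suc k) (?A z) I =
      (\<Sum>i<Suc k. cofactor (?R (0\<^sub>v (dimE n))) i k * z $ pick I i)" for z
  proof -
    have "pluecker n (Suc k) (?A z) I = det (?R z)" using True by (intro pluecker_rowsel) auto
    also have "\<dots> = (\<Sum>i<Suc k. ?R z $$ (i, k) * cofactor (?R z) i k)"
      by (rule laplace_expansion_column[OF rowsel_carrier]) simp
    also have "\<dots> = (\<Sum>i<Suc k. cofactor (?R (0\<^sub>v (dimE n))) i k * z $ pick I i)"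
    proof (rule sum.cong)
      fix i assume "i \<in> {..<Suc k}"
      then have i: "i < Suc k" by simp
      have "?R z $$ (i, k) = z $ pick I i" using i pN[OF i] by simp
      then show "?R z $$ (i, k) * cofactor (?R z) i k =
          cofactor (?R (0\<^sub>v (dimE n))) i k * z $ pick I i"
        unfolding cof[OF i, of z] by (simp only: mult.commute)
    qed simp
    finally show ?thesis .
  qed
  then show ?thesis by (intro exI[of _ "\<lambda>i. cofactor (?R (0\<^sub>v (dimE n))) i k"]) simp
qed

text \<open>The point (s, t) goes to the span of W and s^m x + t^m y, an m-fold cover of the line.
  By linearity in the last column its Pluecker coordinates are binary forms of degree m.\<close>

lemma line_morphism:
  assumes adj: "(V, V') \<in> line_adj n (Suc k)" and m: "1 \<le> m"
  shows "\<exists>f. P1_morphism n (Suc k) m f \<and> f (1, 0) = V \<and> f (0, 1) = V'"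
proof -
  let ?N = "dimE n"
  obtain W x y where V: "V = add_line W x" "V' = add_line W y" and W: "W \<in> IG n k"
    and xy: "x \<in> carrier_vec ?N" "y \<in> carrier_vec ?N"
    and orth: "\<And>w. w \<in> W \<Longrightarrow> omega n w x = 0 \<and> omega n w y = 0"
    and ind: "\<And>s t. (s, t) \<noteq> (0, 0) \<Longrightarrow> s \<cdot>\<^sub>v x + t \<cdot>\<^sub>v y \<notin> W"
    using adj unfolding line_adj_def by auto
  have Ws: "lin_subspace ?N W" "card (leads W) = k" using W by (auto simp: IG_iff)
  note WD = lin_subspaceD[OF Ws(1)]
  define z where "z p = fst p ^ m \<cdot>\<^sub>v x + snd p ^ m \<cdot>\<^sub>v y" for p
  define f where "f p = add_line W (z p)" for p
  have zc: "z p \<in> carrier_vec ?N" for p using xy by (simp add: z_def)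
  have IG: "f p \<in> IG n (Suc k)" if p: "p \<in> P1_coords" for p
  proof -
    have "(fst p ^ m, snd p ^ m) \<noteq> (0, 0)" using p by (cases p) (auto simp: P1_coords_def)
    then have "z p \<notin> W" unfolding z_def by (rule ind)
    moreover have "omega n w (z p) = 0" if "w \<in> W" for w
      using orth[OF that] xy unfolding z_def by (simp add: omega_add_right omega_smult_right)
    ultimately show ?thesis unfolding f_def by (intro add_line_IG[OF W zc])
  qed
  obtain h where h: "is_echelon W h" using echelon_exists[OF Ws(1)] by blast
  let ?E = "echelon_frame ?N k W h"
  let ?A = "\<lambda>z. mat ?N (Suc k) (\<lambda>(i, j). if j < k then ?E $$ (i, j) else z $ i)"
  have Ec: "?E \<in> carrier_mat ?N k" by (simp add: echelon_frame_def)
  have "\<exists>c. \<forall>I. \<forall>z. pluecker n (Suc k) (?A z) I = (\<Sum>i<Suc k. c I i * z $ pick I i)"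
    by (rule choice, rule allI, rule pluecker_last_column[OF Ec])
  then obtain c where c: "\<And>I z. pluecker n (Suc k) (?A z) I = (\<Sum>i<Suc k. c I i * z $ pick I i)"
    by (elim exE) blast
  define L where "L I v = (\<Sum>i<Suc k. c I i * v $ pick I i)" for I and v :: "complex vec"
  define b where "b I j = (if j = m then L I x else if j = 0 then L I y else 0)" for I j
  have pl: "pluecker n (Suc k) (?A (z p)) I = binary_form m (b I) p"
    if I: "I \<subseteq> {..<?N}" "card I = Suc k" for I p
  proof -
    have pN: "pick I i < ?N" if "i < Suc k" for i using pick_in_set_le[of i I] I that by auto
    have "pluecker n (Suc k) (?A (z p)) I = (\<Sum>i<Suc k. c I i * z p $ pick I i)" by (rule c)
    also have "\<dots> = (\<Sum>i<Suc k. fst p ^ m * (c I i * x $ pick I i) + snd p ^ m * (c I i * y $ pick I i))"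
      using pN xy by (intro sum.cong) (auto simp: z_def algebra_simps)
    also have "\<dots> = fst p ^ m * L I x + snd p ^ m * L I y"
      unfolding sum.distrib L_def sum_distrib_left ..
    also have "\<dots> = (\<Sum>j\<le>m. (if j = m then L I x * fst p ^ m else 0) + (if j = 0 then L I y * snd p ^ m else 0))"
      unfolding sum.distrib by simp
    also have "\<dots> = binary_form m (b I) p"
      unfolding binary_form_def b_def using m by (intro sum.cong) auto
    finally show ?thesis .
  qed
  have fr: "frame n (Suc k) (f p) (?A (z p))" for p
    unfolding f_def by (rule frame_add_line[OF Ws h zc])
  have "P1_morphism n (Suc k) m f"
    unfolding P1_morphism_def
  proof (intro conjI ballI exI[of _ b])
    fix p assume "p \<in> P1_coords"
    then show "f p \<in> IG n (Suc k)" by (rule IG)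
    show "\<exists>A. frame n (Suc k) (f p) A \<and> (\<forall>I. I \<subseteq> {..<dimE n} \<and> card I = Suc k \<longrightarrow>
        pluecker n (Suc k) A I = binary_form m (b I) p)"
      using fr[of p] pl[of _ p] by blast
  qed
  moreover have "z (1, 0) = x" "z (0, 1) = y"
    using xy m by (auto simp: z_def intro!: eq_vecI)
  ultimately show ?thesis using V by (intro exI[of _ f]) (simp add: f_def)
qed

lemma constant_morphism:
  assumes V: "V \<in> IG n k"
  shows "P1_morphism n k 0 (\<lambda>_. V)"
proof -
  have Vs: "lin_subspace (dimE n) V" "card (leads V) = k" using V by (auto simp: IG_iff)
  obtain h where "is_echelon V h" using echelon_exists[OF Vs(1)] by blast
  then have fr: "frame n k V (echelon_frame (dimE n) k V h)" (is "frame n k V ?A")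
    by (rule echelon_frame_frame[OF Vs])
  have "binary_form 0 (\<lambda>_. pluecker n k ?A I) p = pluecker n k ?A I" for I p
    by (simp add: binary_form_def)
  then show ?thesis unfolding P1_morphism_def
    using V fr by (intro conjI ballI exI[of _ "\<lambda>I _. pluecker n k ?A I"] exI[of _ ?A]) auto
qed

text \<open>The hyperplane is cut out by the coordinate at the largest leading position. It thus
  loses exactly this position, and its counts agree with those of V up to there.\<close>

lemma hyperplane_exists:
  assumes V: "V \<in> IG n (Suc k)"
  shows "\<exists>W y. W \<in> IG n k \<and> W \<subseteq> V \<and> y \<in> V \<and> y \<notin> W \<and> V = add_line W y \<and>
    Max (leads V) \<notin> leads W \<and> leads V = insert (Max (leads V)) (leads W)"
proof -
  let ?N = "dimE n"
  have Vs: "lin_subspace ?N V" "card (leads V) = Suc k" and iso: "\<And>x y. x \<in> V \<Longrightarrow> y \<in> V \<Longrightarrow> omega n x y = 0"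
    using V by (auto simp: IG_iff)
  note VD = lin_subspaceD[OF Vs(1)]
  define m where "m = Max (leads V)"
  have fin: "finite (leads V)" using finite_leads[OF Vs(1)] .
  have "leads V \<noteq> {}" using Vs(2) by auto
  then have mV: "m \<in> leads V" and mmax: "\<And>p. p \<in> leads V \<Longrightarrow> p \<le> m"
    unfolding m_def using fin by auto
  have mN: "m < ?N" using mV leads_subset[OF Vs(1)] by auto
  define W where "W = {x \<in> V. x $ m = 0}"
  have Ws: "lin_subspace ?N W"
    unfolding lin_subspace_def
  proof (intro conjI ballI allI)
    show "W \<subseteq> carrier_vec ?N" "0\<^sub>v ?N \<in> W" using VD(1,3) mN by (auto simp: W_def)
  next
    fix x y assume "x \<in> W" "y \<in> W"
    then show "x + y \<in> W" using VD(4) VD(2)[of y] mN by (simp add: W_def)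
  next
    fix c x assume "x \<in> W"
    then show "c \<cdot>\<^sub>v x \<in> W" using VD(5) VD(2)[of x] mN by (simp add: W_def)
  qed
  obtain y where y: "y \<in> V" "lead_pos y m" using mV by (auto simp: leads_def)
  have yc: "y \<in> carrier_vec ?N" using VD(1)[OF y(1)] .
  have "m \<notin> leads W" by (auto simp: leads_def W_def lead_pos_def)
  have "V \<subseteq> add_line W y"
  proof
    fix x assume x: "x \<in> V"
    let ?w = "x + (- x $ m / y $ m) \<cdot>\<^sub>v y"
    have "?w \<in> V" using VD(4,5) x y(1) by blast
    moreover have "?w $ m = 0" using mN yc y(2) by (simp add: lead_pos_def)
    ultimately have "?w \<in> W" by (simp add: W_def)
    moreover have "x = ?w + (x $ m / y $ m) \<cdot>\<^sub>v y"
      using VD(2)[OF x] yc by (intro eq_vecI) (auto simp: algebra_simps)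
    ultimately show "x \<in> add_line W y" unfolding add_line_def by blast
  qed
  then have eq: "V = add_line W y"
    using add_line_least[OF Vs(1), of W y] y(1) by (auto simp: W_def)
  have leads: "leads V = insert m (leads W)"
    using leads_add_line[OF Ws yc y(2) \<open>m \<notin> leads W\<close>] eq by simp
  then have "card (leads W) = k" using \<open>m \<notin> leads W\<close> Vs(2) finite_leads[OF Ws] by simp
  then have "W \<in> IG n k" using Ws iso by (auto simp: IG_iff W_def)
  moreover have "y \<notin> W" using y by (auto simp: W_def lead_pos_def)
  ultimately show ?thesis
    using y(1) eq leads \<open>m \<notin> leads W\<close> unfolding m_def W_def by blast
qed

text \<open>The unit vector at i is orthogonal to the coordinate subspace on \<open>leads W\<close>,
  because the partner of i is not among these positions. The isometry g carries this over to W and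
  keeps the lead.\<close>

lemma orthogonal_vector:
  assumes W: "W \<in> IG n k" and g: "g \<in> borel n" "W = (\<lambda>x. g *\<^sub>v x) ` coord_space (dimE n) (leads W)"
    and i: "i \<le> 2 * n" "i \<notin> leads W" "2 * n + 1 - i \<notin> leads W"
  defines "x \<equiv> g *\<^sub>v unit_vec (dimE n) i"
  shows "x \<in> carrier_vec (dimE n)" "lead_pos x i" "x \<notin> W" "\<And>w. w \<in> W \<Longrightarrow> omega n w x = 0"
proof -
  let ?N = "dimE n"
  have iN: "i < ?N" using i by (simp add: dimE_def)
  show "x \<in> carrier_vec ?N" using borelD(1)[OF g(1)] by (simp add: x_def)
  have "lead_pos (unit_vec ?N i) i" using iN by (auto simp: lead_pos_def)
  then show l: "lead_pos x i" unfolding x_def using lead_pos_borel[OF g(1), of "unit_vec ?N i"] by simp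
  show "x \<notin> W" using l i(2) by (auto simp: leads_def)
  fix w assume "w \<in> W"
  then have "w \<in> (\<lambda>x. g *\<^sub>v x) ` coord_space ?N (leads W)" using g(2) by blast
  then obtain u where u: "u \<in> coord_space ?N (leads W)" "w = g *\<^sub>v u" by blast
  have "omega n w x = omega n u (unit_vec ?N i)"
    unfolding u(2) x_def using u(1) by (intro borelD(3)[OF g(1)]) (auto simp: coord_space_def)
  also have "\<dots> = 0"
    unfolding omega_unit_right[OF iN] using u(1) i(3) by (auto simp: coord_space_def dimE_def)
  finally show "omega n w x = 0" .
qed

lemma IG_bruhat:
  assumes "W \<in> IG n k"
  shows "admissible n (leads W)" "\<exists>g\<in>borel n. W = (\<lambda>x. g *\<^sub>v x) ` coord_space (dimE n) (leads W)"
  using assms isotropic_leads_admissible bruhat_cell by (auto simp: IG_iff)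

text \<open>V' and the point found share the hyperplane W, so they are equal or adjacent;
  \<open>exists_free_index\<close> says where the second extension of W should lead.\<close>

lemma line_into_schubert:
  assumes V: "V' \<in> IG n (Suc k)" and S: "admissible n S" "card S = Suc k" "0 \<notin> S"
    and near: "\<And>j. cnt S j \<le> cnt (leads V') j + 1"
  shows "\<exists>V\<in>IG n (Suc k). dominated (leads V) S \<and> (V = V' \<or> (V, V') \<in> line_adj n (Suc k))"
proof -
  let ?N = "dimE n"
  obtain W y where W: "W \<in> IG n k" "W \<subseteq> V'" "y \<in> V'" "y \<notin> W" "V' = add_line W y"
    "Max (leads V') \<notin> leads W" "leads V' = insert (Max (leads V')) (leads W)"
    using hyperplane_exists[OF V] by blast
  have Ws: "lin_subspace ?N W" "card (leads W) = k" using W(1) by (auto simp: IG_iff)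
  have Vs: "lin_subspace ?N V'" and iso: "\<And>x y. x \<in> V' \<Longrightarrow> y \<in> V' \<Longrightarrow> omega n x y = 0"
    using V by (auto simp: IG_iff)
  obtain g where g: "g \<in> borel n" "W = (\<lambda>x. g *\<^sub>v x) ` coord_space ?N (leads W)"
    using IG_bruhat(2)[OF W(1)] by blast
  \<comment> \<open>Up to the largest lead of V' the counts of W and V' agree. Beyond it W has all
    of its k positions, and S has only k+1 elements in total.\<close>
  have near': "cnt S j \<le> cnt (leads W) j + 1" for j
  proof (cases "Max (leads V') < j")
    case False
    then show ?thesis using near[of j] cnt_insert[OF W(6), of j] W(7) by simp
  next
    case True
    have "leads V' \<subseteq> {..<j}"
    proof
      fix p assume "p \<in> leads V'"
      then have "p \<le> Max (leads V')" using finite_leads[OF Vs] by simp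
      then show "p \<in> {..<j}" using True by simp
    qed
    then have "leads W \<subseteq> {..<j}" using W(7) by blast
    then have "cnt (leads W) j = k" using cnt_full Ws(2) by blast
    moreover have "cnt S j \<le> card S"
      unfolding cnt_def by (rule card_mono[OF admissible_finite[OF S(1)]]) auto
    ultimately show ?thesis using S(2) by simp
  qed
  obtain i where i: "i \<le> 2 * n" "i \<notin> leads W" "2 * n + 1 - i \<notin> leads W" "dominated (insert i (leads W)) S"
    using exists_free_index[OF IG_bruhat(1)[OF W(1)] S(1,3) _ near'] Ws(2) S(2) by auto
  define x where "x = g *\<^sub>v unit_vec ?N i"
  have x: "x \<in> carrier_vec ?N" "lead_pos x i" "x \<notin> W" "\<And>w. w \<in> W \<Longrightarrow> omega n w x = 0"
    unfolding x_def using orthogonal_vector[OF W(1) g i(1-3)] by auto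
  have "add_line W x \<in> IG n (Suc k)" by (rule add_line_IG[OF W(1) x(1,3,4)])
  moreover have "dominated (leads (add_line W x)) S"
    using leads_add_line[OF Ws(1) x(1,2) i(2)] i(4) by simp
  moreover have "(add_line W x, add_line W y) \<in> line_adj n (Suc k)" if "add_line W x \<noteq> add_line W y"
    by (rule line_adjI[OF _ x(1,3) lin_subspaceD(1)[OF Vs W(3)] W(4) x(4) _ that])
      (use W(1-3) iso in auto)
  then have "add_line W x = V' \<or> (add_line W x, V') \<in> line_adj n (Suc k)" using W(5) by blast
  ultimately show ?thesis by blast
qed

text \<open>The k leads of W and their partners cannot fill 1..2n, as k < n. This leaves a pair of
  partners outside, and at most one of the two is a lead of V; the other gives a second extension of
  W. The line serves as a tail that raises the degree.\<close>

lemma line_through: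
  assumes V: "V \<in> IG n (Suc k)" and k: "Suc k \<le> n"
  shows "\<exists>V'. (V, V') \<in> line_adj n (Suc k)"
proof -
  let ?N = "dimE n" and ?b = "\<lambda>i. 2 * n + 1 - i"
  obtain W y where W: "W \<in> IG n k" "W \<subseteq> V" "y \<in> V" "y \<notin> W" "V = add_line W y"
    using hyperplane_exists[OF V] by blast
  have Ws: "lin_subspace ?N W" "card (leads W) = k" using W(1) by (auto simp: IG_iff)
  have Vs: "lin_subspace ?N V" and iso: "\<And>x y. x \<in> V \<Longrightarrow> y \<in> V \<Longrightarrow> omega n x y = 0"
    using V by (auto simp: IG_iff)
  obtain g where g: "g \<in> borel n" "W = (\<lambda>x. g *\<^sub>v x) ` coord_space ?N (leads W)"
    using IG_bruhat(2)[OF W(1)] by blast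
  have fin: "finite (leads W)" using finite_leads[OF Ws(1)] .
  have "card (leads W \<union> ?b ` leads W) \<le> k + k"
    using card_Un_le[of "leads W" "?b ` leads W"] card_image_le[OF fin, of ?b] Ws(2) by linarith
  then have "\<not> {1..2 * n} \<subseteq> leads W \<union> ?b ` leads W"
    using card_mono[of "leads W \<union> ?b ` leads W" "{1..2 * n}"] fin k by auto
  then obtain i where i: "i \<in> {1..2 * n}" "i \<notin> leads W" "i \<notin> ?b ` leads W" by blast
  have bi: "?b i \<notin> leads W" using i by (metis atLeastAtMost_iff diff_diff_cancel image_eqI le_add1 le_trans)
  have bbi: "?b (?b i) = i" using i by auto
  have "\<exists>j. j \<le> 2 * n \<and> j \<notin> leads W \<and> ?b j \<notin> leads W \<and> j \<notin> leads V"
  proof (cases "i \<in> leads V")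
    case True
    then have "?b i \<notin> leads V" using IG_bruhat(1)[OF V] by (auto simp: admissible_def)
    then show ?thesis using i bi bbi by (intro exI[of _ "?b i"]) auto
  next
    case False
    then show ?thesis using i bi by (intro exI[of _ i]) auto
  qed
  then obtain j where j: "j \<le> 2 * n" "j \<notin> leads W" "?b j \<notin> leads W" "j \<notin> leads V" by blast
  define x where "x = g *\<^sub>v unit_vec ?N j"
  have x: "x \<in> carrier_vec ?N" "lead_pos x j" "x \<notin> W" "\<And>w. w \<in> W \<Longrightarrow> omega n w x = 0"
    unfolding x_def using orthogonal_vector[OF W(1) g j(1-3)] by auto
  have "x \<notin> V" using x(2) j(4) by (auto simp: leads_def)
  then have ne: "add_line W y \<noteq> add_line W x" using add_line_subspace(3)[OF Ws(1) x(1)] W(5) by blast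
  have "(add_line W y, add_line W x) \<in> line_adj n (Suc k)"
    by (rule line_adjI[OF _ lin_subspaceD(1)[OF Vs W(3)] W(4) x(1,3) _ x(4) ne])
      (use W(1-3) iso in auto)
  then have "(V, add_line W x) \<in> line_adj n (Suc k)" using W(5) by simp
  then show ?thesis by blast
qed

text \<open>Built backwards from V': each step goes to a point that satisfies the conditions of one
  lift fewer, and it may stay where it is, so the chain can be shorter than d.\<close>

lemma line_chain:
  assumes S: "\<And>e. admissible n ((lift_min n ^^ e) S)" "\<And>e. card ((lift_min n ^^ e) S) = Suc k"
      "\<And>e. 0 \<notin> (lift_min n ^^ e) S"
  shows "V' \<in> IG n (Suc k) \<Longrightarrow> dominated (leads V') ((lift_min n ^^ d) S) \<Longrightarrow>
    \<exists>l\<le>d. \<exists>V\<in>IG n (Suc k). dominated (leads V) S \<and> (V, V') \<in> line_adj n (Suc k) ^^ l"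
proof (induction d arbitrary: V')
  case 0
  then show ?case by auto
next
  case (Suc d)
  let ?S = "(lift_min n ^^ d) S"
  have sub: "?S \<subseteq> {..2 * n}" "?S \<noteq> {}" using S(1)[of d] S(2)[of d] by (auto simp: admissible_def)
  have "cnt ?S j \<le> cnt (leads V') j + 1" for j
    using cnt_lift_min_ge[OF sub, of j] Suc.prems(2) unfolding dominated_def
    by (metis add_le_mono1 comp_apply funpow.simps(2) order_trans)
  then obtain U where U: "U \<in> IG n (Suc k)" "dominated (leads U) ?S"
    "U = V' \<or> (U, V') \<in> line_adj n (Suc k)"
    using line_into_schubert[OF Suc.prems(1) S(1,2,3)] by blast
  then obtain l V where l: "l \<le> d" "V \<in> IG n (Suc k)" "dominated (leads V) S"
    "(V, U) \<in> line_adj n (Suc k) ^^ l"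
    using Suc.IH by blast
  from U(3) show ?case
  proof
    assume "U = V'"
    then show ?thesis using l by (intro exI[of _ l]) auto
  next
    assume "(U, V') \<in> line_adj n (Suc k)"
    then have "(V, V') \<in> line_adj n (Suc k) ^^ Suc l" using l(4) by auto
    then show ?thesis using l by (intro exI[of _ "Suc l"]) auto
  qed
qed

section \<open>Curve neighborhoods\<close>

lemma eval_mark_curve_nbhd:
  assumes "C \<in> stable_maps n k d" "eval_mark 1 C \<in> Y"
  shows "eval_mark 2 C \<in> curve_nbhd n k d Y"
  using assms by (auto simp: curve_nbhd_def)

text \<open>Both markings lie on a component contracted to V. The node of a tail of degree d is its
  third special point and makes it stable.\<close>

lemma curve_nbhd_self:
  assumes V: "V \<in> Y" "V \<in> IG n (Suc k)" and k: "Suc k \<le> n" and d: "1 \<le> d"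
  shows "V \<in> curve_nbhd n (Suc k) d Y"
proof -
  obtain V' where adj: "(V, V') \<in> line_adj n (Suc k)" using line_through[OF V(2) k] by blast
  obtain f where f: "P1_morphism n (Suc k) d f" "f (1, 0) = V" using line_morphism[OF adj d] by blast
  define C where "C = \<lparr>comps = {0, 1 :: nat}, adj = {(0, 1), (1, 0)},
    node = (\<lambda>u v. if u = 0 then (1, 1) else (1, 0)), mark_comp = (\<lambda>i. 0),
    mark_pt = (\<lambda>i. if i = 1 then (1, 0) else (0, 1)),
    cmap = (\<lambda>v. if v = 0 then (\<lambda>_. V) else f), cdeg = (\<lambda>v. if v = 0 then 0 else d)\<rparr>"
  have "tree_of_lines C"
    unfolding tree_of_lines_def C_def by (auto simp: sym_def irrefl_def)
  moreover have sp: "specials C 0 = {Inl 1, Inr 1, Inr 2}" "specials C 1 = {Inl 0}"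
    by (auto simp: specials_def C_def)
  then have "card (specials C 0) = 3" by simp
  ultimately have "C \<in> stable_maps n (Suc k) d"
    unfolding stable_maps_def
    using f sp constant_morphism[OF V(2)] d
    by (auto simp: C_def special_pt_def P1_coords_def P1_eq_def)
  moreover have "eval_mark 1 C = V" "eval_mark 2 C = V" by (auto simp: eval_mark_def C_def)
  ultimately show ?thesis using eval_mark_curve_nbhd[of C] V(1) by metis
qed

lemma curve_nbhd_chain:
  assumes V: "V \<in> Y" "(V, V') \<in> line_adj n (Suc k) ^^ Suc l" and l: "Suc l \<le> d"
  shows "V' \<in> curve_nbhd n (Suc k) d Y"
proof -
  obtain U where U: "U 0 = V" "U (Suc l) = V'"
    "\<And>i. i \<le> l \<Longrightarrow> (U i, U (Suc i)) \<in> line_adj n (Suc k)"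
    using V(2) unfolding relpow_fun_conv by (auto simp: less_Suc_eq_le)
  \<comment> \<open>The l+1 components must have total degree d: the first has d - l, each of the
    others 1.\<close>
  define e where "e i = (if i = 0 then d - l else 1)" for i :: nat
  have e: "1 \<le> e i" for i using l by (auto simp: e_def)
  have "\<exists>f. P1_morphism n (Suc k) (e i) f \<and> f (1, 0) = U i \<and> f (0, 1) = U (Suc i)" if "i \<le> l" for i
    using line_morphism[OF U(3)[OF that] e] .
  then obtain f where f: "\<And>i. i \<le> l \<Longrightarrow> P1_morphism n (Suc k) (e i) (f i)"
    "\<And>i. i \<le> l \<Longrightarrow> f i (1, 0) = U i" "\<And>i. i \<le> l \<Longrightarrow> f i (0, 1) = U (Suc i)" by metis
  define C where "C = \<lparr>comps = {..l}, adj = {(u, v). u \<le> l \<and> v \<le> l \<and> (v = Suc u \<or> u = Suc v)},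
    node = (\<lambda>u v. if v = Suc u then (0, 1) else (1, 0)),
    mark_comp = (\<lambda>i. if i = 1 then 0 else l),
    mark_pt = (\<lambda>i. if i = 1 then (1, 0) else (0, 1)), cmap = f, cdeg = e\<rparr>"
  have sel: "comps C = {..l}" "adj C = {(u, v). u \<le> l \<and> v \<le> l \<and> (v = Suc u \<or> u = Suc v)}"
    "mark_comp C 1 = 0" "mark_comp C 2 = l" "mark_pt C 1 = (1, 0)" "mark_pt C 2 = (0, 1)"
    "cmap C = f" "cdeg C = e" "\<And>u v. node C u v = (if v = Suc u then (0, 1) else (1, 0))"
    by (auto simp: C_def)
  have tree: "tree_of_lines C"
    unfolding tree_of_lines_def
  proof (intro conjI ballI)
    show symC: "sym (adj C)" by (auto simp: sym_def sel)
    have reach: "(0, v) \<in> (adj C)\<^sup>*" if "v \<le> l" for v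
      using that
    proof (induction v)
      case (Suc v)
      then have "(v, Suc v) \<in> adj C" by (simp add: sel)
      then show ?case using Suc by auto
    qed simp
    fix u v assume "u \<in> comps C" "v \<in> comps C"
    then have "(0, u) \<in> (adj C)\<^sup>*" "(0, v) \<in> (adj C)\<^sup>*" using reach by (auto simp: sel)
    then show "(u, v) \<in> (adj C)\<^sup>*"
      using sym_rtrancl[OF symC] by (meson rtrancl_trans symD)
  next
    have "adj C = (\<lambda>i. (i, Suc i)) ` {..<l} \<union> (\<lambda>i. (Suc i, i)) ` {..<l}" by (auto simp: sel)
    moreover have "card ((\<lambda>i. (i, Suc i)) ` {..<l} \<union> (\<lambda>i. (Suc i, i)) ` {..<l}) =
        card ((\<lambda>i. (i, Suc i)) ` {..<l}) + card ((\<lambda>i. (Suc i, i)) ` {..<l})"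
      by (rule card_Un_disjoint) auto
    moreover have "card ((\<lambda>i. (i, Suc i)) ` {..<l}) = l" "card ((\<lambda>i. (Suc i, i)) ` {..<l}) = l"
      by (simp_all add: card_image inj_on_def)
    ultimately show "card (adj C) = 2 * (card (comps C) - 1)" by (simp add: sel)
  qed (auto simp: sel irrefl_def)
  have pt: "special_pt C v a = (1, 0) \<and> (a = Inr 1 \<and> v = 0 \<or> (\<exists>u. a = Inl u \<and> v = Suc u)) \<or>
      special_pt C v a = (0, 1) \<and> (a = Inr 2 \<and> v = l \<or> a = Inl (Suc v) \<and> Suc v \<le> l)"
    if "v \<le> l" "a \<in> specials C v" for v a
    using that by (auto simp: specials_def special_pt_def sel simp del: One_nat_def)
  have coords: "special_pt C v a \<in> P1_coords" if "v \<le> l" "a \<in> specials C v" for v a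
    using pt[OF that] by (auto simp: P1_coords_def)
  have distinct: "\<not> P1_eq (special_pt C v a) (special_pt C v b)"
    if v: "v \<le> l" and ab: "a \<in> specials C v" "b \<in> specials C v" "a \<noteq> b" for v a b
    using pt[OF v ab(1)] pt[OF v ab(2)] ab(3) by (auto simp: P1_eq_def)
  have glue: "cmap C u (node C u v) = cmap C v (node C v u)" if "(u, v) \<in> adj C" for u v
    using that f(2,3) by (auto simp: sel)
  have total: "(\<Sum>v\<in>comps C. cdeg C v) = d"
  proof -
    have "(\<Sum>v\<le>l. e v) = e 0 + (\<Sum>v\<in>{1..l}. e v)"
      by (simp add: sum.atMost_shift sum.atLeast1_atMost_eq atMost_atLeast0 sum.atLeast_Suc_atMost)
    also have "(\<Sum>v\<in>{1..l}. e v) = l" by (simp add: e_def)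
    finally show ?thesis using l by (simp add: sel e_def)
  qed
  have pos: "cdeg C v \<noteq> 0" for v using e[of v] by (simp add: sel)
  have "C \<in> stable_maps n (Suc k) d"
    unfolding stable_maps_def
  proof (intro CollectI conjI ballI impI)
    show "tree_of_lines C" "(\<Sum>v\<in>comps C. cdeg C v) = d" by (fact tree, fact total)
    show "mark_comp C 1 \<in> comps C" "mark_comp C 2 \<in> comps C" unfolding sel by simp_all
  next
    fix v a assume "v \<in> comps C" "a \<in> specials C v"
    then show "special_pt C v a \<in> P1_coords" using coords by (simp add: sel(1))
  next
    fix v a b assume "v \<in> comps C" "a \<in> specials C v" "b \<in> specials C v" "a \<noteq> b"
    then show "\<not> P1_eq (special_pt C v a) (special_pt C v b)" using distinct by (simp add: sel(1))
  next
    fix v assume "v \<in> comps C"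
    then show "P1_morphism n (Suc k) (cdeg C v) (cmap C v)" using f(1) by (simp add: sel)
  next
    fix x assume "x \<in> adj C"
    then show "case x of (u, v) \<Rightarrow> cmap C u (node C u v) = cmap C v (node C v u)"
      using glue by (cases x) simp
  next
    fix v assume "cdeg C v = 0"
    then show "3 \<le> card (specials C v)" using pos by blast
  qed
  moreover have "eval_mark 1 C = V" "eval_mark 2 C = V'"
    using f(2)[of 0] f(3)[of l] U(1,2) unfolding eval_mark_def sel by simp_all
  ultimately show ?thesis using eval_mark_curve_nbhd[of C] V(1) by metis
qed

text \<open>Curves bound the loss of rank by d, which \<open>dominated_funpow_lift_min\<close> turns
  into domination by the d-fold lift. The reverse inclusion realises a chain of lines as a stable
  map.\<close>

lemma curve_nbhd_dominated:
  assumes k: "1 \<le> k" "k \<le> n" and d: "1 \<le> d"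
    and S: "\<And>e. admissible n ((lift_min n ^^ e) S)" "\<And>e. card ((lift_min n ^^ e) S) = k"
      "\<And>e. 0 \<notin> (lift_min n ^^ e) S"
  shows "curve_nbhd n k d {V \<in> IG n k. dominated (leads V) S} =
    {V \<in> IG n k. dominated (leads V) ((lift_min n ^^ d) S)}"
proof
  let ?Y = "{V \<in> IG n k. dominated (leads V) S}"
  show "curve_nbhd n k d ?Y \<subseteq> {V \<in> IG n k. dominated (leads V) ((lift_min n ^^ d) S)}"
  proof
    fix V' assume "V' \<in> curve_nbhd n k d ?Y"
    then obtain C where C: "C \<in> stable_maps n k d" "eval_mark 1 C \<in> ?Y" "V' = eval_mark 2 C"
      by (auto simp: curve_nbhd_def)
    have V': "V' \<in> IG n k" using eval_mark_IG[OF C(1), of 2] C(3) by simp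
    have "cnt S j \<le> cnt (leads V') j + d" for j
      using stable_map_cnt_le[OF C(1), of j] C(2,3) unfolding dominated_def
      by (metis (mono_tags, lifting) le_trans mem_Collect_eq)
    moreover have "leads V' \<subseteq> {..2 * n}" "card (leads V') = k"
      using V' leads_subset[of "dimE n" V'] by (auto simp: IG_iff dimE_def less_Suc_eq_le)
    moreover have "S \<subseteq> {..2 * n}" "S \<noteq> {}" "card S = k"
      using S(1)[of 0] S(2)[of 0] k by (auto simp: admissible_def)
    ultimately have "dominated (leads V') ((lift_min n ^^ d) S)"
      by (intro dominated_funpow_lift_min) auto
    then show "V' \<in> {V \<in> IG n k. dominated (leads V) ((lift_min n ^^ d) S)}" using V' by simp
  qed
  show "{V \<in> IG n k. dominated (leads V) ((lift_min n ^^ d) S)} \<subseteq> curve_nbhd n k d ?Y"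
  proof
    fix V' assume "V' \<in> {V \<in> IG n k. dominated (leads V) ((lift_min n ^^ d) S)}"
    then have V': "V' \<in> IG n k" "dominated (leads V') ((lift_min n ^^ d) S)" by auto
    obtain k' where k': "k = Suc k'" using k by (cases k) auto
    obtain l V where l: "l \<le> d" "V \<in> IG n k" "dominated (leads V) S" "(V, V') \<in> line_adj n k ^^ l"
      using line_chain[of n S k' V' d] S V' unfolding k' by blast
    then have V: "V \<in> ?Y" by simp
    show "V' \<in> curve_nbhd n k d ?Y"
    proof (cases l)
      case 0
      then have "V' = V" using l(4) by simp
      then show ?thesis using curve_nbhd_self[of V ?Y n k' d] V l(2) k d unfolding k' by simp
    next
      case (Suc l')
      have "(V, V') \<in> line_adj n (Suc k') ^^ Suc l'" "Suc l' \<le> d"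
        using l(1,4) unfolding k' Suc by blast+
      then show ?thesis unfolding k' by (rule curve_nbhd_chain[OF V[unfolded k']])
    qed
  qed
qed

section \<open>Subspaces that avoid the kernel of the form\<close>

lemma first_unit_vec_mem:
  assumes V: "V \<in> IG n k" and "0 \<in> leads V"
  shows "ev n 1 \<in> V"
proof -
  have Vs: "lin_subspace (dimE n) V" using V by (simp add: IG_iff)
  obtain x where x: "x \<in> V" "lead_pos x 0" using assms(2) by (auto simp: leads_def)
  have "dim_vec x = dimE n" using lin_subspaceD(2)[OF Vs x(1)] .
  then have "(1 / x $ 0) \<cdot>\<^sub>v x = ev n 1"
    using x(2) by (intro eq_vecI) (auto simp: ev_def lead_pos_def unit_vec_def)
  then show ?thesis using lin_subspaceD(5)[OF Vs x(1), of "1 / x $ 0"] by simp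
qed

text \<open>Folding 1..2n along partners maps S injectively into 1..n. Isotropic subspaces without
  e_1 therefore have dimension at most n.\<close>

lemma card_admissible_le:
  assumes S: "admissible n S" and "0 \<notin> S"
  shows "card S \<le> n"
proof -
  let ?h = "\<lambda>i. min i (2 * n + 1 - i)"
  have "inj_on ?h S"
  proof (rule inj_onI)
    fix x y assume xy: "x \<in> S" "y \<in> S" "?h x = ?h y"
    have "x \<le> 2 * n" "y \<le> 2 * n" "y \<noteq> 2 * n + 1 - x"
      using S xy(1,2) by (auto simp: admissible_def)
    then show "x = y" using xy(3) by (auto simp: min_def split: if_splits)
  qed
  moreover have "?h ` S \<subseteq> {1..n}"
  proof
    fix y assume "y \<in> ?h ` S"
    then obtain x where "x \<in> S" "y = ?h x" by blast
    moreover have "x \<noteq> 0" "x \<le> 2 * n" using calculation assms by (auto simp: admissible_def intro: gr0I)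
    ultimately show "y \<in> {1..n}" by auto
  qed
  ultimately have "card S \<le> card {1..n}" by (rule card_inj_on_le) simp
  then show ?thesis by simp
qed

theorem proposition4p9:
  fixes n k d :: nat and w :: "nat \<Rightarrow> nat"
  assumes "1 \<le> k" and "k \<le> n + 1"
    and "w \<in> min_reps n k \<inter> weyl_odd n"
    and "schubert n k w \<inter> IG_open n k \<noteq> {}"
    and "1 \<le> d"
  shows "curve_nbhd n k d (schubert n k w) = schubert n k (hecke_O n k d w)"
proof -
  have W: "w \<in> weyl n" and odd: "\<And>i. i \<in> {1..k} \<Longrightarrow> w i \<noteq> 2 * n + 2"
    using assms(2,3) by (auto simp: weyl_odd_def bar_def)
  have sch: "schubert n k w = {V \<in> IG n k. dominated (leads V) (index_set k w)}"
    by (rule schubert_eq) (rule index_set_admissible[OF W assms(2) odd], assumption)+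
  obtain V where V: "V \<in> IG n k" "dominated (leads V) (index_set k w)" "ev n 1 \<notin> V"
    using assms(4) unfolding sch IG_open_def by blast
  have zero: "0 \<notin> leads V" using first_unit_vec_mem[OF V(1)] V(3) by blast
  have kn: "k \<le> n"
    using card_admissible_le[OF IG_bruhat(1)[OF V(1)] zero] V(1) by (simp add: IG_iff)
  \<comment> \<open>If 1 were among the values, the rank condition at j = 1 would put e_1 into every
    point of X(w), including V.\<close>
  have ne1: "w i \<noteq> 1" if i: "i \<in> {1..k}" for i
  proof
    assume "w i = 1"
    then have "0 \<in> index_set k w" using i by (force simp: index_set_def)
    then have "cnt (index_set k w) 1 = 1" using cnt_Suc[of "index_set k w" 0] by simp
    then have "1 \<le> cnt (leads V) 1" using V(2) unfolding dominated_def by metis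
    then show False using zero cnt_Suc[of "leads V" 0] by simp
  qed
  have one: "w (Suc k) = 1" by (rule min_reps_one[OF assms(3,1) kn ne1])
  have step: "hecke_O n k e w \<in> weyl n" "hecke_O n k e w (Suc k) = 1"
    "index_set k (hecke_O n k e w) = (lift_min n ^^ e) (index_set k w)" for e
    using hecke_O_index_set[OF W assms(1) kn one, of e] by auto
  have adm: "admissible n (index_set k (hecke_O n k e w))" "card (index_set k (hecke_O n k e w)) = k"
    "0 \<notin> index_set k (hecke_O n k e w)" for e
    using index_set_admissible[OF step(1) assms(2), of e] zero_notin_index_set[OF step(1) assms(2), of e]
      weyl_fixing_kernel[OF step(1) kn step(2), of _ e] by auto
  show ?thesis
    unfolding sch schubert_eq[OF adm(1,2)] step(3)
    by (rule curve_nbhd_dominated[OF assms(1) kn assms(5)]) (use adm step(3) in auto)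
qed

end
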